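(* Assume the following. (1) The weighted digraph $\mathcal G$ is strongly connected (it need not be weight-balanced). (2) For each $i\in\mathcal V$ the nonlinearity $f_i$ satisfies, for all $x_i,x_i^{(1)},\dots,x_i^{(n-1)},\check x_i,\check x_i^{(1)},\dots,\check x_i^{(n-1)}\in\mathbb R^m$, $$\|f_i(x_i,x_i^{(1)},\dots,x_i^{(n-1)},w_i)-f_i(\check x_i,\check x_i^{(1)},\dots,\check x_i^{(n-1)},w_i)\|\le l_x\|x_i-\check x_i\|+\sum_{l=1}^{n-1}l_{x^{(l)}}\|x_i^{(l)}-\check x_i^{(l)}\|,$$ with constants $l_x,l_{x^{(l)}}\ge 0$. (3) For each $i\in\mathcal V$, $J_i(x_i,x_{-i})$ is continuously differentiable in $x$ and convex in $x_i$ for every fixed $x_{-i}$. (4) The pseudo-gradient $\mathcal F$ is $\omega$-strongly monotone and $\theta$-Lipschitz continuous for some $\omega,\theta>0$. Let $k_1,\dots,k_{n-1}$ be real numbers such that all roots of $s^{n-1}+k_{n-1}s^{n-2}+\dots+k_2s+k_1$ lie in the open left half plane, and let $\beta_1,\dots,\beta_n$ be real numbers such that all roots of $s^n+\beta_1s^{n-1}+\dots+\beta_{n-1}s+\beta_n$ lie in the open left half plane. Then there exist positive constants $\alpha_1,\alpha_2,\alpha_3,\varepsilon,\mu$ such that the players with $n$th-order nonlinear dynamics under the output-based algorithm (both given in the context) exponentially converge to the Nash equilibrium $x^*$ of the game: there is $\lambda>0$ such that for every solution of the closed-loop system there is $C>0$ with $\|x(t)-x^*\|\le Ce^{-\lambda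 t}$ for all $t\ge 0$, where $x(t)=(x_1(t),\dots,x_N(t))$.
   Context: Graph. $\mathcal G$ is a weighted digraph on $\mathcal V=\{1,\dots,N\}$ with adjacency matrix $[a_{ij}]$, where $a_{ij}>0$ if $i$ receives information from $j$, $a_{ij}=0$ otherwise, and $a_{ii}=0$. Game. Player $i\in\mathcal V$ has decision $x_i\in\mathbb R^m$ and differentiable cost $J_i(x_i,x_{-i}):\mathbb R^{Nm}\to\mathbb R$, where $x_{-i}=(x_1,\dots,x_{i-1},x_{i+1},\dots,x_N)$, and solves $\min_{x_i\in\mathbb R^m}J_i(x_i,x_{-i})$. A profile $x^*=(x_1^*,\dots,x_N^* )$ is a Nash equilibrium if $J_i(x_i^*,x_{-i}^* )\le J_i(x_i,x_{-i}^* )$ for all $x_i\in\mathbb R^m$ and all $i\in\mathcal V$. The pseudo-gradient is $\mathcal F(x)=\big(\nabla_{x_1}J_1(x_1,x_{-1}),\dots,\nabla_{x_N}J_N(x_N,x_{-N})\big)\in\mathbb R^{Nm}$. A map $F$ is $\omega$-strongly monotone if $(x-y)^T(F(x)-F(y))\ge\omega\|x-y\|^2$ for all $x,y$, and $\theta$-Lipschitz if $\|F(x)-F(y)\|\le\theta\|x-y\|$ for all $x,y$. Under hypotheses (3) and (4) the game has exactly one Nash equilibrium. Dynamics. With $n\ge 1$, player $i$ obeys $x_i^{(n)}=f_i(x_i,x_i^{(1)},\dots,x_i^{(n-1)},w_i)+u_i$, where $x_i^{(l)}$ is the $l$th time derivative of $x_i$, $w_i\in\mathbb{R}^{n_{w_i}}$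 is an (unknown) constant parameter, $f_i(\cdot,\dots,\cdot,w_i):(\mathbb R^m)^n\to\mathbb R^m$, and $u_i\in\mathbb R^m$ is the control input. Output-based algorithm. For $i,j\in\mathcal V$, $$u_i=-\sum_{l=1}^{n-1}\varepsilon^{n-l}k_lz_i^{(l)}-\alpha_1\nabla_{x_i}J_i(x_i,\hat x_{-i})-\alpha_2y_i,$$ $$\dot y_i=\sum_{l=1}^{n-1}\varepsilon^{1-l}k_lz_i^{(l)}+\frac{\alpha_1}{\varepsilon^{n-1}}\nabla_{x_i}J_i(x_i,\hat x_{-i}),$$ $$\dot z_i^{(l)}=z_i^{(l+1)}+\frac{\varepsilon^{l+1}\beta_{l+1}}{\mu^{l+1}}(x_i-z_i)\quad(0\le l\le n-2),\qquad \dot z_i^{(n-1)}=\frac{\varepsilon^n\beta_n}{\mu^n}(x_i-z_i),$$ $$\dot{\hat x}^i_j=-\alpha_3\Big(\sum_{k=1}^Na_{ik}(\hat x^i_j-\hat x^k_j)+a_{ij}(\hat x^i_j-x_j)\Big),$$ where $z_i^{(0)}=z_i$ and $z_i,z_i^{(1)},\dots,z_i^{(n-1)}\in\mathbb R^m$ are independent observer state variables (the superscript on $z_i$ is an index, not a time derivative), $y_i\in\mathbb R^m$, $\hat x^i_j\in\mathbb R^m$ is player $i$'s estimate of $x_j$, and $\hat x_{-i}=(\hat x_1^i,\dots,\hat x_{i-1}^i,\hat x_{i+1}^i,\dots,\hat x_N^i)$; $\nabla_{x_i}J_i(x_i,\hat x_{-i})$ is the gradient of $J_i$ in its own decision evaluated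 at $(x_i,\hat x_{-i})$. The closed-loop system has state consisting of all $x_i,x_i^{(1)},\dots,x_i^{(n-1)},z_i,z_i^{(1)},\dots,z_i^{(n-1)},y_i,\hat x^i_j$. Empty sums are zero. *)

theory Defs
  imports "Graph_Theory.Digraph_Component" "HOL-Analysis.Analysis"
begin

text \<open>
  Players are the elements of a finite type \<open>'p\<close> (so \<open>N = CARD('p)\<close>), decisions live in
  \<open>real ^ 'm\<close>, and a profile is an element of \<open>real ^ 'm ^ 'p\<close>, whose norm is the Euclidean
  norm of the stacked vector.
\<close>

text \<open>Information flows from \<open>j\<close> to \<open>i\<close> along an arc of positive weight \<open>a i j\<close>.\<close>

definition comm_digraph :: "('p \<Rightarrow> 'p \<Rightarrow> real) \<Rightarrow> ('p, 'p \<times> 'p) pre_digraph" where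
  "comm_digraph a = \<lparr>verts = UNIV, arcs = {(j, i). a i j > 0}, tail = fst, head = snd\<rparr>"

text \<open>\<open>with_own x i v\<close> is the profile \<open>(v, x\<^bsub>-i\<^esub>)\<close>.\<close>

definition with_own :: "real ^ 'm ^ 'p \<Rightarrow> 'p \<Rightarrow> real ^ 'm \<Rightarrow> real ^ 'm ^ 'p" where
  "with_own x i v = (\<chi> j. if j = i then v else x $ j)"

text \<open>The block gradient of \<open>J i\<close> in player \<open>i\<close>'s own decision, at the profile \<open>x\<close>.\<close>

definition own_gradient ::
    "('p \<Rightarrow> real ^ 'm ^ 'p \<Rightarrow> real) \<Rightarrow> 'p \<Rightarrow> real ^ 'm ^ 'p \<Rightarrow> real ^ 'm" where
  "own_gradient J i x = (THE g. GDERIV (\<lambda>v. J i (with_own x i v)) (x $ i) :> g)"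

definition pseudo_gradient ::
    "('p::finite \<Rightarrow> real ^ 'm ^ 'p \<Rightarrow> real) \<Rightarrow> real ^ 'm ^ 'p \<Rightarrow> real ^ 'm ^ 'p" where
  "pseudo_gradient J x = (\<chi> i. own_gradient J i x)"

definition continuously_differentiable :: "('a::real_inner \<Rightarrow> real) \<Rightarrow> bool" where
  "continuously_differentiable h \<longleftrightarrow> (\<exists>G. (\<forall>x. GDERIV h x :> G x) \<and> continuous_on UNIV G)"

definition strongly_monotone :: "real \<Rightarrow> ('a::real_inner \<Rightarrow> 'a) \<Rightarrow> bool" where
  "strongly_monotone \<omega> F \<longleftrightarrow> (\<forall>x y. (x - y) \<bullet> (F x - F y) \<ge> \<omega> * (norm (x - y))\<^sup>2)"

definition nash_equilibrium ::
    "('p \<Rightarrow> real ^ 'm ^ 'p \<Rightarrow> real) \<Rightarrow> real ^ 'm ^ 'p \<Rightarrow> bool" where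
  "nash_equilibrium J x \<longleftrightarrow> (\<forall>i v. J i x \<le> J i (with_own x i v))"

text \<open>
  In what follows \<open>x l t $ i\<close> stands for the \<open>l\<close>-th time derivative of player \<open>i\<close>'s decision,
  \<open>z l t $ i\<close> for the observer variable with index \<open>l\<close> (\<open>0 \<le> l < n\<close> in both cases), and
  \<open>xh t $ i $ j\<close> for player \<open>i\<close>'s estimate of \<open>x\<^sub>j\<close>. The nonlinearity \<open>f i\<close> receives the
  sequence \<open>\<lambda>l. x l t $ i\<close>, of which only the entries \<open>l < n\<close> are meaningful.
\<close>

text \<open>The own gradient of player \<open>i\<close> evaluated at its decision and its estimates of the others.\<close>

definition estimated_gradient ::
    "('p \<Rightarrow> real ^ 'm ^ 'p \<Rightarrow> real) \<Rightarrow> 'p \<Rightarrow> real ^ 'm ^ 'p \<Rightarrow> real ^ 'm ^ 'p ^ 'p \<Rightarrow> real ^ 'm" where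
  "estimated_gradient J i x xh = own_gradient J i (with_own (xh $ i) i (x $ i))"

definition control_input ::
    "nat \<Rightarrow> ('p \<Rightarrow> real ^ 'm ^ 'p \<Rightarrow> real) \<Rightarrow> (nat \<Rightarrow> real) \<Rightarrow> real \<Rightarrow> real \<Rightarrow> real \<Rightarrow> 'p \<Rightarrow>
     real ^ 'm ^ 'p \<Rightarrow> (nat \<Rightarrow> real ^ 'm ^ 'p) \<Rightarrow> real ^ 'm ^ 'p \<Rightarrow> real ^ 'm ^ 'p ^ 'p \<Rightarrow> real ^ 'm" where
  "control_input n J k \<alpha>\<^sub>1 \<alpha>\<^sub>2 \<epsilon> i x z y xh =
     - (\<Sum>l = 1..<n. (\<epsilon> ^ (n - l) * k l) *\<^sub>R z l $ i)
     - \<alpha>\<^sub>1 *\<^sub>R estimated_gradient J i x xh - \<alpha>\<^sub>2 *\<^sub>R y $ i"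

text \<open>Solutions are defined on \<open>[0, \<infinity>)\<close>, with a one-sided derivative at \<open>0\<close>.\<close>

definition closed_loop_solution ::
    "nat \<Rightarrow> ('p \<Rightarrow> 'p \<Rightarrow> real) \<Rightarrow> ('p::finite \<Rightarrow> real ^ 'm ^ 'p \<Rightarrow> real) \<Rightarrow>
     ('p \<Rightarrow> (nat \<Rightarrow> real ^ 'm) \<Rightarrow> real list \<Rightarrow> real ^ 'm) \<Rightarrow> ('p \<Rightarrow> real list) \<Rightarrow>
     (nat \<Rightarrow> real) \<Rightarrow> (nat \<Rightarrow> real) \<Rightarrow> real \<Rightarrow> real \<Rightarrow> real \<Rightarrow> real \<Rightarrow> real \<Rightarrow>
     (nat \<Rightarrow> real \<Rightarrow> real ^ 'm ^ 'p) \<Rightarrow> (nat \<Rightarrow> real \<Rightarrow> real ^ 'm ^ 'p) \<Rightarrow>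
     (real \<Rightarrow> real ^ 'm ^ 'p) \<Rightarrow> (real \<Rightarrow> real ^ 'm ^ 'p ^ 'p) \<Rightarrow> bool" where
  "closed_loop_solution n a J f w k \<beta> \<alpha>\<^sub>1 \<alpha>\<^sub>2 \<alpha>\<^sub>3 \<epsilon> \<mu> x z y xh \<longleftrightarrow>
    (\<forall>t\<ge>0. \<forall>i.
      (\<forall>l. l + 1 < n \<longrightarrow>
        ((\<lambda>s. x l s $ i) has_vector_derivative x (l + 1) t $ i) (at t within {0..})) \<and>
      ((\<lambda>s. x (n - 1) s $ i) has_vector_derivative
          f i (\<lambda>l. x l t $ i) (w i)
          + control_input n J k \<alpha>\<^sub>1 \<alpha>\<^sub>2 \<epsilon> i (x 0 t) (\<lambda>l. z l t) (y t) (xh t)) (at t within {0..}) \<and>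
      ((\<lambda>s. y s $ i) has_vector_derivative
          (\<Sum>l = 1..<n. (\<epsilon> powi (1 - int l) * k l) *\<^sub>R z l t $ i)
          + (\<alpha>\<^sub>1 / \<epsilon> ^ (n - 1)) *\<^sub>R estimated_gradient J i (x 0 t) (xh t)) (at t within {0..}) \<and>
      (\<forall>l. l + 1 < n \<longrightarrow>
        ((\<lambda>s. z l s $ i) has_vector_derivative
          z (l + 1) t $ i
          + (\<epsilon> ^ (l + 1) * \<beta> (l + 1) / \<mu> ^ (l + 1)) *\<^sub>R (x 0 t $ i - z 0 t $ i)) (at t within {0..})) \<and>
      ((\<lambda>s. z (n - 1) s $ i) has_vector_derivative
          (\<epsilon> ^ n * \<beta> n / \<mu> ^ n) *\<^sub>R (x 0 t $ i - z 0 t $ i)) (at t within {0..}) \<and>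
      (\<forall>j. ((\<lambda>s. xh s $ i $ j) has_vector_derivative
          - \<alpha>\<^sub>3 *\<^sub>R ((\<Sum>q\<in>UNIV. a i q *\<^sub>R (xh t $ i $ j - xh t $ q $ j))
                 + a i j *\<^sub>R (xh t $ i $ j - x 0 t $ j))) (at t within {0..})))"

end

theory Submission
  imports Defs "HOL-Computational_Algebra.Fundamental_Theorem_Algebra"
begin

text \<open>
  Put \<open>\<tau> = \<epsilon> t\<close>, divide the \<open>l\<close>-th derivatives and observer states by \<open>\<epsilon> ^ l\<close>, and measure \<open>x\<close>, \<open>z\<close>,
  \<open>y\<close> from the equilibrium. With \<open>\<alpha>\<^sub>1 = \<kappa> \<epsilon> ^ n\<close>, \<open>\<alpha>\<^sub>2 = \<kappa>\<^sup>2 \<epsilon> ^ n\<close>, \<open>\<alpha>\<^sub>3 = \<Gamma> \<epsilon>\<close> and \<open>\<mu> = 1 / \<Gamma>\<close> the loop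
  no longer contains \<open>\<epsilon>\<close>, except that the nonlinearity, minus its equilibrium value, is
  Lipschitz with a constant \<open>\<sigma> = O(1 / \<epsilon>)\<close>. The sum of five energies then decays:
  \<^item> \<open>A\<close>, of \<open>v = x + (k\<^sub>2 x\<^sup>(\<^sup>1\<^sup>) + \<dots> + x\<^sup>(\<^sup>n\<^sup>-\<^sup>1\<^sup>)) / k\<^sub>1\<close>, the slow mode of the chain, whose derivative is a multiple
    of the forcing of the chain and which therefore follows the pseudo-gradient flow at rate \<open>\<kappa>\<close>;
  \<^item> \<open>B\<close>, of \<open>x\<^sup>(\<^sup>n\<^sup>-\<^sup>1\<^sup>) + y\<close>, which integral action contracts at rate \<open>\<kappa>\<^sup>2\<close>;
  \<^item> \<open>E\<close>, of the derivatives \<open>x\<^sup>(\<^sup>1\<^sup>), \<dots>, x\<^sup>(\<^sup>n\<^sup>-\<^sup>1\<^sup>)\<close>, contracting at rate \<open>1\<close>;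
  \<^item> \<open>P\<close> and \<open>Q\<close>, of the observer error and of the consensus error, contracting at rate \<open>\<Gamma>\<close>.
  Choosing \<open>\<kappa>\<close> small, then \<open>\<Gamma>\<close> large, then \<open>\<sigma>\<close> small makes the damping dominate all couplings.
  The energies \<open>E\<close> and \<open>P\<close> come from factoring the Hurwitz polynomial: along its complex roots the chain becomes
  triangular. The energy \<open>Q\<close> is weighted by the positive left null vector of the Laplacian.
\<close>

section \<open>Nash equilibria and zeros of the pseudo-gradient\<close>

lemma with_own_nth [simp]: "with_own x i v $ j = (if j = i then v else x $ j)"
  by (simp add: with_own_def)

lemma with_own_same [simp]: "with_own x i (x $ i) = x"
  by (simp add: vec_eq_iff)

lemma GDERIV_unique: "GDERIV f x :> g \<Longrightarrow> GDERIV f x :> g' \<Longrightarrow> g = g'"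
  unfolding gderiv_def using has_derivative_unique[of f "\<lambda>h. h \<bullet> g" x "\<lambda>h. h \<bullet> g'"]
  by (auto simp: fun_eq_iff vector_eq_ldot)

lemma bounded_linear_axis: "bounded_linear (axis i :: real ^ 'm \<Rightarrow> real ^ 'm ^ 'p::finite)"
  by (intro linear_conv_bounded_linear[THEN iffD1] linearI) (auto simp: vec_eq_iff axis_def)

lemma GDERIV_with_own:
  fixes h :: "real ^ 'm ^ 'p::finite \<Rightarrow> real"
  assumes "GDERIV h (with_own x i v) :> g"
  shows "GDERIV (\<lambda>v. h (with_own x i v)) v :> g $ i"
proof -
  have eq: "with_own x i = (\<lambda>v. with_own x i 0 + axis i v)"
    by (auto simp: fun_eq_iff vec_eq_iff axis_def)
  have "(with_own x i has_derivative axis i) (at v)"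
    by (subst eq) (auto intro!: derivative_eq_intros bounded_linear_imp_has_derivative bounded_linear_axis)
  from diff_chain_at[OF this assms[unfolded gderiv_def]]
  show ?thesis
    by (simp add: gderiv_def o_def inner_axis inner_commute)
qed

lemma GDERIV_own_gradient:
  fixes J :: "'p::finite \<Rightarrow> real ^ 'm ^ 'p \<Rightarrow> real"
  assumes "continuously_differentiable (J i)"
  shows "GDERIV (\<lambda>v. J i (with_own x i v)) (x $ i) :> own_gradient J i x"
proof -
  obtain G where "GDERIV (J i) x :> G x"
    using assms by (auto simp: continuously_differentiable_def)
  then have g: "GDERIV (\<lambda>v. J i (with_own x i v)) (x $ i) :> G x $ i"
    by (intro GDERIV_with_own) simp
  then have "own_gradient J i x = G x $ i"
    unfolding own_gradient_def by (rule the_equality) (rule GDERIV_unique[OF _ g])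
  with g show ?thesis by simp
qed

lemma convex_on_GDERIV_above_tangent:
  fixes h :: "'a::real_inner \<Rightarrow> real"
  assumes "convex_on UNIV h" and "GDERIV h x :> g"
  shows "h v \<ge> h x + (v - x) \<bullet> g"
proof -
  define \<phi> where "\<phi> t = h (x + t *\<^sub>R (v - x))" for t :: real
  have "convex_on UNIV \<phi>"
  proof (rule convex_onI)
    fix t a b :: real
    assume "0 < t" "t < 1"
    have "\<phi> ((1 - t) *\<^sub>R a + t *\<^sub>R b)
        = h ((1 - t) *\<^sub>R (x + a *\<^sub>R (v - x)) + t *\<^sub>R (x + b *\<^sub>R (v - x)))"
      by (simp add: \<phi>_def algebra_simps)
    also have "\<dots> \<le> (1 - t) * \<phi> a + t * \<phi> b"
      unfolding \<phi>_def using \<open>0 < t\<close> \<open>t < 1\<close> by (intro convex_onD[OF assms(1)]) auto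
    finally show "\<phi> ((1 - t) *\<^sub>R a + t *\<^sub>R b) \<le> (1 - t) * \<phi> a + t * \<phi> b" .
  qed auto
  moreover have "(\<phi> has_real_derivative (v - x) \<bullet> g) (at 0)"
  proof -
    have 1: "((\<lambda>t. x + t *\<^sub>R (v - x)) has_derivative (\<lambda>t. t *\<^sub>R (v - x))) (at 0)"
      by (auto intro!: derivative_eq_intros)
    have "(h has_derivative (\<lambda>h. h \<bullet> g)) (at (x + 0 *\<^sub>R (v - x)))"
      using assms(2) by (simp add: gderiv_def)
    from diff_chain_at[OF 1 this] show ?thesis
      by (simp add: \<phi>_def[abs_def] has_field_derivative_def o_def mult_commute_abs)
  qed
  ultimately have "\<phi> 1 - \<phi> 0 \<ge> (v - x) \<bullet> g * (1 - 0)"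
    by (intro convex_on_imp_above_tangent[of UNIV]) auto
  then show ?thesis by (simp add: \<phi>_def)
qed

lemma nash_equilibrium_iff:
  fixes J :: "'p::finite \<Rightarrow> real ^ 'm ^ 'p \<Rightarrow> real"
  assumes diff: "\<And>i. continuously_differentiable (J i)"
    and conv: "\<And>i x. convex_on UNIV (\<lambda>v. J i (with_own x i v))"
  shows "nash_equilibrium J x \<longleftrightarrow> pseudo_gradient J x = 0"
proof
  assume N: "nash_equilibrium J x"
  have "own_gradient J i x = 0" for i
  proof -
    let ?h = "\<lambda>v. J i (with_own x i v)"
    have "(?h has_derivative (\<lambda>h. h \<bullet> own_gradient J i x)) (at (x $ i))"
      using GDERIV_own_gradient[of J i x] diff by (simp add: gderiv_def)
    moreover have "\<forall>v. ?h (x $ i) \<le> ?h v"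
      using N by (simp add: nash_equilibrium_def)
    ultimately have "(\<lambda>h. h \<bullet> own_gradient J i x) = (\<lambda>h. 0)"
      by (intro differential_zero_maxmin[of "x $ i" UNIV ?h]) auto
    then show ?thesis by (metis inner_eq_zero_iff)
  qed
  then show "pseudo_gradient J x = 0"
    by (simp add: pseudo_gradient_def vec_eq_iff)
next
  assume "pseudo_gradient J x = 0"
  then have 0: "own_gradient J i x = 0" for i
    by (simp add: pseudo_gradient_def vec_eq_iff)
  show "nash_equilibrium J x"
    unfolding nash_equilibrium_def
  proof (intro allI)
    fix i v
    show "J i x \<le> J i (with_own x i v)"
      using convex_on_GDERIV_above_tangent[OF conv[of i x] GDERIV_own_gradient[of J i x, OF diff], of v]
      by (simp add: 0)
  qed
qed

lemma strongly_monotone_ex1_zero: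
  fixes F :: "'a::euclidean_space \<Rightarrow> 'a"
  assumes "\<omega> > 0" and mono: "strongly_monotone \<omega> F"
    and "\<theta> > 0" and lip: "\<theta>-lipschitz_on UNIV F"
  shows "\<exists>!x. F x = 0"
proof -
  define \<gamma> where "\<gamma> = \<omega> / \<theta>\<^sup>2"
  define q where "q = sqrt (max 0 (1 - \<omega>\<^sup>2 / \<theta>\<^sup>2))"
  have "\<gamma> > 0" using assms by (simp add: \<gamma>_def)
  have q: "0 \<le> q" "q < 1" using assms by (auto simp: q_def)
  have "dist (x - \<gamma> *\<^sub>R F x) (y - \<gamma> *\<^sub>R F y) \<le> q * dist x y" for x y
  proof -
    define d where "d = x - y"
    define D where "D = F x - F y"
    have m: "d \<bullet> D \<ge> \<omega> * (norm d)\<^sup>2"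
      using mono by (simp add: strongly_monotone_def d_def D_def)
    have "norm D \<le> \<theta> * norm d"
      using lipschitz_onD[OF lip, of x y] by (simp add: d_def D_def dist_norm)
    then have l: "(norm D)\<^sup>2 \<le> \<theta>\<^sup>2 * (norm d)\<^sup>2"
      by (metis norm_ge_zero power_mono power_mult_distrib)
    have "(norm (d - \<gamma> *\<^sub>R D))\<^sup>2 = (norm d)\<^sup>2 - 2 * \<gamma> * (d \<bullet> D) + \<gamma>\<^sup>2 * (norm D)\<^sup>2"
      unfolding power2_norm_eq_inner
      by (simp add: inner_diff inner_commute algebra_simps power2_eq_square)
    also have "\<dots> \<le> (norm d)\<^sup>2 - 2 * \<gamma> * (\<omega> * (norm d)\<^sup>2) + \<gamma>\<^sup>2 * (\<theta>\<^sup>2 * (norm d)\<^sup>2)"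
      using m l \<open>\<gamma> > 0\<close> by (intro add_mono diff_mono mult_left_mono) auto
    also have "\<dots> = (1 - 2 * (\<gamma> * \<omega>) + \<gamma>\<^sup>2 * \<theta>\<^sup>2) * (norm d)\<^sup>2"
      by (simp add: algebra_simps)
    also have "\<dots> = (1 - \<omega>\<^sup>2 / \<theta>\<^sup>2) * (norm d)\<^sup>2"
    proof -
      have "\<gamma> * \<omega> = \<omega>\<^sup>2 / \<theta>\<^sup>2" "\<gamma>\<^sup>2 * \<theta>\<^sup>2 = \<omega>\<^sup>2 / \<theta>\<^sup>2"
        using \<open>\<theta> > 0\<close> by (simp_all add: \<gamma>_def power2_eq_square)
      then show ?thesis by simp
    qed
    also have "\<dots> \<le> q\<^sup>2 * (norm d)\<^sup>2"
    proof (rule mult_right_mono)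
      have "q\<^sup>2 = max 0 (1 - \<omega>\<^sup>2 / \<theta>\<^sup>2)" unfolding q_def by (rule real_sqrt_pow2) (rule max.cobounded1)
      then show "1 - \<omega>\<^sup>2 / \<theta>\<^sup>2 \<le> q\<^sup>2" by linarith
    qed (rule zero_le_power2)
    finally have "(norm (d - \<gamma> *\<^sub>R D))\<^sup>2 \<le> (q * norm d)\<^sup>2"
      by (simp add: power_mult_distrib)
    then have "norm (d - \<gamma> *\<^sub>R D) \<le> q * norm d"
      by (rule power2_le_imp_le) (use q in simp)
    then show "dist (x - \<gamma> *\<^sub>R F x) (y - \<gamma> *\<^sub>R F y) \<le> q * dist x y"
      by (simp add: dist_norm d_def D_def algebra_simps)
  qed
  then have "\<exists>!x. x - \<gamma> *\<^sub>R F x = x"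
    using q by (intro banach_fix_type) auto
  then show ?thesis using \<open>\<gamma> > 0\<close> by simp
qed

section \<open>The pinned Laplacian of a strongly connected digraph\<close>

definition laplacian :: "('p::finite \<Rightarrow> 'p \<Rightarrow> real) \<Rightarrow> real ^ 'p ^ 'p" where
  "laplacian a = (\<chi> i j. (if i = j then (\<Sum>q\<in>UNIV. a i q) else 0) - a i j)"

lemma laplacian_mult_nth: "(laplacian a *v e) $ i = (\<Sum>q\<in>UNIV. a i q * (e $ i - e $ q))"
proof -
  have "(\<Sum>j\<in>UNIV. (if i = j then (\<Sum>q\<in>UNIV. a i q) else 0) * e $ j)
      = (\<Sum>j\<in>UNIV. if i = j then (\<Sum>q\<in>UNIV. a i q) * e $ j else 0)"
    by (rule sum.cong) auto
  then show ?thesis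
    by (simp add: matrix_vector_mult_def laplacian_def left_diff_distrib right_diff_distrib
        sum_subtractf sum_distrib_right)
qed

lemma vec_mult_laplacian_nth:
  "(\<xi> v* laplacian a) $ j = \<xi> $ j * (\<Sum>q\<in>UNIV. a j q) - (\<Sum>i\<in>UNIV. \<xi> $ i * a i j)"
proof -
  have "(\<Sum>i\<in>UNIV. \<xi> $ i * (if i = j then (\<Sum>q\<in>UNIV. a i q) else 0))
      = (\<Sum>i\<in>UNIV. if i = j then \<xi> $ j * (\<Sum>q\<in>UNIV. a j q) else 0)"
    by (rule sum.cong) auto
  then show ?thesis
    by (simp add: vector_matrix_mult_def laplacian_def right_diff_distrib sum_subtractf)
qed

lemma strongly_connected_closed_set:
  fixes a :: "'p::finite \<Rightarrow> 'p \<Rightarrow> real"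
  assumes "strongly_connected (comm_digraph a)"
    and "P j" and "\<And>i j. a i j > 0 \<Longrightarrow> P j \<Longrightarrow> P i"
  shows "P i"
proof -
  have "(j, i) \<in> rtrancl_on (verts (comm_digraph a)) (arcs_ends (comm_digraph a))"
    using assms(1) by (auto simp: strongly_connected_def reachable_def comm_digraph_def)
  then show ?thesis
    using assms(2)
    by (induction rule: rtrancl_on_induct)
      (auto simp: comm_digraph_def arcs_ends_def arc_to_ends_def dest: assms(3))
qed

lemma laplacian_positive_left_null:
  fixes a :: "'p::finite \<Rightarrow> 'p \<Rightarrow> real"
  assumes nonneg: "\<And>i j. a i j \<ge> 0" and conn: "strongly_connected (comm_digraph a)"
  shows "\<exists>\<xi>. (\<forall>i. \<xi> i > 0) \<and> (\<forall>j. \<xi> j * (\<Sum>q\<in>UNIV. a j q) = (\<Sum>i\<in>UNIV. \<xi> i * a i j))"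
proof -
  have "laplacian a *v 1 = 0" by (simp add: vec_eq_iff laplacian_mult_nth)
  moreover have "(1 :: real ^ 'p) \<noteq> 0" by simp
  ultimately have "\<not> invertible (laplacian a)"
    by (metis matrix_left_invertible_ker invertible_left_inverse)
  then have "\<not> invertible (transpose (laplacian a))"
    by (metis transpose_invertible transpose_transpose)
  then obtain \<zeta> where "\<zeta> \<noteq> 0" and "transpose (laplacian a) *v \<zeta> = 0"
    by (metis matrix_left_invertible_ker invertible_left_inverse)
  then have null: "\<zeta> $ j * (\<Sum>q\<in>UNIV. a j q) = (\<Sum>i\<in>UNIV. \<zeta> $ i * a i j)" for j
    using vec_mult_laplacian_nth[of \<zeta> a j] by simp
  define \<xi> where "\<xi> i = \<bar>\<zeta> $ i\<bar>" for i
  define d where "d j = (\<Sum>i\<in>UNIV. \<xi> i * a i j) - \<xi> j * (\<Sum>q\<in>UNIV. a j q)" for j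
  have "d j \<ge> 0" for j
  proof -
    have "\<xi> j * (\<Sum>q\<in>UNIV. a j q) = \<bar>\<Sum>i\<in>UNIV. \<zeta> $ i * a i j\<bar>"
      using nonneg by (simp add: \<xi>_def abs_mult sum_nonneg flip: null)
    also have "\<dots> \<le> (\<Sum>i\<in>UNIV. \<xi> i * a i j)"
      using nonneg by (intro order_trans[OF sum_abs]) (simp add: \<xi>_def abs_mult)
    finally show ?thesis by (simp add: d_def)
  qed
  moreover have "(\<Sum>j\<in>UNIV. d j) = 0"
  proof -
    have "(\<Sum>j\<in>UNIV. \<Sum>i\<in>UNIV. \<xi> i * a i j) = (\<Sum>i\<in>UNIV. \<Sum>j\<in>UNIV. \<xi> i * a i j)"
      by (rule sum.swap)
    then show ?thesis by (simp add: d_def sum_subtractf sum_distrib_left)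
  qed
  ultimately have "d j = 0" for j
    by (simp add: sum_nonneg_eq_0_iff)
  then have bal: "\<xi> j * (\<Sum>q\<in>UNIV. a j q) = (\<Sum>i\<in>UNIV. \<xi> i * a i j)" for j
    by (simp add: d_def)
  have pos: "\<xi> i > 0" for i
  proof (rule ccontr)
    assume "\<not> \<xi> i > 0"
    then have "\<xi> i = 0" by (simp add: \<xi>_def)
    then have "\<xi> j = 0" for j
    proof (rule strongly_connected_closed_set[OF conn, where P = "\<lambda>j. \<xi> j = 0"])
      fix i j assume "a i j > 0" "\<xi> j = 0"
      then have "(\<Sum>i\<in>UNIV. \<xi> i * a i j) = 0" by (simp flip: bal)
      then have "\<xi> i * a i j = 0"
        using nonneg by (subst (asm) sum_nonneg_eq_0_iff) (auto simp: \<xi>_def)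
      with \<open>a i j > 0\<close> show "\<xi> i = 0" by simp
    qed
    with \<open>\<zeta> \<noteq> 0\<close> show False by (simp add: vec_eq_iff \<xi>_def)
  qed
  show ?thesis using pos bal by blast
qed

lemma laplacian_weighted_form:
  fixes a :: "'p::finite \<Rightarrow> 'p \<Rightarrow> real"
  assumes bal: "\<And>j. \<xi> j * (\<Sum>q\<in>UNIV. a j q) = (\<Sum>i\<in>UNIV. \<xi> i * a i j)"
  shows "(\<Sum>i\<in>UNIV. \<xi> i * (e i * (\<Sum>q\<in>UNIV. a i q * (e i - e q))))
    = (\<Sum>i\<in>UNIV. \<Sum>q\<in>UNIV. \<xi> i * a i q * (e i - e q)\<^sup>2) / 2"
proof -
  have "(\<Sum>i\<in>UNIV. \<Sum>q\<in>UNIV. \<xi> i * a i q * (e q)\<^sup>2)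
      = (\<Sum>q\<in>UNIV. \<Sum>i\<in>UNIV. \<xi> i * a i q * (e q)\<^sup>2)"
    by (rule sum.swap)
  also have "\<dots> = (\<Sum>i\<in>UNIV. \<Sum>q\<in>UNIV. \<xi> i * a i q * (e i)\<^sup>2)"
    by (simp add: sum_distrib_right[symmetric] sum_distrib_left[symmetric] bal)
  finally have "(\<Sum>i\<in>UNIV. \<Sum>q\<in>UNIV. \<xi> i * a i q * ((e i)\<^sup>2 - (e q)\<^sup>2)) = 0"
    by (simp add: right_diff_distrib sum_subtractf)
  then have "(\<Sum>i\<in>UNIV. \<Sum>q\<in>UNIV. \<xi> i * a i q * (e i - e q)\<^sup>2)
      = (\<Sum>i\<in>UNIV. \<Sum>q\<in>UNIV. \<xi> i * a i q * ((e i - e q)\<^sup>2 + ((e i)\<^sup>2 - (e q)\<^sup>2)))"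
    by (simp add: distrib_left sum.distrib)
  also have "\<dots> = (\<Sum>i\<in>UNIV. \<Sum>q\<in>UNIV. 2 * (\<xi> i * (e i * (a i q * (e i - e q)))))"
    by (intro sum.cong refl) (simp add: power2_eq_square algebra_simps)
  finally show ?thesis by (simp add: sum_distrib_left[symmetric])
qed

lemma pinned_laplacian_coercive_real:
  fixes a :: "'p::finite \<Rightarrow> 'p \<Rightarrow> real"
  assumes nonneg: "\<And>i j. a i j \<ge> 0" and conn: "strongly_connected (comm_digraph a)"
  shows "\<exists>\<xi> c. c > 0 \<and> (\<forall>i. \<xi> i \<ge> 0) \<and> (\<forall>i j. i \<noteq> j \<longrightarrow> \<xi> i \<ge> 1) \<and>
    (\<forall>j e. (\<Sum>i\<in>UNIV. \<xi> i * (e i * ((\<Sum>q\<in>UNIV. a i q * (e i - e q)) + a i j * e i)))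
      \<ge> c * (\<Sum>i\<in>UNIV. \<xi> i * (e i)\<^sup>2))"
proof (cases "\<forall>i j :: 'p. i = j")
  case True
  text \<open>A single player's estimate of itself does not converge, so it gets weight zero.\<close>
  then show ?thesis by (intro exI[of _ "\<lambda>_. 0"] exI[of _ 1]) auto
next
  case False
  obtain \<zeta> where "\<And>i. \<zeta> i > 0"
    and bal0: "\<And>j. \<zeta> j * (\<Sum>q\<in>UNIV. a j q) = (\<Sum>i\<in>UNIV. \<zeta> i * a i j)"
    using laplacian_positive_left_null[OF assms] by blast
  define m where "m = Min (range \<zeta>)"
  have "m \<in> range \<zeta>" unfolding m_def by (rule Min_in) auto
  then have "m > 0" using \<open>\<And>i. \<zeta> i > 0\<close> by auto
  define \<xi> where "\<xi> i = \<zeta> i / m" for i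
  have "\<xi> i \<ge> 1" for i
    using \<open>m > 0\<close> by (simp add: \<xi>_def m_def)
  then have pos: "\<xi> i > 0" for i by (rule less_le_trans[OF zero_less_one])
  have bal: "\<xi> j * (\<Sum>q\<in>UNIV. a j q) = (\<Sum>i\<in>UNIV. \<xi> i * a i j)" for j
    using arg_cong[OF bal0[of j], of "\<lambda>x. x / m"] by (simp add: \<xi>_def sum_divide_distrib)
  define Q where "Q j e = (\<Sum>i\<in>UNIV. \<Sum>q\<in>UNIV. \<xi> i * a i q * (e $ i - e $ q)\<^sup>2) / 2
      + (\<Sum>i\<in>UNIV. \<xi> i * (a i j * (e $ i)\<^sup>2))" for j and e :: "real ^ 'p"
  have Q_pos: "Q j e > 0" if "e \<noteq> 0" for j e
  proof (rule ccontr)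
    assume "\<not> Q j e > 0"
    have "0 \<le> (\<Sum>i\<in>UNIV. \<Sum>q\<in>UNIV. \<xi> i * a i q * (e $ i - e $ q)\<^sup>2)"
      "0 \<le> (\<Sum>i\<in>UNIV. \<xi> i * (a i j * (e $ i)\<^sup>2))"
      by (auto intro!: sum_nonneg simp: nonneg less_imp_le[OF pos])
    with \<open>\<not> Q j e > 0\<close> have "(\<Sum>i\<in>UNIV. \<Sum>q\<in>UNIV. \<xi> i * a i q * (e $ i - e $ q)\<^sup>2) = 0"
      "(\<Sum>i\<in>UNIV. \<xi> i * (a i j * (e $ i)\<^sup>2)) = 0"
      by (auto simp: Q_def)
    then have "\<forall>i q. \<xi> i * a i q * (e $ i - e $ q)\<^sup>2 = 0" "\<forall>i. \<xi> i * (a i j * (e $ i)\<^sup>2) = 0"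
      by (simp_all add: sum_nonneg_eq_0_iff sum_nonneg nonneg less_imp_le[OF pos])
    then have arc: "e $ i = e $ q" if "a i q > 0" for i q
      using that pos by (metis mult_eq_0_iff less_irrefl power_eq_0_iff right_minus_eq)
    have pin: "e $ i = 0" if "a i j > 0" for i
      using that pos \<open>\<forall>i. \<xi> i * (a i j * (e $ i)\<^sup>2) = 0\<close>
      by (metis mult_eq_0_iff less_irrefl power_eq_0_iff)
    have "\<exists>i. a i j > 0"
    proof (rule ccontr)
      assume no: "\<not> (\<exists>i. a i j > 0)"
      have "i = j" for i
        by (rule strongly_connected_closed_set[OF conn, where P = "\<lambda>i. i = j"]) (use no in auto)
      with False show False by metis
    qed
    then obtain i0 where "e $ i0 = 0" using pin by blast
    then have "e $ i = 0" for i
      by (rule strongly_connected_closed_set[OF conn, where P = "\<lambda>i. e $ i = 0"]) (use arc in auto)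
    with that show False by (simp add: vec_eq_iff)
  qed
  have "\<exists>c>0. \<forall>e. Q j e \<ge> c * (norm e)\<^sup>2" for j
  proof -
    have "compact (sphere 0 1 :: (real ^ 'p) set)" "sphere 0 1 \<noteq> ({} :: (real ^ 'p) set)"
      by auto
    moreover have "continuous_on (sphere 0 1) (Q j)"
      unfolding Q_def by (intro continuous_intros) auto
    ultimately obtain u where u: "u \<in> sphere 0 1" and min: "\<And>e. e \<in> sphere 0 1 \<Longrightarrow> Q j u \<le> Q j e"
      using continuous_attains_inf by metis
    have "Q j e \<ge> Q j u * (norm e)\<^sup>2" for e
    proof (cases "e = 0")
      case False
      have scale: "Q j (s *\<^sub>R e) = s\<^sup>2 * Q j e" for s
      proof -
        have "(s * x - s * y)\<^sup>2 = s\<^sup>2 * (x - y)\<^sup>2" for x y :: real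
          by (simp add: power_mult_distrib flip: right_diff_distrib)
        then show ?thesis
          by (simp add: Q_def power_mult_distrib distrib_left sum_distrib_left mult.left_commute)
      qed
      have "Q j u \<le> Q j ((1 / norm e) *\<^sub>R e)" by (rule min) (use False in simp)
      then show ?thesis using False by (simp add: scale field_simps)
    qed (simp add: Q_def)
    moreover have "Q j u > 0" using u by (intro Q_pos) auto
    ultimately show ?thesis by blast
  qed
  then obtain c where c_pos: "\<And>j. c j > 0" and c: "\<And>j e. Q j e \<ge> c j * (norm e)\<^sup>2" by metis
  define c0 where "c0 = Min (range c)"
  have "c0 \<in> range c" unfolding c0_def by (rule Min_in) auto
  then have "c0 > 0" using c_pos by auto
  define \<Xi> where "\<Xi> = (\<Sum>i\<in>UNIV. \<xi> i)"
  have "\<Xi> > 0" unfolding \<Xi>_def using pos by (intro sum_pos) auto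
  have "(\<Sum>i\<in>UNIV. \<xi> i * (e i * ((\<Sum>q\<in>UNIV. a i q * (e i - e q)) + a i j * e i)))
      \<ge> c0 / \<Xi> * (\<Sum>i\<in>UNIV. \<xi> i * (e i)\<^sup>2)" for j e
  proof -
    define v where "v = (\<chi> i. e i)"
    have "(\<Sum>i\<in>UNIV. \<xi> i * (e i)\<^sup>2) \<le> (\<Sum>i\<in>UNIV. \<Xi> * (e i)\<^sup>2)"
      unfolding \<Xi>_def using pos
      by (intro sum_mono mult_right_mono member_le_sum) (auto simp: less_imp_le)
    also have "\<dots> = \<Xi> * (norm v)\<^sup>2"
      by (simp add: norm_vec_def L2_set_def v_def sum_nonneg sum_distrib_left)
    finally have "c0 / \<Xi> * (\<Sum>i\<in>UNIV. \<xi> i * (e i)\<^sup>2) \<le> c0 / \<Xi> * (\<Xi> * (norm v)\<^sup>2)"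
      using \<open>c0 > 0\<close> \<open>\<Xi> > 0\<close> by (intro mult_left_mono) auto
    also have "\<dots> \<le> c j * (norm v)\<^sup>2"
      using \<open>\<Xi> > 0\<close> by (auto simp: c0_def intro!: mult_right_mono)
    also have "\<dots> \<le> Q j v" by (rule c)
    also have "\<dots> = (\<Sum>i\<in>UNIV. \<xi> i * (e i * (\<Sum>q\<in>UNIV. a i q * (e i - e q))))
        + (\<Sum>i\<in>UNIV. \<xi> i * (a i j * (e i)\<^sup>2))"
      by (subst laplacian_weighted_form[OF bal]) (simp add: Q_def v_def)
    also have "\<dots> = (\<Sum>i\<in>UNIV. \<xi> i * (e i * ((\<Sum>q\<in>UNIV. a i q * (e i - e q)) + a i j * e i)))"
      by (simp add: sum.distrib[symmetric] distrib_left power2_eq_square mult.left_commute)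
    finally show ?thesis .
  qed
  note coercive = this
  show ?thesis
  proof (intro exI conjI allI impI)
    show "c0 / \<Xi> > 0" using \<open>c0 > 0\<close> \<open>\<Xi> > 0\<close> by simp
    show "\<xi> i \<ge> 0" "\<xi> i \<ge> 1" for i
      using pos[of i] \<open>\<xi> i \<ge> 1\<close> by simp_all
  qed (rule coercive)
qed

lemma pinned_laplacian_coercive:
  fixes a :: "'p::finite \<Rightarrow> 'p \<Rightarrow> real"
  assumes "\<And>i j. a i j \<ge> 0" and "strongly_connected (comm_digraph a)"
  shows "\<exists>\<xi> c. c > 0 \<and> (\<forall>i. \<xi> i \<ge> 0) \<and> (\<forall>i j. i \<noteq> j \<longrightarrow> \<xi> i \<ge> 1) \<and>
    (\<forall>j (e :: 'p \<Rightarrow> 'a::euclidean_space).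
      (\<Sum>i\<in>UNIV. \<xi> i * (e i \<bullet> ((\<Sum>q\<in>UNIV. a i q *\<^sub>R (e i - e q)) + a i j *\<^sub>R e i)))
      \<ge> c * (\<Sum>i\<in>UNIV. \<xi> i * (norm (e i))\<^sup>2))"
proof -
  obtain \<xi> c where \<xi>: "c > 0" "\<And>i. \<xi> i \<ge> 0" "\<And>i j. i \<noteq> j \<Longrightarrow> \<xi> i \<ge> 1"
    and c: "\<And>j e. (\<Sum>i\<in>UNIV. \<xi> i * (e i * ((\<Sum>q\<in>UNIV. a i q * (e i - e q)) + a i j * e i)))
      \<ge> c * (\<Sum>i\<in>UNIV. \<xi> i * (e i)\<^sup>2)"
    using pinned_laplacian_coercive_real[OF assms] by blast
  have "c * (\<Sum>i\<in>UNIV. \<xi> i * (norm (e i))\<^sup>2)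
      \<le> (\<Sum>i\<in>UNIV. \<xi> i * (e i \<bullet> ((\<Sum>q\<in>UNIV. a i q *\<^sub>R (e i - e q)) + a i j *\<^sub>R e i)))"
    for j and e :: "'p \<Rightarrow> 'a"
  proof -
    define g where "g i = (\<Sum>q\<in>UNIV. a i q *\<^sub>R (e i - e q)) + a i j *\<^sub>R e i" for i
    have swap: "(\<Sum>i\<in>UNIV. \<xi> i * (x i \<bullet> y i))
        = (\<Sum>b\<in>Basis. \<Sum>i\<in>UNIV. \<xi> i * ((x i \<bullet> b) * (y i \<bullet> b)))" for x y :: "'p \<Rightarrow> 'a"
    proof -
      have "(\<Sum>i\<in>UNIV. \<xi> i * (x i \<bullet> y i))
          = (\<Sum>i\<in>UNIV. \<Sum>b\<in>Basis. \<xi> i * ((x i \<bullet> b) * (y i \<bullet> b)))"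
        by (rule sum.cong[OF refl], subst euclidean_inner) (rule sum_distrib_left)
      also have "\<dots> = (\<Sum>b\<in>Basis. \<Sum>i\<in>UNIV. \<xi> i * ((x i \<bullet> b) * (y i \<bullet> b)))"
        by (rule sum.swap)
      finally show ?thesis .
    qed
    have g: "g i \<bullet> b = (\<Sum>q\<in>UNIV. a i q * (e i \<bullet> b - e q \<bullet> b)) + a i j * (e i \<bullet> b)" for i b
      by (simp add: g_def inner_add_left inner_sum_left inner_diff_left)
    have "c * (\<Sum>i\<in>UNIV. \<xi> i * (norm (e i))\<^sup>2)
        = (\<Sum>b\<in>Basis. c * (\<Sum>i\<in>UNIV. \<xi> i * ((e i \<bullet> b) * (e i \<bullet> b))))"
      unfolding power2_norm_eq_inner swap by (rule sum_distrib_left)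
    also have "\<dots> = (\<Sum>b\<in>Basis. c * (\<Sum>i\<in>UNIV. \<xi> i * (e i \<bullet> b)\<^sup>2))"
      by (simp only: power2_eq_square)
    also have "\<dots> \<le> (\<Sum>b\<in>Basis. \<Sum>i\<in>UNIV. \<xi> i * ((e i \<bullet> b) * (g i \<bullet> b)))"
      unfolding g by (rule sum_mono) (rule c)
    also have "\<dots> = (\<Sum>i\<in>UNIV. \<xi> i * (e i \<bullet> g i))" by (rule swap[symmetric])
    finally show ?thesis by (simp only: g_def)
  qed
  note coercive = this
  show ?thesis
    by (intro exI[of _ \<xi>] exI[of _ c] conjI allI impI) (assumption | rule \<xi> coercive)+
qed

section \<open>Lyapunov functions for Hurwitz chains\<close>

fun chain_coord :: "complex list \<Rightarrow> (nat \<Rightarrow> complex) \<Rightarrow> complex" where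
  "chain_coord [] w = w 0"
| "chain_coord (r # rs) w = chain_coord rs (\<lambda>l. w (Suc l)) - r * chain_coord rs w"

fun chain_energy :: "real \<Rightarrow> complex list \<Rightarrow> (nat \<Rightarrow> complex) \<Rightarrow> real" where
  "chain_energy \<sigma> [] w = 0"
| "chain_energy \<sigma> (r # rs) w =
     chain_energy \<sigma> rs w + (2 / \<sigma>\<^sup>2) ^ length rs * (cmod (chain_coord rs w))\<^sup>2"

fun chain_energy_deriv ::
    "real \<Rightarrow> complex list \<Rightarrow> (nat \<Rightarrow> complex) \<Rightarrow> (nat \<Rightarrow> complex) \<Rightarrow> real" where
  "chain_energy_deriv \<sigma> [] w w' = 0"
| "chain_energy_deriv \<sigma> (r # rs) w w' = chain_energy_deriv \<sigma> rs w w'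
     + (2 / \<sigma>\<^sup>2) ^ length rs * (2 * (chain_coord rs w \<bullet> chain_coord rs w'))"

lemma chain_coord_cong:
  "(\<And>l. l \<le> length rs \<Longrightarrow> w l = w' l) \<Longrightarrow> chain_coord rs w = chain_coord rs w'"
proof (induction rs arbitrary: w w')
  case (Cons r rs)
  have "chain_coord rs (\<lambda>l. w (Suc l)) = chain_coord rs (\<lambda>l. w' (Suc l))"
    by (rule Cons.IH) (simp add: Cons.prems)
  moreover have "chain_coord rs w = chain_coord rs w'"
    by (rule Cons.IH) (simp add: Cons.prems)
  ultimately show ?case by simp
qed simp

lemma degree_prod_list_linear: "degree (\<Prod>r\<leftarrow>rs. [:- r, 1::complex:]) = length rs"
proof (induction rs)
  case (Cons r rs)
  have "(\<Prod>r\<leftarrow>rs. [:- r, 1::complex:]) \<noteq> 0"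
    by (auto simp: prod_list_zero_iff)
  then show ?case using Cons by (simp add: degree_mult_eq del: mult_pCons_left)
qed simp

lemma lead_coeff_prod_list_linear: "lead_coeff (\<Prod>r\<leftarrow>rs. [:- r, 1::complex:]) = 1"
  by (induction rs) (simp_all add: lead_coeff_mult del: mult_pCons_left)

lemma chain_coord_eq_sum:
  "chain_coord rs w = (\<Sum>l\<le>length rs. coeff (\<Prod>r\<leftarrow>rs. [:- r, 1:]) l * w l)"
proof (induction rs arbitrary: w)
  case (Cons r rs)
  define p where "p = (\<Prod>r\<leftarrow>rs. [:- r, 1::complex:])"
  have deg: "degree p = length rs"
    unfolding p_def by (rule degree_prod_list_linear)
  have "(\<Sum>l\<le>length (r # rs). coeff ([:- r, 1:] * p) l * w l)
      = (\<Sum>l\<le>Suc (length rs). coeff (pCons 0 p) l * w l)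
        - r * (\<Sum>l\<le>Suc (length rs). coeff p l * w l)"
    by (simp add: sum_subtractf sum_distrib_left algebra_simps del: sum.atMost_Suc)
  also have "(\<Sum>l\<le>Suc (length rs). coeff (pCons 0 p) l * w l)
      = (\<Sum>l\<le>length rs. coeff p l * w (Suc l))"
    by (subst sum.atMost_Suc_shift) simp
  also have "(\<Sum>l\<le>Suc (length rs). coeff p l * w l) = (\<Sum>l\<le>length rs. coeff p l * w l)"
    using deg by (simp add: coeff_eq_0)
  finally show ?case by (simp add: Cons.IH p_def)
qed simp

lemma chain_energy_nonneg: "chain_energy \<sigma> rs w \<ge> 0"
  by (induction rs) auto

lemma chain_coord_has_vector_derivative:
  assumes "\<And>l. l \<le> length rs \<Longrightarrow> ((\<lambda>s. w s l) has_vector_derivative w' l) (at t within S)"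
  shows "((\<lambda>s. chain_coord rs (w s)) has_vector_derivative chain_coord rs w') (at t within S)"
  using assms
proof (induction rs arbitrary: w w')
  case (Cons r rs)
  have "((\<lambda>s. chain_coord rs (\<lambda>l. w s (Suc l))) has_vector_derivative
      chain_coord rs (\<lambda>l. w' (Suc l))) (at t within S)"
    by (rule Cons.IH) (simp add: Cons.prems)
  moreover have "((\<lambda>s. chain_coord rs (w s)) has_vector_derivative chain_coord rs w') (at t within S)"
    by (rule Cons.IH) (simp add: Cons.prems)
  ultimately show ?case by (auto intro!: derivative_eq_intros)
qed simp

lemma has_real_derivative_norm_power2:
  fixes v :: "real \<Rightarrow> 'a::real_inner"
  assumes "(v has_vector_derivative v') (at t within S)"
  shows "((\<lambda>s. (norm (v s))\<^sup>2) has_real_derivative 2 * (v t \<bullet> v')) (at t within S)"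
proof -
  have "((\<lambda>s. v s \<bullet> v s) has_derivative (\<lambda>h. v t \<bullet> h *\<^sub>R v' + h *\<^sub>R v' \<bullet> v t)) (at t within S)"
    using assms unfolding has_vector_derivative_def by (intro has_derivative_inner)
  then show ?thesis
    unfolding power2_norm_eq_inner has_field_derivative_def
    by (rule has_derivative_eq_rhs) (auto simp: inner_commute algebra_simps)
qed

lemma chain_energy_has_real_derivative:
  assumes "\<And>l. l < length rs \<Longrightarrow> ((\<lambda>s. w s l) has_vector_derivative w' l) (at t within S)"
  shows "((\<lambda>s. chain_energy \<sigma> rs (w s)) has_real_derivative chain_energy_deriv \<sigma> rs (w t) w')
    (at t within S)"
  using assms
proof (induction rs)
  case (Cons r rs)
  have "((\<lambda>s. chain_energy \<sigma> rs (w s)) has_real_derivative chain_energy_deriv \<sigma> rs (w t) w')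
      (at t within S)"
    by (rule Cons.IH) (simp add: Cons.prems)
  moreover have "((\<lambda>s. (cmod (chain_coord rs (w s)))\<^sup>2) has_real_derivative
      2 * (chain_coord rs (w t) \<bullet> chain_coord rs w')) (at t within S)"
    by (intro has_real_derivative_norm_power2 chain_coord_has_vector_derivative)
      (simp add: Cons.prems)
  ultimately show ?case unfolding chain_energy.simps chain_energy_deriv.simps
    by (intro DERIV_add DERIV_cmult)
qed simp

lemma chain_energy_deriv_le:
  assumes "\<sigma> > 0" and "\<And>r. r \<in> set rs \<Longrightarrow> Re r \<le> - \<sigma>"
  shows "chain_energy_deriv \<sigma> rs w (\<lambda>l. w (Suc l))
    \<le> - (\<sigma> / 2) * chain_energy \<sigma> rs w + \<sigma> / 2 * (2 / \<sigma>\<^sup>2) ^ length rs * (cmod (chain_coord rs w))\<^sup>2"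
  using assms(2)
proof (induction rs)
  case (Cons r rs)
  define M where "M = (2 / \<sigma>\<^sup>2) ^ length rs"
  have "M > 0" using \<open>\<sigma> > 0\<close> by (simp add: M_def)
  define q where "q = chain_coord rs w"
  define p where "p = chain_coord (r # rs) w"
  have IH: "chain_energy_deriv \<sigma> rs w (\<lambda>l. w (Suc l))
      \<le> - (\<sigma> / 2) * chain_energy \<sigma> rs w + \<sigma> / 2 * M * (cmod q)\<^sup>2"
    using Cons by (simp add: M_def q_def)
  have "chain_coord rs (\<lambda>l. w (Suc l)) = p + r * q"
    by (simp add: p_def q_def)
  have "q \<bullet> (r * q) = Re r * (cmod q)\<^sup>2"
    unfolding cmod_power2 by (simp add: inner_complex_def algebra_simps power2_eq_square)
  also have "\<dots> \<le> - \<sigma> * (cmod q)\<^sup>2"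
    using Cons.prems[of r] by (intro mult_right_mono) auto
  finally have 1: "q \<bullet> (r * q) \<le> - \<sigma> * (cmod q)\<^sup>2" .
  have "2 * (q \<bullet> p) \<le> 2 * (cmod q * cmod p)"
    by (simp add: norm_cauchy_schwarz)
  also have "\<dots> \<le> \<sigma> * (cmod q)\<^sup>2 + (cmod p)\<^sup>2 / \<sigma>"
  proof -
    have "0 \<le> (\<sigma> * cmod q - cmod p)\<^sup>2 / \<sigma>" using \<open>\<sigma> > 0\<close> by simp
    also have "\<dots> = \<sigma> * (cmod q)\<^sup>2 + (cmod p)\<^sup>2 / \<sigma> - 2 * (cmod q * cmod p)"
      using \<open>\<sigma> > 0\<close> by (simp add: field_simps power2_eq_square)
    finally show ?thesis by simp
  qed
  finally have "2 * (q \<bullet> (p + r * q)) \<le> - \<sigma> * (cmod q)\<^sup>2 + (cmod p)\<^sup>2 / \<sigma>"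
    using 1 by (simp add: inner_add_right)
  then have "M * (2 * (q \<bullet> (p + r * q))) \<le> M * (- \<sigma> * (cmod q)\<^sup>2 + (cmod p)\<^sup>2 / \<sigma>)"
    using \<open>M > 0\<close> by (intro mult_left_mono) auto
  with IH have "chain_energy_deriv \<sigma> rs w (\<lambda>l. w (Suc l)) + M * (2 * (q \<bullet> (p + r * q)))
      \<le> - (\<sigma> / 2) * (chain_energy \<sigma> rs w + M * (cmod q)\<^sup>2) + M / \<sigma> * (cmod p)\<^sup>2"
    by (simp add: algebra_simps)
  moreover have "\<sigma> / 2 * (2 / \<sigma>\<^sup>2) ^ length (r # rs) = M / \<sigma>"
    using \<open>\<sigma> > 0\<close> by (simp add: M_def power2_eq_square)
  ultimately show ?case
    using \<open>chain_coord rs (\<lambda>l. w (Suc l)) = p + r * q\<close>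
    by (simp add: p_def[symmetric] q_def[symmetric] M_def[symmetric] del: chain_coord.simps)
qed (use \<open>\<sigma> > 0\<close> in simp)

lemma chain_energy_bounds_entries:
  assumes "\<sigma> > 0"
  shows "\<exists>C\<ge>0. \<forall>w. (\<Sum>l<length rs. cmod (w l)) \<le> C * sqrt (chain_energy \<sigma> rs w)"
proof (induction rs)
  case (Cons r rs)
  then obtain C where "C \<ge> 0"
    and C: "\<And>w. (\<Sum>l<length rs. cmod (w l)) \<le> C * sqrt (chain_energy \<sigma> rs w)" by blast
  define d where "d = length rs"
  define a where "a l = coeff (\<Prod>r\<leftarrow>rs. [:- r, 1::complex:]) l" for l
  have "a d = 1"
    using lead_coeff_prod_list_linear[of rs] by (simp add: a_def d_def degree_prod_list_linear)
  define B where "B = (\<Sum>l<d. cmod (a l))"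
  define M where "M = (2 / \<sigma>\<^sup>2) ^ d"
  have "M > 0" using \<open>\<sigma> > 0\<close> by (simp add: M_def)
  have "B \<ge> 0" by (simp add: B_def sum_nonneg)
  have "(\<Sum>l<length (r # rs). cmod (w l))
      \<le> (C + (1 / sqrt M + B * C)) * sqrt (chain_energy \<sigma> (r # rs) w)" for w
  proof -
    define V where "V = sqrt (chain_energy \<sigma> (r # rs) w)"
    have V: "sqrt (chain_energy \<sigma> rs w) \<le> V"
      by (simp add: V_def)
    have le: "(\<Sum>l<d. cmod (w l)) \<le> C * V"
      using C[of w] mult_left_mono[OF V \<open>C \<ge> 0\<close>] by (simp add: d_def)
    have "sqrt (M * (cmod (chain_coord rs w))\<^sup>2) \<le> V"
      unfolding V_def by (rule real_sqrt_le_mono) (simp add: M_def d_def chain_energy_nonneg)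
    then have q: "cmod (chain_coord rs w) \<le> 1 / sqrt M * V"
      using \<open>M > 0\<close> by (simp add: real_sqrt_mult field_simps)
    have "{..d} = insert d {..<d}" by auto
    then have "chain_coord rs w = w d + (\<Sum>l<d. a l * w l)"
      using \<open>a d = 1\<close> by (simp add: chain_coord_eq_sum a_def[symmetric] d_def[symmetric])
    then have "w d = chain_coord rs w - (\<Sum>l<d. a l * w l)" by simp
    then have "cmod (w d) \<le> cmod (chain_coord rs w) + cmod (\<Sum>l<d. a l * w l)"
      by (simp add: norm_triangle_ineq4)
    also have "cmod (\<Sum>l<d. a l * w l) \<le> (\<Sum>l<d. cmod (a l) * (\<Sum>l<d. cmod (w l)))"
      by (intro order_trans[OF norm_sum] sum_mono)
        (auto simp: norm_mult intro!: mult_left_mono member_le_sum)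
    also have "\<dots> = B * (\<Sum>l<d. cmod (w l))" by (simp add: B_def sum_distrib_right)
    also have "\<dots> \<le> B * (C * V)" using le \<open>B \<ge> 0\<close> by (rule mult_left_mono)
    finally have "cmod (w d) \<le> 1 / sqrt M * V + B * (C * V)" using q by simp
    with le show ?thesis
      unfolding V_def[symmetric] by (simp add: d_def[symmetric] algebra_simps)
  qed
  moreover have "C + (1 / sqrt M + B * C) \<ge> 0"
    using \<open>C \<ge> 0\<close> \<open>B \<ge> 0\<close> \<open>M > 0\<close> by auto
  ultimately show ?case by blast
qed auto

lemma monic_poly_roots:
  fixes c :: "nat \<Rightarrow> complex"
  shows "\<exists>rs. length rs = d \<and> (\<forall>r\<in>set rs. r ^ d + (\<Sum>l<d. c l * r ^ l) = 0) \<and>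
    (\<forall>l<d. coeff (\<Prod>r\<leftarrow>rs. [:- r, 1:]) l = c l)"
proof -
  define p where "p = monom 1 d + (\<Sum>l<d. monom (c l) l)"
  have co: "coeff p l = (if l = d then 1 else if l < d then c l else 0)" for l
    by (simp add: p_def coeff_sum)
  have deg: "degree p = d"
    by (rule antisym) (auto intro!: degree_le le_degree simp: co)
  obtain A where A: "size A = degree p" "p = smult (lead_coeff p) (\<Prod>x\<in>#A. [:-x, 1:])"
    using alg_closed_imp_factorization[of p] co[of d] by force
  obtain rs where rs: "mset rs = A" using ex_mset by blast
  have p: "p = (\<Prod>r\<leftarrow>rs. [:- r, 1:])"
    using A(2) rs co[of d] deg by (simp flip: prod_mset_prod_list)
  have "poly p s = s ^ d + (\<Sum>l<d. c l * s ^ l)" for s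
    by (simp add: p_def poly_sum poly_monom)
  moreover have "poly p r = 0" if "r \<in> set rs" for r
    using that unfolding p by (induction rs) auto
  moreover have "length rs = d" using A(1) rs deg size_mset[of rs] by simp
  ultimately show ?thesis using co p by (intro exI[of _ rs]) auto
qed

lemma chain_energy_cong:
  "(\<And>l. l < length rs \<Longrightarrow> w l = w' l) \<Longrightarrow> chain_energy \<sigma> rs w = chain_energy \<sigma> rs w'"
proof (induction rs)
  case (Cons r rs)
  then show ?case using chain_coord_cong[of rs w w'] by simp
qed simp

lemma chain_energy_deriv_cong:
  assumes "\<And>l. l < length rs \<Longrightarrow> w l = v l" and "\<And>l. l < length rs \<Longrightarrow> w' l = v' l"
  shows "chain_energy_deriv \<sigma> rs w w' = chain_energy_deriv \<sigma> rs v v'"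
  using assms
proof (induction rs)
  case (Cons r rs)
  then show ?case using chain_coord_cong[of rs w v] chain_coord_cong[of rs w' v'] by simp
qed simp

lemma chain_coord_scale: "chain_coord rs (\<lambda>l. a * w l) = a * chain_coord rs w"
  by (simp add: chain_coord_eq_sum sum_distrib_left mult.left_commute)

lemma chain_energy_deriv_scale:
  "chain_energy_deriv \<sigma> rs w (\<lambda>l. of_real \<kappa> * w' l) = \<kappa> * chain_energy_deriv \<sigma> rs w w'"
  by (induction rs) (simp_all add: chain_coord_scale inner_complex_def algebra_simps)

definition chain_lyapunov ::
    "nat \<Rightarrow> (nat \<Rightarrow> real) \<Rightarrow> ((nat \<Rightarrow> 'a::real_normed_vector) \<Rightarrow> real) \<Rightarrow> real \<Rightarrow> real \<Rightarrow> bool" where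
  "chain_lyapunov d c U \<gamma> C \<longleftrightarrow> \<gamma> > 0 \<and> C > 0 \<and> (\<forall>w. U w \<ge> 0) \<and>
    (\<forall>w l. l < d \<longrightarrow> (norm (w l))\<^sup>2 \<le> C * U w) \<and>
    (\<forall>w w' \<kappa> r t S. \<kappa> > 0 \<longrightarrow>
      (\<forall>l<d. ((\<lambda>s. w s l) has_vector_derivative w' l) (at t within S)) \<longrightarrow>
      (\<forall>l. Suc l < d \<longrightarrow> w' l = \<kappa> *\<^sub>R w t (Suc l)) \<longrightarrow>
      (d > 0 \<longrightarrow> w' (d - 1) = r - \<kappa> *\<^sub>R (\<Sum>l<d. c l *\<^sub>R w t l)) \<longrightarrow>
      (\<exists>D. ((\<lambda>s. U (w s)) has_real_derivative D) (at t within S) \<and>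
        D \<le> - (\<kappa> * \<gamma> * U (w t)) + C / \<kappa> * (norm r)\<^sup>2))"

lemma chain_lyapunov_deriv:
  assumes "chain_lyapunov d c U \<gamma> C" and "\<kappa> > 0"
    and "\<And>l. l < d \<Longrightarrow> ((\<lambda>s. w s l) has_vector_derivative w' l) (at t within S)"
    and "\<And>l. Suc l < d \<Longrightarrow> w' l = \<kappa> *\<^sub>R w t (Suc l)"
    and "d > 0 \<Longrightarrow> w' (d - 1) = r - \<kappa> *\<^sub>R (\<Sum>l<d. c l *\<^sub>R w t l)"
  shows "\<exists>D. ((\<lambda>s. U (w s)) has_real_derivative D) (at t within S) \<and>
    D \<le> - (\<kappa> * \<gamma> * U (w t)) + C / \<kappa> * (norm r)\<^sup>2"
  using assms unfolding chain_lyapunov_def by blast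

lemma hurwitz_chain_lyapunov:
  fixes c :: "nat \<Rightarrow> real"
  assumes hurwitz: "\<And>s::complex. s ^ d + (\<Sum>l<d. of_real (c l) * s ^ l) = 0 \<Longrightarrow> Re s < 0"
  shows "\<exists>(U :: (nat \<Rightarrow> 'a::euclidean_space) \<Rightarrow> real) \<gamma> C. chain_lyapunov d c U \<gamma> C"
proof -
  obtain rs where len: "length rs = d"
    and root: "\<And>r. r \<in> set rs \<Longrightarrow> r ^ d + (\<Sum>l<d. of_real (c l) * r ^ l) = 0"
    and co: "\<And>l. l < d \<Longrightarrow> coeff (\<Prod>r\<leftarrow>rs. [:- r, 1::complex:]) l = of_real (c l)"
    using monic_poly_roots[of d "\<lambda>l. of_real (c l)"] by auto
  define \<sigma> where "\<sigma> = Min (insert 1 ((\<lambda>r. - Re r) ` set rs))"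
  have "\<sigma> > 0" using root hurwitz by (auto simp: \<sigma>_def)
  have "\<sigma> \<le> - Re r" if "r \<in> set rs" for r
    using that by (auto simp: \<sigma>_def intro!: Min_le)
  then have Re: "Re r \<le> - \<sigma>" if "r \<in> set rs" for r
    using that by fastforce
  obtain C0 where "C0 \<ge> 0"
    and C0: "\<And>w. (\<Sum>l<d. cmod (w l)) \<le> C0 * sqrt (chain_energy \<sigma> rs w)"
    using chain_energy_bounds_entries[OF \<open>\<sigma> > 0\<close>, of rs] len by blast
  define K where "K = \<sigma> / 2 * (2 / \<sigma>\<^sup>2) ^ d"
  have "K > 0" using \<open>\<sigma> > 0\<close> by (simp add: K_def)
  define u :: "(nat \<Rightarrow> 'a) \<Rightarrow> 'a \<Rightarrow> nat \<Rightarrow> complex" where "u w b l = of_real (w l \<bullet> b)" for w b l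
  define U where "U w = (\<Sum>b\<in>Basis. chain_energy \<sigma> rs (u w b))" for w
  have coord: "chain_coord rs w = w d + (\<Sum>l<d. of_real (c l) * w l)" for w
  proof -
    have "{..d} = insert d {..<d}" by auto
    moreover have "coeff (\<Prod>r\<leftarrow>rs. [:- r, 1::complex:]) d = 1"
      using lead_coeff_prod_list_linear[of rs] by (simp add: degree_prod_list_linear len)
    ultimately show ?thesis by (simp add: chain_coord_eq_sum len co)
  qed
  have "chain_lyapunov d c U (\<sigma> / 2) (C0\<^sup>2 + K)"
    unfolding chain_lyapunov_def
  proof (intro conjI allI impI)
    show "\<sigma> / 2 > 0" "C0\<^sup>2 + K > 0" "U w \<ge> 0" for w
      using \<open>\<sigma> > 0\<close> \<open>K > 0\<close> by (auto simp: U_def add_nonneg_pos intro!: sum_nonneg chain_energy_nonneg)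
  next
    fix w :: "nat \<Rightarrow> 'a" and l
    assume "l < d"
    have "(w l \<bullet> b)\<^sup>2 \<le> C0\<^sup>2 * chain_energy \<sigma> rs (u w b)" for b
    proof -
      have "cmod (u w b l) \<le> (\<Sum>l<d. cmod (u w b l))"
        using \<open>l < d\<close> by (intro member_le_sum) auto
      also have "\<dots> \<le> C0 * sqrt (chain_energy \<sigma> rs (u w b))" by (rule C0)
      finally have "\<bar>w l \<bullet> b\<bar>\<^sup>2 \<le> (C0 * sqrt (chain_energy \<sigma> rs (u w b)))\<^sup>2"
        by (intro power_mono) (auto simp: u_def)
      then show ?thesis by (simp add: power_mult_distrib chain_energy_nonneg)
    qed
    then have "(norm (w l))\<^sup>2 \<le> C0\<^sup>2 * U w"
      unfolding U_def sum_distrib_left power2_norm_eq_inner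
      by (subst euclidean_inner) (auto simp: power2_eq_square intro!: sum_mono)
    also have "\<dots> \<le> (C0\<^sup>2 + K) * U w"
      using \<open>K > 0\<close> by (intro mult_right_mono) (auto simp: U_def intro!: sum_nonneg chain_energy_nonneg)
    finally show "(norm (w l))\<^sup>2 \<le> (C0\<^sup>2 + K) * U w" .
  next
    fix w :: "real \<Rightarrow> nat \<Rightarrow> 'a" and w' \<kappa> r t S
    assume "\<kappa> > 0"
      and der: "\<forall>l<d. ((\<lambda>s. w s l) has_vector_derivative w' l) (at t within S)"
      and step: "\<forall>l. Suc l < d \<longrightarrow> w' l = \<kappa> *\<^sub>R w t (Suc l)"
      and last: "d > 0 \<longrightarrow> w' (d - 1) = r - \<kappa> *\<^sub>R (\<Sum>l<d. c l *\<^sub>R w t l)"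
    define D where "D b = chain_energy_deriv \<sigma> rs (u (w t) b) (u w' b)" for b
    have "((\<lambda>s. chain_energy \<sigma> rs (u (w s) b)) has_real_derivative D b) (at t within S)" for b
      unfolding D_def
    proof (rule chain_energy_has_real_derivative)
      fix l assume "l < length rs"
      then have "((\<lambda>s. w s l \<bullet> b) has_real_derivative w' l \<bullet> b) (at t within S)"
        using bounded_linear.has_vector_derivative[OF bounded_linear_inner_left der[rule_format, of l]]
        by (simp add: len has_real_derivative_iff_has_vector_derivative)
      then show "((\<lambda>s. u (w s) b l) has_vector_derivative u w' b l) (at t within S)"
        unfolding u_def by (rule has_vector_derivative_of_real)
    qed
    then have DU: "((\<lambda>s. U (w s)) has_real_derivative (\<Sum>b\<in>Basis. D b)) (at t within S)"
      unfolding U_def by (intro DERIV_sum)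
    have "D b \<le> - (\<kappa> * (\<sigma> / 2) * chain_energy \<sigma> rs (u (w t) b)) + K / \<kappa> * (r \<bullet> b)\<^sup>2" for b
    proof -
      text \<open>The entry at index \<open>d\<close> continues the chain by the derivative that is actually
        attained, so that the forcing term is the value of the annihilating polynomial.\<close>
      define v where "v l = (if l < d then w t l
        else (1 / \<kappa>) *\<^sub>R r - (\<Sum>l<d. c l *\<^sub>R w t l))" for l
      have w': "w' l = \<kappa> *\<^sub>R v (Suc l)" if "l < d" for l
      proof (cases "Suc l < d")
        case False
        with that have "l = d - 1" by simp
        with last \<open>\<kappa> > 0\<close> that show ?thesis by (simp add: v_def algebra_simps)
      qed (use step that in \<open>simp add: v_def\<close>)
      have "D b = chain_energy_deriv \<sigma> rs (u v b) (\<lambda>l. of_real \<kappa> * u v b (Suc l))"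
        unfolding D_def
        by (rule chain_energy_deriv_cong) (auto simp: len u_def w' v_def)
      also have "\<dots> = \<kappa> * chain_energy_deriv \<sigma> rs (u v b) (\<lambda>l. u v b (Suc l))"
        by (rule chain_energy_deriv_scale)
      also have "\<dots> \<le> \<kappa> * (- (\<sigma> / 2) * chain_energy \<sigma> rs (u v b) + K * (cmod (chain_coord rs (u v b)))\<^sup>2)"
        unfolding K_def len[symmetric]
        using \<open>\<kappa> > 0\<close> by (intro mult_left_mono chain_energy_deriv_le \<open>\<sigma> > 0\<close> Re) auto
      also have "chain_energy \<sigma> rs (u v b) = chain_energy \<sigma> rs (u (w t) b)"
        by (rule chain_energy_cong) (simp add: len u_def v_def)
      also have "chain_coord rs (u v b) = of_real ((r \<bullet> b) / \<kappa>)"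
      proof -
        have "u v b d + (\<Sum>l<d. of_real (c l) * u v b l)
            = of_real (v d \<bullet> b + (\<Sum>l<d. c l * (v l \<bullet> b)))"
          by (simp add: u_def)
        also have "v d \<bullet> b + (\<Sum>l<d. c l * (v l \<bullet> b)) = (r \<bullet> b) / \<kappa>"
          by (simp add: v_def inner_diff_left inner_sum_left)
        finally show ?thesis by (simp add: coord)
      qed
      also have "\<kappa> * (- (\<sigma> / 2) * chain_energy \<sigma> rs (u (w t) b) + K * (cmod (of_real ((r \<bullet> b) / \<kappa>)))\<^sup>2)
          = - (\<kappa> * (\<sigma> / 2) * chain_energy \<sigma> rs (u (w t) b)) + K / \<kappa> * (r \<bullet> b)\<^sup>2"
        using \<open>\<kappa> > 0\<close> by (simp add: norm_divide power_divide field_simps power2_eq_square)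
      finally show ?thesis .
    qed
    then have "(\<Sum>b\<in>Basis. D b)
        \<le> (\<Sum>b\<in>Basis. - (\<kappa> * (\<sigma> / 2) * chain_energy \<sigma> rs (u (w t) b)) + K / \<kappa> * (r \<bullet> b)\<^sup>2)"
      by (rule sum_mono)
    also have "\<dots> = - (\<kappa> * (\<sigma> / 2) * U (w t)) + K / \<kappa> * (norm r)\<^sup>2"
    proof -
      have "(norm r)\<^sup>2 = (\<Sum>b\<in>Basis. (r \<bullet> b)\<^sup>2)"
        unfolding power2_norm_eq_inner by (subst euclidean_inner) (simp add: power2_eq_square)
      then show ?thesis
        by (simp add: U_def sum_subtractf sum_distrib_left)
    qed
    also have "\<dots> \<le> - (\<kappa> * (\<sigma> / 2) * U (w t)) + (C0\<^sup>2 + K) / \<kappa> * (norm r)\<^sup>2"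
      using \<open>\<kappa> > 0\<close> by (intro add_left_mono mult_right_mono divide_right_mono) auto
    finally show "\<exists>D. ((\<lambda>s. U (w s)) has_real_derivative D) (at t within S) \<and>
        D \<le> - (\<kappa> * (\<sigma> / 2) * U (w t)) + (C0\<^sup>2 + K) / \<kappa> * (norm r)\<^sup>2"
      using DU by blast
  qed
  then show ?thesis by blast
qed

section \<open>Differential inequalities and the choice of gains\<close>

lemma hurwitz_constant_coeff_pos:
  fixes c :: "nat \<Rightarrow> real"
  assumes hurwitz: "\<And>s::complex. s ^ d + (\<Sum>l<d. of_real (c l) * s ^ l) = 0 \<Longrightarrow> Re s < 0"
    and "d > 0"
  shows "c 0 > 0"
proof (rule ccontr)
  assume "\<not> c 0 > 0"
  define p where "p = monom 1 d + (\<Sum>l<d. monom (c l) l)"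
  have co: "coeff p l = (if l = d then 1 else if l < d then c l else 0)" for l
    by (simp add: p_def coeff_sum)
  have deg: "degree p = d"
    by (rule antisym) (auto intro!: degree_le le_degree simp: co)
  have p: "poly p x = x ^ d + (\<Sum>l<d. c l * x ^ l)" for x
    by (simp add: p_def poly_sum poly_monom)
  have noroot: "poly p x \<noteq> 0" if "x \<ge> 0" for x
  proof
    assume "poly p x = 0"
    then have "complex_of_real (poly p x) = 0" by simp
    then have "Re (complex_of_real x) < 0"
      by (intro hurwitz) (simp add: p)
    with that show False by simp
  qed
  obtain b where "\<forall>x\<ge>b. poly p x \<ge> lead_coeff p"
    using poly_pinfty_gt_lc[of p] co[of d] deg by auto
  then have "poly p (max b 1) > 0"
    using co[of d] deg by (metis less_le_trans max.cobounded1 zero_less_one)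
  moreover have "poly p 0 \<le> 0"
    using \<open>\<not> c 0 > 0\<close> \<open>d > 0\<close> co[of 0] by (simp add: poly_0_coeff_0)
  then have "poly p 0 < 0" using noroot[of 0] by simp
  moreover have "(0::real) < max b 1" by simp
  ultimately obtain x where "x > 0" "poly p x = 0"
    using poly_IVT_pos[of 0 "max b 1" p] by blast
  with noroot show False by simp
qed

fun deconv :: "(nat \<Rightarrow> real) \<Rightarrow> (nat \<Rightarrow> 'a::real_vector) \<Rightarrow> nat \<Rightarrow> 'a" where
  "deconv \<beta> e l = e l - (\<Sum>j = 1..l. \<beta> j *\<^sub>R deconv \<beta> e (l - j))"

declare deconv.simps [simp del]

lemma deconv_has_vector_derivative:
  assumes "\<And>j. j \<le> l \<Longrightarrow> ((\<lambda>s. e s j) has_vector_derivative e' j) (at t within S)"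
  shows "((\<lambda>s. deconv \<beta> (e s) l) has_vector_derivative deconv \<beta> e' l) (at t within S)"
  using assms
proof (induction l rule: less_induct)
  case (less l)
  have "((\<lambda>s. deconv \<beta> (e s) (l - j)) has_vector_derivative deconv \<beta> e' (l - j)) (at t within S)"
    if "j \<in> {1..l}" for j
    using that by (intro less.IH less.prems) auto
  then show ?case
    unfolding deconv.simps[of \<beta> _ l]
    by (intro has_vector_derivative_diff has_vector_derivative_sum less.prems
        bounded_linear.has_vector_derivative[OF bounded_linear_scaleR_right]) auto
qed

text \<open>Deconvolution turns the observer form of a linear system into its companion form.\<close>

lemma deconv_observer_form:
  assumes "\<And>l. l < n \<Longrightarrow> e' l = \<Gamma> *\<^sub>R (e (Suc l) - \<beta> (Suc l) *\<^sub>R e 0)" and "l < n"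
  shows "deconv \<beta> e' l = \<Gamma> *\<^sub>R deconv \<beta> e (Suc l)"
  using assms(2)
proof (induction l rule: less_induct)
  case (less l)
  have "(\<Sum>j = 1..l. \<beta> j *\<^sub>R deconv \<beta> e' (l - j))
      = (\<Sum>j = 1..l. \<Gamma> *\<^sub>R \<beta> j *\<^sub>R deconv \<beta> e (Suc l - j))"
  proof (rule sum.cong[OF refl])
    fix j assume "j \<in> {1..l}"
    then have "deconv \<beta> e' (l - j) = \<Gamma> *\<^sub>R deconv \<beta> e (Suc (l - j))"
      using less by auto
    with \<open>j \<in> {1..l}\<close> show "\<beta> j *\<^sub>R deconv \<beta> e' (l - j) = \<Gamma> *\<^sub>R \<beta> j *\<^sub>R deconv \<beta> e (Suc l - j)"
      by (simp add: Suc_diff_le)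
  qed
  also have "\<dots> = \<Gamma> *\<^sub>R (\<Sum>j = 1..l. \<beta> j *\<^sub>R deconv \<beta> e (Suc l - j))"
    by (simp only: scaleR_sum_right)
  finally have sum: "(\<Sum>j = 1..l. \<beta> j *\<^sub>R deconv \<beta> e' (l - j)) = \<dots>" .
  have "deconv \<beta> e (Suc l)
      = e (Suc l) - ((\<Sum>j = 1..l. \<beta> j *\<^sub>R deconv \<beta> e (Suc l - j)) + \<beta> (Suc l) *\<^sub>R deconv \<beta> e 0)"
    by (subst deconv.simps) (simp del: diff_Suc_Suc)
  also have "deconv \<beta> e 0 = e 0" by (subst deconv.simps) simp
  finally show ?case
    by (subst deconv.simps) (simp only: sum assms(1)[OF less.prems] scaleR_diff_right scaleR_add_right
        diff_diff_eq add.commute)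
qed

lemma has_real_derivative_exp_decay:
  fixes W :: "real \<Rightarrow> real"
  assumes der: "\<And>t. t \<ge> 0 \<Longrightarrow> \<exists>D. (W has_real_derivative D) (at t within {0..}) \<and> D \<le> - (r * W t)"
    and "t \<ge> 0"
  shows "W t \<le> W 0 * exp (- (r * t))"
proof -
  obtain D where D: "\<And>t. t \<ge> 0 \<Longrightarrow> (W has_real_derivative D t) (at t within {0..})"
    and le: "\<And>t. t \<ge> 0 \<Longrightarrow> D t \<le> - (r * W t)"
    using der by metis
  define g where "g t = W t * exp (r * t)" for t
  have g: "(g has_derivative (\<lambda>h. (D t * exp (r * t) + W t * (exp (r * t) * r)) * h)) (at t within {0..s})"
    if "t \<in> {0..s}" for t s
  proof -
    have "(W has_real_derivative D t) (at t within {0..s})"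
      using that by (intro DERIV_subset[OF D]) auto
    then have "(g has_real_derivative (D t * exp (r * t) + W t * (exp (r * t) * r))) (at t within {0..s})"
      unfolding g_def[abs_def] by (auto intro!: derivative_eq_intros)
    then show ?thesis by (simp add: has_field_derivative_def mult_commute_abs)
  qed
  have "\<exists>x\<in>{0..t}. g t - g 0 = (D x * exp (r * x) + W x * (exp (r * x) * r)) * (t - 0)"
    by (rule mvt_very_simple[OF \<open>t \<ge> 0\<close>]) (rule g, simp)
  then obtain x where "x \<in> {0..t}"
    and x: "g t - g 0 = (D x * exp (r * x) + W x * (exp (r * x) * r)) * (t - 0)"
    by blast
  have "(D x + r * W x) * exp (r * x) * t \<le> 0"
    using le[of x] \<open>x \<in> {0..t}\<close> \<open>t \<ge> 0\<close> by (intro mult_nonpos_nonneg) auto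
  then have "g t \<le> g 0" using x by (simp add: algebra_simps)
  then have "W t * exp (r * t) * exp (- (r * t)) \<le> W 0 * exp (- (r * t))"
    by (intro mult_right_mono) (auto simp: g_def)
  then show ?thesis by (simp add: mult.assoc flip: exp_add)
qed

lemma inner_le_Young:
  fixes x y :: "'a::real_inner"
  assumes "a > 0"
  shows "2 * (x \<bullet> y) \<le> a * (norm x)\<^sup>2 + (norm y)\<^sup>2 / a"
proof -
  have "0 \<le> (a * norm x - norm y)\<^sup>2 / a" using assms by simp
  also have "\<dots> = a * (norm x)\<^sup>2 + (norm y)\<^sup>2 / a - 2 * (norm x * norm y)"
    using assms by (simp add: field_simps power2_eq_square)
  finally show ?thesis using norm_cauchy_schwarz[of x y] by linarith
qed

lemma norm_add_power2_le:
  fixes x y :: "'a::real_inner"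
  shows "(norm (x + y))\<^sup>2 \<le> 2 * (norm x)\<^sup>2 + 2 * (norm y)\<^sup>2"
  using inner_le_Young[of 1 x y]
  by (simp add: power2_norm_eq_inner inner_add_left inner_add_right inner_commute)

lemma norm_diff_power2_le:
  fixes x y :: "'a::real_inner"
  shows "(norm (x - y))\<^sup>2 \<le> 2 * (norm x)\<^sup>2 + 2 * (norm y)\<^sup>2"
  using norm_add_power2_le[of x "- y"] by simp

lemma norm_sum_scaleR_power2_le:
  assumes "\<And>l. l \<in> S \<Longrightarrow> (norm (x l))\<^sup>2 \<le> B" and "B \<ge> 0"
  shows "(norm (\<Sum>l\<in>S. c l *\<^sub>R x l))\<^sup>2 \<le> (\<Sum>l\<in>S. \<bar>c l\<bar>)\<^sup>2 * B"
proof -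
  have "norm (\<Sum>l\<in>S. c l *\<^sub>R x l) \<le> (\<Sum>l\<in>S. \<bar>c l\<bar> * sqrt B)"
    using assms(1) by (intro order_trans[OF norm_sum] sum_mono)
      (auto intro!: mult_left_mono real_le_rsqrt)
  also have "\<dots> = (\<Sum>l\<in>S. \<bar>c l\<bar>) * sqrt B" by (simp add: sum_distrib_right)
  finally have "(norm (\<Sum>l\<in>S. c l *\<^sub>R x l))\<^sup>2 \<le> ((\<Sum>l\<in>S. \<bar>c l\<bar>) * sqrt B)\<^sup>2"
    by (intro power_mono) auto
  then show ?thesis using \<open>B \<ge> 0\<close> by (simp add: power_mult_distrib)
qed

lemma slow_mode_estimate:
  fixes v p X F :: "'a::real_inner"
  assumes "\<omega> > 0" "\<kappa> > 0" and v: "v = X + p"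
    and mono: "X \<bullet> F \<ge> \<omega> * (norm X)\<^sup>2" and lip: "(norm F)\<^sup>2 \<le> \<theta>\<^sup>2 * (norm X)\<^sup>2"
  shows "2 * (v \<bullet> (r - \<kappa> *\<^sub>R F)) \<le> - (\<kappa> * (\<omega> / 4) * (norm v)\<^sup>2)
    + \<kappa> * (\<omega> + \<theta>\<^sup>2 / \<omega>) * (norm p)\<^sup>2 + 4 / (\<kappa> * \<omega>) * (norm r)\<^sup>2"
proof -
  have "2 * ((- p) \<bullet> F) \<le> \<theta>\<^sup>2 / \<omega> * (norm p)\<^sup>2 + \<omega> * (norm X)\<^sup>2"
  proof (cases "\<theta> = 0")
    case True
    with lip show ?thesis using \<open>\<omega> > 0\<close> by simp
  next
    case False
    have "2 * ((- p) \<bullet> F) \<le> \<theta>\<^sup>2 / \<omega> * (norm (- p))\<^sup>2 + (norm F)\<^sup>2 / (\<theta>\<^sup>2 / \<omega>)"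
      using False \<open>\<omega> > 0\<close> by (intro inner_le_Young) auto
    also have "(norm F)\<^sup>2 / (\<theta>\<^sup>2 / \<omega>) \<le> (\<theta>\<^sup>2 * (norm X)\<^sup>2) / (\<theta>\<^sup>2 / \<omega>)"
      using lip \<open>\<omega> > 0\<close> by (intro divide_right_mono) auto
    also have "\<dots> = \<omega> * (norm X)\<^sup>2" using False by simp
    finally show ?thesis by simp
  qed
  moreover have "\<omega> * (norm v)\<^sup>2 \<le> \<omega> * (2 * (norm X)\<^sup>2 + 2 * (norm p)\<^sup>2)"
    unfolding v using \<open>\<omega> > 0\<close> by (intro mult_left_mono norm_add_power2_le) auto
  ultimately have "\<omega> / 2 * (norm v)\<^sup>2 - (\<omega> + \<theta>\<^sup>2 / \<omega>) * (norm p)\<^sup>2 \<le> 2 * (v \<bullet> F)"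
    using mono by (simp add: v inner_add_left algebra_simps)
  then have "\<kappa> * (\<omega> / 2 * (norm v)\<^sup>2 - (\<omega> + \<theta>\<^sup>2 / \<omega>) * (norm p)\<^sup>2) \<le> \<kappa> * (2 * (v \<bullet> F))"
    using \<open>\<kappa> > 0\<close> by (intro mult_left_mono) auto
  moreover have "2 * (v \<bullet> r) \<le> \<kappa> * \<omega> / 4 * (norm v)\<^sup>2 + (norm r)\<^sup>2 / (\<kappa> * \<omega> / 4)"
    using assms by (intro inner_le_Young) auto
  ultimately show ?thesis by (simp add: inner_diff_right algebra_simps)
qed

lemma integral_mode_estimate:
  fixes s y \<Phi> :: "'a::real_inner"
  assumes "a > 0"
  shows "2 * (s \<bullet> (\<Phi> - a *\<^sub>R (s - y))) \<le> - (a * (norm s)\<^sup>2) + 2 * a * (norm y)\<^sup>2 + 2 / a * (norm \<Phi>)\<^sup>2"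
proof -
  have "a * (2 * (s \<bullet> y)) \<le> a * (1 / 2 * (norm s)\<^sup>2 + (norm y)\<^sup>2 / (1 / 2))"
    using assms by (intro mult_left_mono inner_le_Young) auto
  moreover have "2 * (s \<bullet> \<Phi>) \<le> a / 2 * (norm s)\<^sup>2 + (norm \<Phi>)\<^sup>2 / (a / 2)"
    using assms by (intro inner_le_Young) auto
  ultimately show ?thesis
    by (simp add: inner_diff_right dot_square_norm algebra_simps)
qed

lemma gain_choice:
  fixes c C :: real
  assumes "c > 0" "C > 0"
  obtains \<kappa> \<Gamma> \<sigma> r :: real where "0 < \<kappa>" "\<kappa> \<le> 1" "1 \<le> \<Gamma>" "0 < \<sigma>" "\<sigma> \<le> 1" "0 < r"
    "\<And>A B E P Q. A \<ge> 0 \<Longrightarrow> B \<ge> 0 \<Longrightarrow> E \<ge> 0 \<Longrightarrow> P \<ge> 0 \<Longrightarrow> Q \<ge> 0 \<Longrightarrow>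
      (- (c * \<kappa> * A) + C * \<kappa> * E
        + C / \<kappa> * (P + \<kappa>\<^sup>2 * Q + \<kappa> ^ 4 * (A + B + E) + \<sigma>\<^sup>2 * (A + E)))
      + (- (c * \<kappa>\<^sup>2 * B) + C * \<kappa>\<^sup>2 * (A + E) + C / \<kappa>\<^sup>2 * (\<sigma>\<^sup>2 * (A + E)))
      + (- (c * E) + C * (P + \<kappa>\<^sup>2 * (A + E + Q) + \<kappa> ^ 4 * (A + B + E) + \<sigma>\<^sup>2 * (A + E)))
      + (- (c * \<Gamma> * P) + C / \<Gamma> * (A + B + E + P + Q))
      + (- (c * \<Gamma> * Q) + C / \<Gamma> * (A + B + E + P + Q))
      \<le> - (r * (A + B + E + P + Q))"
proof -
  define \<kappa> where "\<kappa> = min 1 (c / (40 * C))"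
  have \<kappa>: "0 < \<kappa>" "\<kappa> \<le> 1" using assms by (auto simp: \<kappa>_def)
  have C\<kappa>: "40 * (C * \<kappa>) \<le> c"
  proof -
    have "C * \<kappa> \<le> C * (c / (40 * C))" using assms by (intro mult_left_mono) (auto simp: \<kappa>_def)
    then show ?thesis using assms by simp
  qed
  define \<Gamma> where "\<Gamma> = 2 + 16 * C / (c * \<kappa>\<^sup>2)"
  have "16 * C / (c * \<kappa>\<^sup>2) > 0" using assms \<kappa> by simp
  then have \<Gamma>: "1 \<le> \<Gamma>" "16 * C / (c * \<kappa>\<^sup>2) \<le> \<Gamma>" by (auto simp: \<Gamma>_def)
  have G1: "16 * (C / \<Gamma>) \<le> c * \<kappa>\<^sup>2"
    using \<Gamma> assms \<kappa> by (simp add: field_simps)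
  have G2: "c * \<Gamma> = 2 * c + 16 * (C / \<kappa>\<^sup>2)"
    using assms \<kappa> by (simp add: \<Gamma>_def field_simps)
  have pw: "\<kappa> ^ a \<le> \<kappa> ^ b" if "b \<le> a" for a b
    using that \<kappa> by (intro power_decreasing) auto
  have C1: "40 * (C * \<kappa>\<^sup>2) \<le> c * \<kappa>" "40 * (C * \<kappa> ^ 3) \<le> c * \<kappa>\<^sup>2"
    using mult_right_mono[OF C\<kappa>, of \<kappa>] mult_right_mono[OF C\<kappa>, of "\<kappa>\<^sup>2"] \<kappa>
    by (auto simp: power2_eq_square power3_eq_cube mult.assoc)
  have C2: "C * \<kappa> ^ 3 \<le> C * \<kappa>\<^sup>2" "C * \<kappa> ^ 4 \<le> C * \<kappa> ^ 3" "C * \<kappa> ^ 5 \<le> C * \<kappa>\<^sup>2"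
    "C * \<kappa> ^ 6 \<le> C * \<kappa>\<^sup>2" "C * \<kappa>\<^sup>2 \<le> C * \<kappa>"
    using pw[of 2 3] pw[of 3 4] pw[of 2 5] pw[of 2 6] pw[of 1 2] assms by auto
  have c2: "c * \<kappa>\<^sup>2 \<le> c * \<kappa>" "c * \<kappa> \<le> c"
    using pw[of 1 2] \<kappa> assms by (auto intro: mult_left_mono simp: mult_left_le)
  have C3: "C \<le> C / \<kappa>" "C / \<kappa> \<le> C / \<kappa>\<^sup>2"
    using assms \<kappa> by (auto simp: field_simps power2_eq_square mult_left_le)
  have C4: "C / \<Gamma> \<le> C" using \<Gamma> assms by (simp add: field_simps)
  define R where "R = c * \<kappa>\<^sup>2 / 2"
  define g where "g = C / \<Gamma>"
  define aA where "aA = - (c * \<kappa>) + C * \<kappa> ^ 3 + C * \<kappa> ^ 5 + C * \<kappa>\<^sup>2 + C * \<kappa> ^ 4 + C * \<kappa>\<^sup>2 + C * \<kappa> ^ 4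
    + C * \<kappa> ^ 6 + 2 * g"
  define aB where "aB = - (c * \<kappa>\<^sup>2) + C * \<kappa> ^ 3 + C * \<kappa> ^ 4 + 2 * g"
  define aE where "aE = - c + C * \<kappa> + C * \<kappa> ^ 3 + C * \<kappa> ^ 5 + C * \<kappa>\<^sup>2 + C * \<kappa> ^ 4 + C * \<kappa>\<^sup>2 + C * \<kappa> ^ 4
    + C * \<kappa> ^ 6 + 2 * g"
  define aP where "aP = C / \<kappa> + C - c * \<Gamma> + 2 * g"
  define aQ where "aQ = C * \<kappa> + C * \<kappa>\<^sup>2 - c * \<Gamma> + 2 * g"
  have "c * \<kappa> > 0" "c * \<kappa>\<^sup>2 > 0" "C * \<kappa> > 0" using assms \<kappa> by auto
  note facts = this C\<kappa> C1 C2 c2 G1 G2 C3 C4 assms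
  have A: "aA \<le> - R"
    using facts unfolding aA_def R_def g_def by linarith
  have B: "aB \<le> - R"
    using facts unfolding aB_def R_def g_def by linarith
  have E: "aE \<le> - R"
    using facts unfolding aE_def R_def g_def by linarith
  have P: "aP \<le> - R"
    using facts unfolding aP_def R_def g_def by linarith
  have Q: "aQ \<le> - R"
    using facts unfolding aQ_def R_def g_def by linarith
  show thesis
  proof (rule that[of \<kappa> \<Gamma> "\<kappa> ^ 3" R])
    show "0 < \<kappa>" "\<kappa> \<le> 1" "1 \<le> \<Gamma>" "0 < \<kappa> ^ 3" "\<kappa> ^ 3 \<le> 1" "0 < R"
      using \<kappa> \<Gamma> assms by (auto simp: R_def power_le_one)
  next
    fix A B E P Q :: real
    assume nn: "A \<ge> 0" "B \<ge> 0" "E \<ge> 0" "P \<ge> 0" "Q \<ge> 0"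
    have le: "aA * A + aB * B + aE * E + aP * P + aQ * Q \<le> - R * A + - R * B + - R * E + - R * P + - R * Q"
      by (intro add_mono mult_right_mono A B E P Q nn)
    have 1: "C / \<kappa> * (P + \<kappa>\<^sup>2 * Q + \<kappa> ^ 4 * (A + B + E) + (\<kappa> ^ 3)\<^sup>2 * (A + E))
        = C / \<kappa> * P + C * \<kappa> * Q + C * \<kappa> ^ 3 * (A + B + E) + C * \<kappa> ^ 5 * (A + E)"
      using \<kappa> by (simp add: field_simps eval_nat_numeral)
    have 2: "C / \<kappa>\<^sup>2 * ((\<kappa> ^ 3)\<^sup>2 * (A + E)) = C * \<kappa> ^ 4 * (A + E)"
      using \<kappa> by (simp add: field_simps eval_nat_numeral)
    have 3: "(\<kappa> ^ 3)\<^sup>2 = \<kappa> ^ 6" by (simp flip: power_mult)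
    from le show "(- (c * \<kappa> * A) + C * \<kappa> * E
        + C / \<kappa> * (P + \<kappa>\<^sup>2 * Q + \<kappa> ^ 4 * (A + B + E) + (\<kappa> ^ 3)\<^sup>2 * (A + E)))
      + (- (c * \<kappa>\<^sup>2 * B) + C * \<kappa>\<^sup>2 * (A + E) + C / \<kappa>\<^sup>2 * ((\<kappa> ^ 3)\<^sup>2 * (A + E)))
      + (- (c * E) + C * (P + \<kappa>\<^sup>2 * (A + E + Q) + \<kappa> ^ 4 * (A + B + E) + (\<kappa> ^ 3)\<^sup>2 * (A + E)))
      + (- (c * \<Gamma> * P) + C / \<Gamma> * (A + B + E + P + Q))
      + (- (c * \<Gamma> * Q) + C / \<Gamma> * (A + B + E + P + Q))
      \<le> - (R * (A + B + E + P + Q))"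
      unfolding 1 2 unfolding 3 aA_def aB_def aE_def aP_def aQ_def g_def[symmetric]
      by (simp add: algebra_simps)
  qed
qed

section \<open>The closed loop in scaled time\<close>

lemma deconv_cong:
  "(\<And>j. j \<le> l \<Longrightarrow> e j = e' j) \<Longrightarrow> deconv \<beta> e l = deconv \<beta> e' l"
proof (induction l rule: less_induct)
  case (less l)
  have "deconv \<beta> e (l - j) = deconv \<beta> e' (l - j)" if "j \<in> {1..l}" for j
    using that by (intro less.IH less.prems) auto
  then show ?case
    unfolding deconv.simps[of \<beta> _ l] using less.prems[of l] by simp
qed

lemma forcing_bounds:
  fixes \<Phi> D G F Y s y k\<^sub>x :: "'a::real_inner"
  assumes K: "K \<ge> 1" and \<kappa>: "0 < \<kappa>" "\<kappa> \<le> 1" and \<sigma>: "0 < \<sigma>" "\<sigma> \<le> 1"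
    and nn: "A \<ge> 0" "E \<ge> 0" "P \<ge> 0" "Q \<ge> 0"
    and \<Phi>: "(norm \<Phi>)\<^sup>2 \<le> 2 * K\<^sup>2 * \<sigma>\<^sup>2 * (A + E)" and D: "(norm D)\<^sup>2 \<le> K * P"
    and G: "(norm (G - F))\<^sup>2 \<le> K * Q" and F: "(norm F)\<^sup>2 \<le> 2 * K\<^sup>2 * (A + E)"
    and y: "(norm y)\<^sup>2 \<le> 2 * K * (A + E)" and kx: "(norm k\<^sub>x)\<^sup>2 \<le> K * E"
    and s: "s = y + Y" and r: "r = \<Phi> - D - \<kappa> *\<^sub>R G - \<kappa>\<^sup>2 *\<^sub>R Y"
  defines "B \<equiv> (norm s)\<^sup>2"
  shows "(norm (r + \<kappa> *\<^sub>R F))\<^sup>2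
      \<le> 16 * K\<^sup>2 * (P + \<kappa>\<^sup>2 * Q + \<kappa> ^ 4 * (A + B + E) + \<sigma>\<^sup>2 * (A + E))" (is ?rt)
    and "(norm r)\<^sup>2
      \<le> 32 * K\<^sup>2 * (P + \<kappa>\<^sup>2 * (A + E + Q) + \<kappa> ^ 4 * (A + B + E) + \<sigma>\<^sup>2 * (A + E))" (is ?r)
    and "(norm (r - k\<^sub>x))\<^sup>2 \<le> 194 * K\<^sup>2 * (A + B + E + P + Q)" (is ?h)
proof -
  have "B \<ge> 0" by (simp add: B_def)
  have KK: "K \<le> K\<^sup>2" using K by (simp add: power2_eq_square)
  have KKm: "K * x \<le> K\<^sup>2 * x" if "x \<ge> 0" for x using KK that by (rule mult_right_mono)
  have "(norm Y)\<^sup>2 \<le> 2 * B + 2 * (norm y)\<^sup>2"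
    using norm_diff_power2_le[of s y] by (simp add: s B_def)
  also have "\<dots> \<le> 4 * K * (A + B + E)"
    using y mult_right_mono[OF K \<open>B \<ge> 0\<close>] \<open>B \<ge> 0\<close> by (simp add: algebra_simps)
  finally have Y: "(norm Y)\<^sup>2 \<le> 4 * K * (A + B + E)" .
  have "(norm (\<kappa> *\<^sub>R (G - F)))\<^sup>2 \<le> \<kappa>\<^sup>2 * (K * Q)"
    using G by (auto simp: power_mult_distrib intro!: mult_left_mono)
  moreover have "(norm (\<kappa>\<^sup>2 *\<^sub>R Y))\<^sup>2 \<le> \<kappa> ^ 4 * (4 * K * (A + B + E))"
    using Y by (auto simp: power_mult_distrib simp flip: power_mult intro!: mult_left_mono)
  ultimately have "(norm (\<kappa> *\<^sub>R (G - F) + \<kappa>\<^sup>2 *\<^sub>R Y))\<^sup>2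
      \<le> 2 * (\<kappa>\<^sup>2 * (K * Q)) + 2 * (\<kappa> ^ 4 * (4 * K * (A + B + E)))"
    using norm_add_power2_le[of "\<kappa> *\<^sub>R (G - F)" "\<kappa>\<^sup>2 *\<^sub>R Y"] by linarith
  moreover have "(norm (\<Phi> - D))\<^sup>2 \<le> 2 * (2 * K\<^sup>2 * \<sigma>\<^sup>2 * (A + E)) + 2 * (K * P)"
    using norm_diff_power2_le[of \<Phi> D] \<Phi> D by linarith
  ultimately have "(norm ((\<Phi> - D) - (\<kappa> *\<^sub>R (G - F) + \<kappa>\<^sup>2 *\<^sub>R Y)))\<^sup>2 \<le> 2 * (2 * (2 * K\<^sup>2 * \<sigma>\<^sup>2 * (A + E)) + 2 * (K * P))
      + 2 * (2 * (\<kappa>\<^sup>2 * (K * Q)) + 2 * (\<kappa> ^ 4 * (4 * K * (A + B + E))))"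
    by (intro order_trans[OF norm_diff_power2_le] add_mono mult_left_mono) (use \<Phi> D in auto)
  moreover have eq: "r + \<kappa> *\<^sub>R F = (\<Phi> - D) - (\<kappa> *\<^sub>R (G - F) + \<kappa>\<^sup>2 *\<^sub>R Y)"
    by (simp add: r algebra_simps)
  ultimately have "(norm (r + \<kappa> *\<^sub>R F))\<^sup>2 \<le> 2 * (2 * (2 * K\<^sup>2 * \<sigma>\<^sup>2 * (A + E)) + 2 * (K * P))
      + 2 * (2 * (\<kappa>\<^sup>2 * (K * Q)) + 2 * (\<kappa> ^ 4 * (4 * K * (A + B + E))))"
    by (simp only: eq)
  also have "\<dots> = 8 * (K\<^sup>2 * (\<sigma>\<^sup>2 * (A + E))) + 4 * (K * P) + 4 * (K * (\<kappa>\<^sup>2 * Q))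
      + 16 * (K * (\<kappa> ^ 4 * (A + B + E)))"
    by (simp add: algebra_simps)
  also have "\<dots> \<le> 16 * (K\<^sup>2 * (\<sigma>\<^sup>2 * (A + E))) + 16 * (K\<^sup>2 * P) + 16 * (K\<^sup>2 * (\<kappa>\<^sup>2 * Q))
      + 16 * (K\<^sup>2 * (\<kappa> ^ 4 * (A + B + E)))"
  proof (intro add_mono)
    show "8 * (K\<^sup>2 * (\<sigma>\<^sup>2 * (A + E))) \<le> 16 * (K\<^sup>2 * (\<sigma>\<^sup>2 * (A + E)))" using nn by simp
    have le: "4 * (K * x) \<le> 16 * (K\<^sup>2 * x)" if "x \<ge> 0" for x
      using KKm[OF that] mult_nonneg_nonneg[OF zero_le_power2[of K] that] by linarith
    show "4 * (K * P) \<le> 16 * (K\<^sup>2 * P)" by (rule le) (use nn in simp)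
    show "4 * (K * (\<kappa>\<^sup>2 * Q)) \<le> 16 * (K\<^sup>2 * (\<kappa>\<^sup>2 * Q))" by (rule le) (use nn in simp)
    show "16 * (K * (\<kappa> ^ 4 * (A + B + E))) \<le> 16 * (K\<^sup>2 * (\<kappa> ^ 4 * (A + B + E)))"
      by (intro mult_left_mono KKm) (use nn \<open>B \<ge> 0\<close> in auto)
  qed
  finally show rt: ?rt by (simp add: algebra_simps)
  have "(norm (\<kappa> *\<^sub>R F))\<^sup>2 \<le> \<kappa>\<^sup>2 * (2 * K\<^sup>2 * (A + E))"
    using F by (auto simp: power_mult_distrib intro!: mult_left_mono)
  then have "(norm r)\<^sup>2 \<le> 2 * (16 * K\<^sup>2 * (P + \<kappa>\<^sup>2 * Q + \<kappa> ^ 4 * (A + B + E) + \<sigma>\<^sup>2 * (A + E)))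
      + 2 * (\<kappa>\<^sup>2 * (2 * K\<^sup>2 * (A + E)))"
    using norm_diff_power2_le[of "r + \<kappa> *\<^sub>R F" "\<kappa> *\<^sub>R F"] rt by simp
  also have "\<dots> \<le> 2 * (16 * K\<^sup>2 * (P + \<kappa>\<^sup>2 * Q + \<kappa> ^ 4 * (A + B + E) + \<sigma>\<^sup>2 * (A + E)))
      + 32 * (K\<^sup>2 * (\<kappa>\<^sup>2 * (A + E)))"
  proof -
    have "0 \<le> K\<^sup>2 * (\<kappa>\<^sup>2 * (A + E))" using nn by simp
    then show ?thesis by (simp add: algebra_simps)
  qed
  finally show r': ?r by (simp add: algebra_simps)
  have "P + \<kappa>\<^sup>2 * (A + E + Q) + \<kappa> ^ 4 * (A + B + E) + \<sigma>\<^sup>2 * (A + E)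
      \<le> P + 1 * (A + E + Q) + 1 * (A + B + E) + 1 * (A + E)"
    using nn \<open>B \<ge> 0\<close> \<kappa> \<sigma> by (intro add_mono mult_right_mono power_le_one) auto
  also have "\<dots> \<le> 3 * (A + B + E + P + Q)" using nn \<open>B \<ge> 0\<close> by simp
  finally have "32 * K\<^sup>2 * (P + \<kappa>\<^sup>2 * (A + E + Q) + \<kappa> ^ 4 * (A + B + E) + \<sigma>\<^sup>2 * (A + E))
      \<le> 32 * K\<^sup>2 * (3 * (A + B + E + P + Q))"
    by (intro mult_left_mono) auto
  also have "\<dots> = 96 * (K\<^sup>2 * (A + B + E + P + Q))" by (simp add: algebra_simps)
  finally have "(norm r)\<^sup>2 \<le> 96 * (K\<^sup>2 * (A + B + E + P + Q))" using r' by linarith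
  moreover have "K * E \<le> K\<^sup>2 * (A + B + E + P + Q)"
    using KKm[of E] nn \<open>B \<ge> 0\<close> mult_left_mono[of E "A + B + E + P + Q" "K\<^sup>2"] by auto
  ultimately show ?h
    using norm_diff_power2_le[of r k\<^sub>x] kx by linarith
qed

definition scaled_loop ::
    "nat \<Rightarrow> (nat \<Rightarrow> real) \<Rightarrow> (nat \<Rightarrow> real) \<Rightarrow> ('a::real_inner \<Rightarrow> 'a) \<Rightarrow> real \<Rightarrow> real \<Rightarrow> real \<Rightarrow> real \<Rightarrow> real \<Rightarrow>
     (nat \<Rightarrow> real \<Rightarrow> 'a) \<Rightarrow> (nat \<Rightarrow> real \<Rightarrow> 'a) \<Rightarrow> (real \<Rightarrow> 'a) \<Rightarrow> (real \<Rightarrow> 'a) \<Rightarrow> (real \<Rightarrow> 'a) \<Rightarrow>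
     (real \<Rightarrow> real) \<Rightarrow> bool" where
  "scaled_loop m k \<beta> F c C \<kappa> \<Gamma> \<sigma> X Z Y G \<Phi> Q \<longleftrightarrow> (\<forall>t\<ge>0.
    (\<forall>l<m. (X l has_vector_derivative X (Suc l) t) (at t within {0..})) \<and>
    (X m has_vector_derivative
      \<Phi> t - (\<Sum>l<m. k (Suc l) *\<^sub>R Z (Suc l) t) - \<kappa> *\<^sub>R G t - \<kappa>\<^sup>2 *\<^sub>R Y t) (at t within {0..}) \<and>
    (Y has_vector_derivative (\<Sum>l<m. k (Suc l) *\<^sub>R Z (Suc l) t) + \<kappa> *\<^sub>R G t) (at t within {0..}) \<and>
    (\<forall>l\<le>m. (Z l has_vector_derivative
      (if l < m then Z (Suc l) t else 0) + (\<Gamma> ^ Suc l * \<beta> (Suc l)) *\<^sub>R (X 0 t - Z 0 t))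
      (at t within {0..})) \<and>
    norm (\<Phi> t) \<le> \<sigma> * (\<Sum>l\<le>m. norm (X l t)) \<and>
    0 \<le> Q t \<and> (norm (G t - F (X 0 t)))\<^sup>2 \<le> C * Q t \<and>
    (\<forall>V. (X 0 has_vector_derivative V) (at t within {0..}) \<longrightarrow>
      (\<exists>D. (Q has_real_derivative D) (at t within {0..}) \<and>
        D \<le> - (c * \<Gamma> * Q t) + C / \<Gamma> * (norm V)\<^sup>2)))"

lemma scaled_loop_decay:
  fixes F :: "'a::euclidean_space \<Rightarrow> 'a"
  assumes hk: "\<And>s::complex. s ^ m + (\<Sum>l<m. of_real (k (Suc l)) * s ^ l) = 0 \<Longrightarrow> Re s < 0"
    and h\<beta>: "\<And>s::complex. s ^ Suc m + (\<Sum>l<Suc m. of_real (\<beta> (Suc m - l)) * s ^ l) = 0 \<Longrightarrow> Re s < 0"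
    and "\<omega> > 0" and mono: "strongly_monotone \<omega> F" and lip: "\<theta>-lipschitz_on UNIV F" and "F 0 = 0"
    and "c\<^sub>0 > 0" "C\<^sub>0 > 0"
  shows "\<exists>\<kappa>>0. \<exists>\<Gamma>>0. \<exists>\<sigma>>0. \<exists>r>0. \<forall>X Z Y G \<Phi> Q. scaled_loop m k \<beta> F c\<^sub>0 C\<^sub>0 \<kappa> \<Gamma> \<sigma> X Z Y G \<Phi> Q \<longrightarrow>
    (\<exists>C>0. \<forall>t\<ge>0. norm (X 0 t) \<le> C * exp (- (r * t)))"
proof -
  obtain U\<^sub>1 :: "(nat \<Rightarrow> 'a) \<Rightarrow> real" and \<gamma>\<^sub>1 C\<^sub>1
    where L1: "chain_lyapunov m (\<lambda>l. k (Suc l)) U\<^sub>1 \<gamma>\<^sub>1 C\<^sub>1"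
    using hurwitz_chain_lyapunov[of m "\<lambda>l. k (Suc l)", OF hk] by blast
  then have U1: "\<gamma>\<^sub>1 > 0" "C\<^sub>1 > 0" "\<And>w. U\<^sub>1 w \<ge> 0"
    and U1_bound: "\<And>w l. l < m \<Longrightarrow> (norm (w l))\<^sup>2 \<le> C\<^sub>1 * U\<^sub>1 w"
    unfolding chain_lyapunov_def by blast+
  obtain U\<^sub>2 :: "(nat \<Rightarrow> 'a) \<Rightarrow> real" and \<gamma>\<^sub>2 C\<^sub>2
    where L2: "chain_lyapunov (Suc m) (\<lambda>l. \<beta> (Suc m - l)) U\<^sub>2 \<gamma>\<^sub>2 C\<^sub>2"
    using hurwitz_chain_lyapunov[of "Suc m" "\<lambda>l. \<beta> (Suc m - l)", OF h\<beta>] by blast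
  then have U2: "\<gamma>\<^sub>2 > 0" "C\<^sub>2 > 0" "\<And>w. U\<^sub>2 w \<ge> 0"
    and U2_bound: "\<And>w l. l < Suc m \<Longrightarrow> (norm (w l))\<^sup>2 \<le> C\<^sub>2 * U\<^sub>2 w"
    unfolding chain_lyapunov_def by blast+
  define kk where "kk l = (if l = Suc m then 1 else k l)" for l
  define k\<^sub>0 where "k\<^sub>0 = kk 1"
  have "k\<^sub>0 > 0"
  proof (cases "m = 0")
    case False
    then show ?thesis
      using hurwitz_constant_coeff_pos[of m "\<lambda>l. k (Suc l)", OF hk] by (simp add: k\<^sub>0_def kk_def)
  qed (simp add: k\<^sub>0_def kk_def)
  define ks where "ks = (\<Sum>l<m. \<bar>k (Suc l)\<bar>)"
  define ps where "ps = (\<Sum>l<m. \<bar>kk (Suc (Suc l)) / k\<^sub>0\<bar>)"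
  define bs where "bs = (\<Sum>j=1..Suc m. \<bar>\<beta> j\<bar>)"
  define K where "K = 1 + \<theta>\<^sup>2 + (real (Suc m))\<^sup>2 + C\<^sub>0 + C\<^sub>1 + ks\<^sup>2 * C\<^sub>1 + ps\<^sup>2 * C\<^sub>1
    + ks\<^sup>2 * (2 * (1 + bs\<^sup>2) * C\<^sub>2)"
  have nn: "0 \<le> ks\<^sup>2 * C\<^sub>1" "0 \<le> ps\<^sup>2 * C\<^sub>1" "0 \<le> ks\<^sup>2 * (2 * (1 + bs\<^sup>2) * C\<^sub>2)" "0 \<le> \<theta>\<^sup>2" "0 \<le> (real (Suc m))\<^sup>2"
    using U1 U2 by auto
  then have K: "1 \<le> K" "\<theta>\<^sup>2 \<le> K" "(real (Suc m))\<^sup>2 \<le> K" "C\<^sub>0 \<le> K" "C\<^sub>1 \<le> K" "ks\<^sup>2 * C\<^sub>1 \<le> K"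
    "ps\<^sup>2 * C\<^sub>1 \<le> K" "ks\<^sup>2 * (2 * (1 + bs\<^sup>2) * C\<^sub>2) \<le> K"
    using \<open>C\<^sub>0 > 0\<close> U1(2) unfolding K_def by linarith+
  define c where "c = min (min (\<omega> / (4 * k\<^sub>0)) 1) (min (min \<gamma>\<^sub>1 \<gamma>\<^sub>2) c\<^sub>0)"
  have c: "c > 0" "c \<le> \<omega> / (4 * k\<^sub>0)" "c \<le> 1" "c \<le> \<gamma>\<^sub>1" "c \<le> \<gamma>\<^sub>2" "c \<le> c\<^sub>0"
    using \<open>\<omega> > 0\<close> \<open>k\<^sub>0 > 0\<close> U1(1) U2(1) \<open>c\<^sub>0 > 0\<close> by (auto simp: c_def)
  define C where "C = (\<omega> + \<theta>\<^sup>2 / \<omega>) * K / k\<^sub>0 + 64 * K\<^sup>2 / (\<omega> * k\<^sub>0) + 4 * K\<^sup>2 + 32 * K\<^sup>2 * C\<^sub>1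
    + 194 * K\<^sup>2 * C\<^sub>2 + 194 * K\<^sup>2 * C\<^sub>0"
  have "0 \<le> (\<omega> + \<theta>\<^sup>2 / \<omega>) * K / k\<^sub>0" "0 \<le> 64 * K\<^sup>2 / (\<omega> * k\<^sub>0)" "0 < 4 * K\<^sup>2" "0 \<le> 32 * K\<^sup>2 * C\<^sub>1"
    "0 \<le> 194 * K\<^sup>2 * C\<^sub>2" "0 \<le> 194 * K\<^sup>2 * C\<^sub>0"
    using \<open>\<omega> > 0\<close> \<open>k\<^sub>0 > 0\<close> U1(2) U2(2) \<open>C\<^sub>0 > 0\<close> K(1) by auto
  then have C: "C > 0" "(\<omega> + \<theta>\<^sup>2 / \<omega>) * K / k\<^sub>0 \<le> C" "64 * K\<^sup>2 / (\<omega> * k\<^sub>0) \<le> C" "4 * K\<^sup>2 \<le> C"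
    "32 * K\<^sup>2 * C\<^sub>1 \<le> C" "194 * K\<^sup>2 * C\<^sub>2 \<le> C" "194 * K\<^sup>2 * C\<^sub>0 \<le> C"
    unfolding C_def by linarith+
  obtain \<kappa> \<Gamma> \<sigma> r where \<kappa>: "0 < \<kappa>" "\<kappa> \<le> 1" and \<Gamma>: "1 \<le> \<Gamma>" and \<sigma>: "0 < \<sigma>" "\<sigma> \<le> 1" and "0 < r"
    and gain: "\<And>A B E P Q. A \<ge> 0 \<Longrightarrow> B \<ge> 0 \<Longrightarrow> E \<ge> 0 \<Longrightarrow> P \<ge> 0 \<Longrightarrow> Q \<ge> 0 \<Longrightarrow>
      (- (c * \<kappa> * A) + C * \<kappa> * E
        + C / \<kappa> * (P + \<kappa>\<^sup>2 * Q + \<kappa> ^ 4 * (A + B + E) + \<sigma>\<^sup>2 * (A + E)))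
      + (- (c * \<kappa>\<^sup>2 * B) + C * \<kappa>\<^sup>2 * (A + E) + C / \<kappa>\<^sup>2 * (\<sigma>\<^sup>2 * (A + E)))
      + (- (c * E) + C * (P + \<kappa>\<^sup>2 * (A + E + Q) + \<kappa> ^ 4 * (A + B + E) + \<sigma>\<^sup>2 * (A + E)))
      + (- (c * \<Gamma> * P) + C / \<Gamma> * (A + B + E + P + Q))
      + (- (c * \<Gamma> * Q) + C / \<Gamma> * (A + B + E + P + Q))
      \<le> - (r * (A + B + E + P + Q))"
    using gain_choice[OF c(1) C(1)] by metis
  have "\<exists>C>0. \<forall>t\<ge>0. norm (X 0 t) \<le> C * exp (- (r / 2 * t))"
    if loop: "scaled_loop m k \<beta> F c\<^sub>0 C\<^sub>0 \<kappa> \<Gamma> \<sigma> X Z Y G \<Phi> Q" for X Z Y G \<Phi> Q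
  proof -
    define p where "p t = (\<Sum>l<m. (kk (Suc (Suc l)) / k\<^sub>0) *\<^sub>R X (Suc l) t)" for t
    define v where "v t = X 0 t + p t" for t
    define s where "s t = X m t + Y t" for t
    define e where "e t l = \<Gamma> ^ (m - l) *\<^sub>R (Z l t - X l t)" for t l
    define A where "A t = (norm (v t))\<^sup>2" for t
    define B where "B t = (norm (s t))\<^sup>2" for t
    define E where "E t = U\<^sub>1 (\<lambda>l. X (Suc l) t)" for t
    define P where "P t = U\<^sub>2 (deconv \<beta> (e t))" for t
    define W where "W t = A t + B t + E t + P t + Q t" for t
    have nn: "0 \<le> A t" "0 \<le> B t" "0 \<le> E t" "0 \<le> P t" for t
      using U1(3) U2(3) by (auto simp: A_def B_def E_def P_def)
    have X_bound: "(norm (X (Suc l) t))\<^sup>2 \<le> K * E t" if "l < m" for l t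
      using U1_bound[OF that, of "\<lambda>l. X (Suc l) t"] mult_right_mono[OF K(5) nn(3)[of t]]
      by (simp add: E_def)
    have p_bound: "(norm (p t))\<^sup>2 \<le> K * E t" for t
    proof -
      have "(norm (p t))\<^sup>2 \<le> ps\<^sup>2 * (C\<^sub>1 * E t)"
        unfolding p_def ps_def E_def
        by (rule norm_sum_scaleR_power2_le) (use U1_bound[of _ "\<lambda>l. X (Suc l) t"] U1 in auto)
      then show ?thesis using mult_right_mono[OF K(7) nn(3)[of t]] by (simp add: mult.assoc)
    qed
    have X0_bound: "(norm (X 0 t))\<^sup>2 \<le> 2 * K * (A t + E t)" for t
      using norm_diff_power2_le[of "v t" "p t"] p_bound[of t] mult_right_mono[OF K(1) nn(1)[of t]]
      by (simp add: v_def A_def algebra_simps)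
    have W_deriv: "\<exists>D. (W has_real_derivative D) (at t within {0..}) \<and> D \<le> - (r * W t)"
      if "t \<ge> 0" for t
    proof -
      have loop_t:
        "\<And>l. l < m \<Longrightarrow> (X l has_vector_derivative X (Suc l) t) (at t within {0..})"
        "(X m has_vector_derivative \<Phi> t - (\<Sum>l<m. k (Suc l) *\<^sub>R Z (Suc l) t) - \<kappa> *\<^sub>R G t - \<kappa>\<^sup>2 *\<^sub>R Y t)
          (at t within {0..})"
        "(Y has_vector_derivative (\<Sum>l<m. k (Suc l) *\<^sub>R Z (Suc l) t) + \<kappa> *\<^sub>R G t) (at t within {0..})"
        "\<And>l. l \<le> m \<Longrightarrow> (Z l has_vector_derivative (if l < m then Z (Suc l) t else 0)
          + (\<Gamma> ^ Suc l * \<beta> (Suc l)) *\<^sub>R (X 0 t - Z 0 t)) (at t within {0..})"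
        and \<Phi>_small: "norm (\<Phi> t) \<le> \<sigma> * (\<Sum>l\<le>m. norm (X l t))"
        and "0 \<le> Q t" and G_bound: "(norm (G t - F (X 0 t)))\<^sup>2 \<le> C\<^sub>0 * Q t"
        and Q_deriv: "\<And>V. (X 0 has_vector_derivative V) (at t within {0..}) \<Longrightarrow>
          \<exists>D. (Q has_real_derivative D) (at t within {0..}) \<and>
            D \<le> - (c\<^sub>0 * \<Gamma> * Q t) + C\<^sub>0 / \<Gamma> * (norm V)\<^sup>2"
        using loop \<open>t \<ge> 0\<close> unfolding scaled_loop_def by blast+
      define D where "D = (\<Sum>l<m. k (Suc l) *\<^sub>R (Z (Suc l) t - X (Suc l) t))"
      define k\<^sub>x where "k\<^sub>x = (\<Sum>l<m. k (Suc l) *\<^sub>R X (Suc l) t)"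
      define f where "f = \<Phi> t - D - \<kappa> *\<^sub>R G t - \<kappa>\<^sup>2 *\<^sub>R Y t"
      define X' where "X' l = (if l < m then X (Suc l) t else f - k\<^sub>x)" for l
      have kZ: "(\<Sum>l<m. k (Suc l) *\<^sub>R Z (Suc l) t) = D + k\<^sub>x"
        by (simp add: D_def k\<^sub>x_def scaleR_diff_right sum_subtractf)
      have dX: "(X l has_vector_derivative X' l) (at t within {0..})" if "l \<le> m" for l
      proof (cases "l < m")
        case False
        with that have "l = m" by simp
        with loop_t(2) show ?thesis by (simp add: X'_def f_def kZ algebra_simps)
      qed (simp add: X'_def loop_t(1))

      have dA: "(A has_real_derivative 2 * (v t \<bullet> ((1 / k\<^sub>0) *\<^sub>R f))) (at t within {0..})"
      proof -
        have "(p has_vector_derivative (\<Sum>l<m. (kk (Suc (Suc l)) / k\<^sub>0) *\<^sub>R X' (Suc l))) (at t within {0..})"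
          unfolding p_def by (intro has_vector_derivative_sum dX
              bounded_linear.has_vector_derivative[OF bounded_linear_scaleR_right]) auto
        then have "(v has_vector_derivative X' 0 + (\<Sum>l<m. (kk (Suc (Suc l)) / k\<^sub>0) *\<^sub>R X' (Suc l)))
            (at t within {0..})"
          unfolding v_def by (intro has_vector_derivative_add dX) auto
        also have "X' 0 + (\<Sum>l<m. (kk (Suc (Suc l)) / k\<^sub>0) *\<^sub>R X' (Suc l))
            = (1 / k\<^sub>0) *\<^sub>R (\<Sum>l<Suc m. kk (Suc l) *\<^sub>R X' l)"
          using \<open>k\<^sub>0 > 0\<close> unfolding sum.lessThan_Suc_shift
          by (simp add: k\<^sub>0_def scaleR_add_right scaleR_sum_right)
        also have "(\<Sum>l<Suc m. kk (Suc l) *\<^sub>R X' l) = f"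
          by (simp add: kk_def X'_def k\<^sub>x_def)
        finally show ?thesis
          unfolding A_def[abs_def] by (rule has_real_derivative_norm_power2)
      qed
      have dB: "(B has_real_derivative 2 * (s t \<bullet> (\<Phi> t - \<kappa>\<^sup>2 *\<^sub>R (s t - X m t)))) (at t within {0..})"
      proof -
        have "(s has_vector_derivative X' m + (D + k\<^sub>x + \<kappa> *\<^sub>R G t)) (at t within {0..})"
          unfolding s_def using loop_t(3) kZ by (intro has_vector_derivative_add dX) auto
        also have "X' m + (D + k\<^sub>x + \<kappa> *\<^sub>R G t) = \<Phi> t - \<kappa>\<^sup>2 *\<^sub>R (s t - X m t)"
          by (simp add: X'_def f_def s_def)
        finally show ?thesis
          unfolding B_def[abs_def] by (rule has_real_derivative_norm_power2)
      qed
      have "\<exists>d. (E has_real_derivative d) (at t within {0..}) \<and>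
          d \<le> - (1 * \<gamma>\<^sub>1 * E t) + C\<^sub>1 / 1 * (norm f)\<^sup>2"
        unfolding E_def
      proof (rule chain_lyapunov_deriv[OF L1 zero_less_one, where w' = "\<lambda>l. X' (Suc l)"])
        show "(X (Suc l) has_vector_derivative X' (Suc l)) (at t within {0..})" if "l < m" for l
          using that by (intro dX) auto
      qed (auto simp: X'_def k\<^sub>x_def)
      then obtain d\<^sub>E where dE: "(E has_real_derivative d\<^sub>E) (at t within {0..})"
        and d\<^sub>E: "d\<^sub>E \<le> - (\<gamma>\<^sub>1 * E t) + C\<^sub>1 * (norm f)\<^sup>2" by auto
      have "\<exists>d. (P has_real_derivative d) (at t within {0..}) \<and>
          d \<le> - (\<Gamma> * \<gamma>\<^sub>2 * P t) + C\<^sub>2 / \<Gamma> * (norm (k\<^sub>x - f))\<^sup>2"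
        unfolding P_def
      proof (rule chain_lyapunov_deriv[OF L2])
        define e' where "e' l = \<Gamma> ^ (m - l) *\<^sub>R ((if l < m then Z (Suc l) t else 0)
          + (\<Gamma> ^ Suc l * \<beta> (Suc l)) *\<^sub>R (X 0 t - Z 0 t) - X' l)" for l
        text \<open>As for the chains above, the entry after the last one encodes the forcing.\<close>
        define E' where "E' l = (if l \<le> m then e t l else (1 / \<Gamma>) *\<^sub>R (k\<^sub>x - f))" for l
        have E'_eq: "e' l = \<Gamma> *\<^sub>R (E' (Suc l) - \<beta> (Suc l) *\<^sub>R E' 0)" if "l < Suc m" for l
        proof -
          have "\<Gamma> ^ (m - l) * \<Gamma> ^ Suc l = \<Gamma> * \<Gamma> ^ m"
            using that by (simp flip: power_add)
          then have "(\<Gamma> * \<beta> (Suc l)) *\<^sub>R E' 0 = (\<Gamma> ^ (m - l) * \<Gamma> ^ Suc l * \<beta> (Suc l)) *\<^sub>R (Z 0 t - X 0 t)"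
            by (simp only: E'_def e_def) (simp add: mult_ac)
          then have "e' l = \<Gamma> ^ (m - l) *\<^sub>R ((if l < m then Z (Suc l) t else 0) - X' l)
              - (\<Gamma> * \<beta> (Suc l)) *\<^sub>R E' 0"
            by (simp add: e'_def scaleR_diff_right scaleR_add_right mult.assoc)
          moreover have "\<Gamma> ^ (m - l) *\<^sub>R ((if l < m then Z (Suc l) t else 0) - X' l) = \<Gamma> *\<^sub>R E' (Suc l)"
          proof (cases "l < m")
            case True
            then have "m - l = Suc (m - Suc l)" by simp
            with True show ?thesis by (simp add: E'_def e_def X'_def)
          next
            case False
            with that \<Gamma> show ?thesis by (simp add: E'_def X'_def)
          qed
          ultimately show ?thesis by (simp add: algebra_simps)
        qed
        show "0 < \<Gamma>" using \<Gamma> by simp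
        show "((\<lambda>s. deconv \<beta> (e s) l) has_vector_derivative deconv \<beta> e' l) (at t within {0..})"
          if "l < Suc m" for l
          unfolding e_def e'_def using that
          by (intro deconv_has_vector_derivative has_vector_derivative_diff loop_t(4) dX
              bounded_linear.has_vector_derivative[OF bounded_linear_scaleR_right]) auto
        have E'_deconv: "deconv \<beta> E' l = deconv \<beta> (e t) l" if "l \<le> m" for l
          using that by (intro deconv_cong) (simp add: E'_def)
        show "deconv \<beta> e' l = \<Gamma> *\<^sub>R deconv \<beta> (e t) (Suc l)" if "Suc l < Suc m" for l
          using deconv_observer_form[where n = "Suc m", OF E'_eq, of l] that by (simp add: E'_deconv)
        have "deconv \<beta> e' m = \<Gamma> *\<^sub>R deconv \<beta> E' (Suc m)"
          using deconv_observer_form[where n = "Suc m", OF E'_eq, of m] by simp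
        also have "deconv \<beta> E' (Suc m) = (1 / \<Gamma>) *\<^sub>R (k\<^sub>x - f)
            - (\<Sum>j = 1..Suc m. \<beta> j *\<^sub>R deconv \<beta> (e t) (Suc m - j))"
        proof -
          have "(\<Sum>j = 1..Suc m. \<beta> j *\<^sub>R deconv \<beta> E' (Suc m - j))
              = (\<Sum>j = 1..Suc m. \<beta> j *\<^sub>R deconv \<beta> (e t) (Suc m - j))"
            by (rule sum.cong[OF refl], subst E'_deconv) auto
          then show ?thesis by (subst deconv.simps) (simp only: E'_def, simp)
        qed
        also have "(\<Sum>j = 1..Suc m. \<beta> j *\<^sub>R deconv \<beta> (e t) (Suc m - j))
            = (\<Sum>l<Suc m. \<beta> (Suc m - l) *\<^sub>R deconv \<beta> (e t) l)"
          by (rule sum.reindex_bij_witness[of _ "\<lambda>l. Suc m - l" "\<lambda>j. Suc m - j"]) auto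
        finally show "deconv \<beta> e' (Suc m - 1)
            = (k\<^sub>x - f) - \<Gamma> *\<^sub>R (\<Sum>l<Suc m. \<beta> (Suc m - l) *\<^sub>R deconv \<beta> (e t) l)"
          using \<Gamma> by (simp add: scaleR_diff_right)
      qed
      then obtain d\<^sub>P where dP: "(P has_real_derivative d\<^sub>P) (at t within {0..})"
        and d\<^sub>P: "d\<^sub>P \<le> - (\<Gamma> * \<gamma>\<^sub>2 * P t) + C\<^sub>2 / \<Gamma> * (norm (f - k\<^sub>x))\<^sup>2"
        by (auto simp: norm_minus_commute)
      obtain d\<^sub>Q where dQ: "(Q has_real_derivative d\<^sub>Q) (at t within {0..})"
        and d\<^sub>Q: "d\<^sub>Q \<le> - (c\<^sub>0 * \<Gamma> * Q t) + C\<^sub>0 / \<Gamma> * (norm (X' 0))\<^sup>2"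
        using Q_deriv[OF dX[of 0]] by auto

      have X_all: "(norm (X l t))\<^sup>2 \<le> 2 * K * (A t + E t)" if "l \<le> m" for l
      proof (cases l)
        case (Suc j)
        have "K * E t \<le> 2 * K * (A t + E t)"
          using nn[of t] K(1) by (simp add: algebra_simps)
        then show ?thesis using X_bound[of j t] that Suc by auto
      qed (use X0_bound in simp)
      have \<Phi>_bound: "(norm (\<Phi> t))\<^sup>2 \<le> 2 * K\<^sup>2 * \<sigma>\<^sup>2 * (A t + E t)"
      proof -
        define b where "b = sqrt (2 * K * (A t + E t))"
        have "norm (X l t) \<le> b" if "l \<le> m" for l
          unfolding b_def by (rule real_le_rsqrt[OF X_all[OF that]])
        then have "(\<Sum>l\<le>m. norm (X l t)) \<le> real (Suc m) * b"
          using sum_mono[of "{..m}" "\<lambda>l. norm (X l t)" "\<lambda>_. b"] by simp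
        then have "\<sigma> * (\<Sum>l\<le>m. norm (X l t)) \<le> \<sigma> * (real (Suc m) * b)"
          using \<sigma> by (intro mult_left_mono) auto
        with \<Phi>_small have "norm (\<Phi> t) \<le> \<sigma> * (real (Suc m) * b)" by (rule order_trans)
        then have "(norm (\<Phi> t))\<^sup>2 \<le> (\<sigma> * (real (Suc m) * b))\<^sup>2"
          by (rule power_mono) simp
        also have "\<dots> = (real (Suc m))\<^sup>2 * (\<sigma>\<^sup>2 * (2 * K * (A t + E t)))"
          using nn[of t] K(1) by (simp add: power_mult_distrib b_def)
        also have "\<dots> \<le> K * (\<sigma>\<^sup>2 * (2 * K * (A t + E t)))"
          using K nn[of t] by (intro mult_right_mono) auto
        finally show ?thesis by (simp add: power2_eq_square algebra_simps)
      qed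
      have D_bound: "(norm D)\<^sup>2 \<le> K * P t"
      proof -
        have "(norm (Z (Suc l) t - X (Suc l) t))\<^sup>2 \<le> 2 * (1 + bs\<^sup>2) * C\<^sub>2 * P t" if "l < m" for l
        proof -
          let ?w = "deconv \<beta> (e t)"
          have w: "(norm (?w j))\<^sup>2 \<le> C\<^sub>2 * P t" if "j \<le> m" for j
            using U2_bound[of j ?w] that by (simp add: P_def)
          have "1 * norm (Z (Suc l) t - X (Suc l) t) \<le> \<Gamma> ^ (m - Suc l) * norm (Z (Suc l) t - X (Suc l) t)"
            using \<Gamma> by (intro mult_right_mono one_le_power) auto
          also have "\<dots> = norm (e t (Suc l))" using \<Gamma> by (simp add: e_def)
          finally have "(norm (Z (Suc l) t - X (Suc l) t))\<^sup>2 \<le> (norm (e t (Suc l)))\<^sup>2"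
            by (intro power_mono) auto
          also have "e t (Suc l) = ?w (Suc l) + (\<Sum>j=1..Suc l. \<beta> j *\<^sub>R ?w (Suc l - j))"
            by (subst deconv.simps) (simp only: diff_add_cancel)
          also have "(norm \<dots>)\<^sup>2 \<le> 2 * (norm (?w (Suc l)))\<^sup>2
              + 2 * (norm (\<Sum>j=1..Suc l. \<beta> j *\<^sub>R ?w (Suc l - j)))\<^sup>2"
            by (rule norm_add_power2_le)
          also have "(norm (\<Sum>j=1..Suc l. \<beta> j *\<^sub>R ?w (Suc l - j)))\<^sup>2
              \<le> (\<Sum>j=1..Suc l. \<bar>\<beta> j\<bar>)\<^sup>2 * (C\<^sub>2 * P t)"
            by (rule norm_sum_scaleR_power2_le) (use w that U2(2) nn in auto)
          also have "\<dots> \<le> bs\<^sup>2 * (C\<^sub>2 * P t)"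
            unfolding bs_def using that U2(2) nn[of t]
            by (intro mult_right_mono power_mono sum_mono2) (auto intro!: sum_nonneg)
          finally show ?thesis using w[of "Suc l"] that by (simp add: algebra_simps)
        qed
        then have "(norm D)\<^sup>2 \<le> ks\<^sup>2 * (2 * (1 + bs\<^sup>2) * C\<^sub>2 * P t)"
          unfolding D_def ks_def using U2(2) nn[of t] by (intro norm_sum_scaleR_power2_le) auto
        also have "\<dots> = ks\<^sup>2 * (2 * (1 + bs\<^sup>2) * C\<^sub>2) * P t" by (simp only: mult.assoc)
        also have "\<dots> \<le> K * P t" using K(8) nn(4) by (rule mult_right_mono)
        finally show ?thesis .
      qed
      have F_bound: "(norm (F (X 0 t)))\<^sup>2 \<le> \<theta>\<^sup>2 * (norm (X 0 t))\<^sup>2"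
      proof -
        have "norm (F (X 0 t)) \<le> \<theta> * norm (X 0 t)"
          using lipschitz_onD[OF lip, of "X 0 t" 0] \<open>F 0 = 0\<close> by (simp add: dist_norm)
        then show ?thesis by (metis norm_ge_zero power_mono power_mult_distrib)
      qed
      have F_bound': "(norm (F (X 0 t)))\<^sup>2 \<le> 2 * K\<^sup>2 * (A t + E t)"
      proof -
        have "\<theta>\<^sup>2 * (norm (X 0 t))\<^sup>2 \<le> K * (2 * K * (A t + E t))"
          using K X0_bound[of t] by (intro mult_mono) auto
        with F_bound show ?thesis by (simp add: power2_eq_square mult_ac)
      qed
      have kx_bound: "(norm k\<^sub>x)\<^sup>2 \<le> K * E t"
      proof -
        have "(norm k\<^sub>x)\<^sup>2 \<le> ks\<^sup>2 * (C\<^sub>1 * E t)"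
          unfolding k\<^sub>x_def ks_def E_def
          by (rule norm_sum_scaleR_power2_le) (use U1_bound[of _ "\<lambda>l. X (Suc l) t"] U1 in auto)
        then show ?thesis using mult_right_mono[OF K(6) nn(3)[of t]] by (simp add: mult.assoc)
      qed
      have G_bound': "(norm (G t - F (X 0 t)))\<^sup>2 \<le> K * Q t"
        using G_bound mult_right_mono[OF K(4) \<open>0 \<le> Q t\<close>] by simp
      note T = forcing_bounds[OF K(1) \<kappa> \<sigma> nn(1,3,4) \<open>0 \<le> Q t\<close> \<Phi>_bound D_bound G_bound' F_bound'
          X_all[OF order_refl] kx_bound s_def f_def, folded B_def]
      have V: "(norm (X' 0))\<^sup>2 \<le> 194 * K\<^sup>2 * (A t + B t + E t + P t + Q t)"
      proof (cases "m = 0")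
        case False
        have "K * E t \<le> (194 * K\<^sup>2) * (A t + B t + E t + P t + Q t)"
          using K(1) nn[of t] \<open>0 \<le> Q t\<close>
          by (intro mult_mono) (auto simp: power2_eq_square intro: order_trans[of K "K * K"])
        then show ?thesis using X_bound[of 0 t] False by (simp add: X'_def)
      qed (use T(3) in \<open>simp add: X'_def\<close>)

      define R where "R = P t + \<kappa>\<^sup>2 * Q t + \<kappa> ^ 4 * (A t + B t + E t) + \<sigma>\<^sup>2 * (A t + E t)"
      have "R \<ge> 0" using nn[of t] \<open>0 \<le> Q t\<close> by (simp add: R_def)
      have estA: "2 * (v t \<bullet> ((1 / k\<^sub>0) *\<^sub>R f)) \<le> - (c * \<kappa> * A t) + C * \<kappa> * E t + C / \<kappa> * R"
      proof -
        let ?F = "F (X 0 t)"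
        have mono_X: "X 0 t \<bullet> ?F \<ge> \<omega> * (norm (X 0 t))\<^sup>2"
          using mono[unfolded strongly_monotone_def, rule_format, where x = "X 0 t" and y = 0] \<open>F 0 = 0\<close> by simp
        have "2 * (v t \<bullet> f) = 2 * (v t \<bullet> ((f + \<kappa> *\<^sub>R ?F) - \<kappa> *\<^sub>R ?F))" by simp
        also have "\<dots> \<le> - (\<kappa> * (\<omega> / 4) * (norm (v t))\<^sup>2)
            + \<kappa> * (\<omega> + \<theta>\<^sup>2 / \<omega>) * (norm (p t))\<^sup>2 + 4 / (\<kappa> * \<omega>) * (norm (f + \<kappa> *\<^sub>R ?F))\<^sup>2"
          by (rule slow_mode_estimate[OF \<open>\<omega> > 0\<close> \<kappa>(1) v_def mono_X F_bound])
        also have "\<dots> \<le> - (\<kappa> * (\<omega> / 4) * A t) + \<kappa> * (\<omega> + \<theta>\<^sup>2 / \<omega>) * (K * E t)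
            + 4 / (\<kappa> * \<omega>) * (16 * K\<^sup>2 * R)"
          unfolding A_def using \<kappa> \<open>\<omega> > 0\<close> p_bound T(1)[folded R_def]
          by (intro add_mono mult_left_mono) auto
        finally have "1 / k\<^sub>0 * (2 * (v t \<bullet> f)) \<le> 1 / k\<^sub>0 * \<dots>"
          using \<open>k\<^sub>0 > 0\<close> by (intro mult_left_mono) auto
        also have "\<dots> = - (\<omega> / (4 * k\<^sub>0) * (\<kappa> * A t)) + (\<omega> + \<theta>\<^sup>2 / \<omega>) * K / k\<^sub>0 * (\<kappa> * E t)
            + 64 * K\<^sup>2 / (\<omega> * k\<^sub>0) * (R / \<kappa>)"
          using \<open>k\<^sub>0 > 0\<close> \<open>\<omega> > 0\<close> \<kappa> by (simp add: field_simps)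
        also have "\<dots> \<le> - (c * (\<kappa> * A t)) + C * (\<kappa> * E t) + C * (R / \<kappa>)"
          using c C \<kappa> nn[of t] \<open>R \<ge> 0\<close>
          by (intro add_mono le_imp_neg_le mult_right_mono) auto
        finally show ?thesis by simp
      qed
      have "4 * K \<le> C"
      proof -
        have "K * 1 \<le> K * K" using K(1) by (intro mult_left_mono) auto
        with C(4) show ?thesis by (simp add: power2_eq_square)
      qed
      have estB: "2 * (s t \<bullet> (\<Phi> t - \<kappa>\<^sup>2 *\<^sub>R (s t - X m t)))
          \<le> - (c * \<kappa>\<^sup>2 * B t) + C * \<kappa>\<^sup>2 * (A t + E t) + C / \<kappa>\<^sup>2 * (\<sigma>\<^sup>2 * (A t + E t))"
      proof -
        have "2 * (s t \<bullet> (\<Phi> t - \<kappa>\<^sup>2 *\<^sub>R (s t - X m t)))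
            \<le> - (\<kappa>\<^sup>2 * (norm (s t))\<^sup>2) + 2 * \<kappa>\<^sup>2 * (norm (X m t))\<^sup>2 + 2 / \<kappa>\<^sup>2 * (norm (\<Phi> t))\<^sup>2"
          by (rule integral_mode_estimate) (use \<kappa> in simp)
        also have "\<dots> \<le> - (\<kappa>\<^sup>2 * B t) + 2 * \<kappa>\<^sup>2 * (2 * K * (A t + E t))
            + 2 / \<kappa>\<^sup>2 * (2 * K\<^sup>2 * \<sigma>\<^sup>2 * (A t + E t))"
          unfolding B_def using X_all[of m] \<Phi>_bound by (intro add_mono mult_left_mono) auto
        also have "\<dots> = - (1 * (\<kappa>\<^sup>2 * B t)) + 4 * K * (\<kappa>\<^sup>2 * (A t + E t))
            + 4 * K\<^sup>2 * (\<sigma>\<^sup>2 * (A t + E t) / \<kappa>\<^sup>2)"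
          by simp
        also have "\<dots> \<le> - (c * (\<kappa>\<^sup>2 * B t)) + C * (\<kappa>\<^sup>2 * (A t + E t)) + C * (\<sigma>\<^sup>2 * (A t + E t) / \<kappa>\<^sup>2)"
          using c(3) C(4) \<open>4 * K \<le> C\<close> nn[of t]
          by (intro add_mono le_imp_neg_le mult_right_mono) auto
        finally show ?thesis by (simp add: mult.assoc)
      qed
      have estE: "d\<^sub>E \<le> - (c * E t)
          + C * (P t + \<kappa>\<^sup>2 * (A t + E t + Q t) + \<kappa> ^ 4 * (A t + B t + E t) + \<sigma>\<^sup>2 * (A t + E t))"
        (is "_ \<le> _ + C * ?S")
      proof -
        have "0 \<le> ?S" using nn[of t] \<open>0 \<le> Q t\<close> by simp
        have "C\<^sub>1 * (norm f)\<^sup>2 \<le> C\<^sub>1 * (32 * K\<^sup>2 * ?S)"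
          using T(2) U1(2) by (intro mult_left_mono) auto
        also have "\<dots> = 32 * K\<^sup>2 * C\<^sub>1 * ?S" by (simp only: mult_ac)
        also have "\<dots> \<le> C * ?S" using C(5) \<open>0 \<le> ?S\<close> by (rule mult_right_mono)
        finally show ?thesis using d\<^sub>E mult_right_mono[OF c(4) nn(3)[of t]] by linarith
      qed
      have T_nonneg: "0 \<le> A t + B t + E t + P t + Q t" using nn[of t] \<open>0 \<le> Q t\<close> by simp
      have forced: "L / \<Gamma> * (norm x)\<^sup>2 \<le> C / \<Gamma> * (A t + B t + E t + P t + Q t)"
        if "(norm x)\<^sup>2 \<le> 194 * K\<^sup>2 * (A t + B t + E t + P t + Q t)" "194 * K\<^sup>2 * L \<le> C" "L \<ge> 0"
        for L and x :: 'a
      proof -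
        have "L / \<Gamma> * (norm x)\<^sup>2 \<le> L / \<Gamma> * (194 * K\<^sup>2 * (A t + B t + E t + P t + Q t))"
          using that \<Gamma> by (intro mult_left_mono) auto
        also have "\<dots> = 194 * K\<^sup>2 * L / \<Gamma> * (A t + B t + E t + P t + Q t)" by simp
        also have "\<dots> \<le> C / \<Gamma> * (A t + B t + E t + P t + Q t)"
          using that \<Gamma> T_nonneg by (intro mult_right_mono divide_right_mono) auto
        finally show ?thesis .
      qed
      have estP: "d\<^sub>P \<le> - (c * \<Gamma> * P t) + C / \<Gamma> * (A t + B t + E t + P t + Q t)"
      proof -
        have "c * (\<Gamma> * P t) \<le> \<gamma>\<^sub>2 * (\<Gamma> * P t)"
          using c(5) \<Gamma> nn[of t] by (intro mult_right_mono) auto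
        then show ?thesis using d\<^sub>P forced[OF T(3) C(6)] U2(2) by (simp add: mult_ac)
      qed
      have estQ: "d\<^sub>Q \<le> - (c * \<Gamma> * Q t) + C / \<Gamma> * (A t + B t + E t + P t + Q t)"
      proof -
        have "c * (\<Gamma> * Q t) \<le> c\<^sub>0 * (\<Gamma> * Q t)"
          using c(6) \<Gamma> \<open>0 \<le> Q t\<close> by (intro mult_right_mono) auto
        then show ?thesis using d\<^sub>Q forced[OF V C(7)] \<open>C\<^sub>0 > 0\<close> by (simp add: mult_ac)
      qed
      have "(W has_real_derivative 2 * (v t \<bullet> ((1 / k\<^sub>0) *\<^sub>R f))
          + 2 * (s t \<bullet> (\<Phi> t - \<kappa>\<^sup>2 *\<^sub>R (s t - X m t))) + d\<^sub>E + d\<^sub>P + d\<^sub>Q) (at t within {0..})"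
        unfolding W_def[abs_def] by (intro DERIV_add dA dB dE dP dQ)
      moreover have "2 * (v t \<bullet> ((1 / k\<^sub>0) *\<^sub>R f)) + 2 * (s t \<bullet> (\<Phi> t - \<kappa>\<^sup>2 *\<^sub>R (s t - X m t)))
          + d\<^sub>E + d\<^sub>P + d\<^sub>Q \<le> - (r * W t)"
        using gain[OF nn(1,2,3,4)[of t] \<open>0 \<le> Q t\<close>] estA estB estE estP estQ
        unfolding W_def R_def by linarith
      ultimately show ?thesis by blast
    qed
    define M where "M = sqrt (2 * K * W 0)"
    have "norm (X 0 t) \<le> M * exp (- (r / 2 * t))" if "t \<ge> 0" for t
    proof -
      have "Q t \<ge> 0" "Q 0 \<ge> 0" using loop \<open>t \<ge> 0\<close> by (auto simp: scaled_loop_def)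
      then have "W 0 \<ge> 0" using nn[of 0] by (simp add: W_def)
      have "(norm (X 0 t))\<^sup>2 \<le> 2 * K * W t"
        using X0_bound[of t] \<open>Q t \<ge> 0\<close> nn[of t] K(1)
        by (intro order_trans[OF X0_bound] mult_left_mono) (auto simp: W_def)
      also have "\<dots> \<le> 2 * K * (W 0 * exp (- (r * t)))"
        using has_real_derivative_exp_decay[of W r t] W_deriv \<open>t \<ge> 0\<close> K(1)
        by (intro mult_left_mono) auto
      also have "\<dots> = (M * exp (- (r / 2 * t)))\<^sup>2"
        using \<open>W 0 \<ge> 0\<close> K(1) by (simp add: M_def power_mult_distrib flip: exp_double)
      finally show ?thesis
        by (rule power2_le_imp_le) (use \<open>W 0 \<ge> 0\<close> K(1) in \<open>simp add: M_def\<close>)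
    qed
    moreover have "M * exp (- (r / 2 * t)) \<le> (\<bar>M\<bar> + 1) * exp (- (r / 2 * t))" for t
      by (intro mult_right_mono) auto
    ultimately have "norm (X 0 t) \<le> (\<bar>M\<bar> + 1) * exp (- (r / 2 * t))" if "t \<ge> 0" for t
      using that by (meson order_trans)
    moreover have "\<bar>M\<bar> + 1 > 0" by simp
    ultimately show ?thesis by blast
  qed
  moreover have "0 < \<Gamma>" "0 < r / 2" using \<Gamma> \<open>0 < r\<close> by auto
  ultimately show ?thesis using \<kappa> \<sigma> by blast
qed

section \<open>From the players to the stacked system\<close>

lemma norm_vec_power2: "(norm x)\<^sup>2 = (\<Sum>i\<in>UNIV. (norm (x $ i))\<^sup>2)"
  by (simp add: norm_vec_def L2_set_def sum_nonneg)

lemma has_vector_derivative_vec: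
  fixes f :: "real \<Rightarrow> real ^ 'm ^ 'p::finite"
  assumes "\<And>i. ((\<lambda>s. f s $ i) has_vector_derivative D $ i) (at t within S)"
  shows "(f has_vector_derivative D) (at t within S)"
proof -
  have eq: "v = (\<Sum>i\<in>UNIV. axis i (v $ i))" for v :: "real ^ 'm ^ 'p"
    by (simp add: vec_eq_iff axis_def)
  have "((\<lambda>s. \<Sum>i\<in>UNIV. axis i (f s $ i)) has_vector_derivative (\<Sum>i\<in>UNIV. axis i (D $ i))) (at t within S)"
    by (intro has_vector_derivative_sum
        bounded_linear.has_vector_derivative[OF bounded_linear_axis] assms)
  then show ?thesis unfolding eq[symmetric] .
qed

lemma has_vector_derivative_time_scale:
  fixes f :: "real \<Rightarrow> 'a::real_normed_vector"
  assumes "(f has_vector_derivative D) (at (t / \<epsilon>) within {0..})" and "\<epsilon> > 0"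
  shows "((\<lambda>s. f (s / \<epsilon>)) has_vector_derivative (1 / \<epsilon>) *\<^sub>R D) (at t within {0..})"
proof -
  have "((\<lambda>s. s / \<epsilon>) has_vector_derivative 1 / \<epsilon>) (at t within {0..})"
    by (auto intro!: derivative_eq_intros)
  moreover have "(f has_vector_derivative D) (at (t / \<epsilon>) within (\<lambda>s. s / \<epsilon>) ` {0..})"
    using \<open>\<epsilon> > 0\<close> by (intro has_vector_derivative_within_subset[OF assms(1)]) auto
  ultimately show ?thesis
    by (rule vector_diff_chain_within[unfolded o_def])
qed

lemma estimated_gradient_error:
  fixes J :: "'p::finite \<Rightarrow> real ^ 'm ^ 'p \<Rightarrow> real"
  assumes lip: "\<theta>-lipschitz_on UNIV (pseudo_gradient J)"
    and \<xi>: "\<And>i. \<xi> i \<ge> 0" "\<And>i j. i \<noteq> j \<Longrightarrow> \<xi> i \<ge> (1::real)"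
  shows "(norm ((\<chi> i. estimated_gradient J i x xh) - pseudo_gradient J x))\<^sup>2
    \<le> \<theta>\<^sup>2 * (\<Sum>j\<in>UNIV. \<Sum>i\<in>UNIV. \<xi> i * (norm (xh $ i $ j - x $ j))\<^sup>2)"
proof -
  have "(norm (estimated_gradient J i x xh - own_gradient J i x))\<^sup>2
      \<le> \<theta>\<^sup>2 * (\<Sum>j\<in>UNIV. \<xi> i * (norm (xh $ i $ j - x $ j))\<^sup>2)" for i
  proof -
    let ?x = "with_own (xh $ i) i (x $ i)"
    have "estimated_gradient J i x xh - own_gradient J i x
        = (pseudo_gradient J ?x - pseudo_gradient J x) $ i"
      by (simp add: estimated_gradient_def pseudo_gradient_def)
    also have "norm \<dots> \<le> norm (pseudo_gradient J ?x - pseudo_gradient J x)"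
      by (rule Finite_Cartesian_Product.norm_nth_le)
    also have "\<dots> \<le> \<theta> * norm (?x - x)"
      using lipschitz_onD[OF lip, of ?x x] by (simp add: dist_norm)
    finally have "(norm (estimated_gradient J i x xh - own_gradient J i x))\<^sup>2 \<le> (\<theta> * norm (?x - x))\<^sup>2"
      by (intro power_mono) auto
    also have "\<dots> = \<theta>\<^sup>2 * (\<Sum>j\<in>UNIV. (norm ((?x - x) $ j))\<^sup>2)"
      by (simp only: power_mult_distrib norm_vec_power2)
    also have "\<dots> \<le> \<theta>\<^sup>2 * (\<Sum>j\<in>UNIV. \<xi> i * (norm (xh $ i $ j - x $ j))\<^sup>2)"
    proof (intro mult_left_mono sum_mono)
      fix j
      show "(norm ((?x - x) $ j))\<^sup>2 \<le> \<xi> i * (norm (xh $ i $ j - x $ j))\<^sup>2"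
        using \<xi>(1)[of i] mult_right_mono[OF \<xi>(2)[of i j], of "(norm (xh $ i $ j - x $ j))\<^sup>2"] by auto
    qed auto
    finally show ?thesis .
  qed
  then have "(norm ((\<chi> i. estimated_gradient J i x xh) - pseudo_gradient J x))\<^sup>2
      \<le> (\<Sum>i\<in>UNIV. \<theta>\<^sup>2 * (\<Sum>j\<in>UNIV. \<xi> i * (norm (xh $ i $ j - x $ j))\<^sup>2))"
    by (subst norm_vec_power2) (auto simp: pseudo_gradient_def intro!: sum_mono)
  also have "\<dots> = \<theta>\<^sup>2 * (\<Sum>j\<in>UNIV. \<Sum>i\<in>UNIV. \<xi> i * (norm (xh $ i $ j - x $ j))\<^sup>2)"
    by (subst sum.swap) (simp add: sum_distrib_left)
  finally show ?thesis .
qed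

lemma consensus_energy_deriv:
  fixes e :: "'p::finite \<Rightarrow> 'p \<Rightarrow> real \<Rightarrow> 'a::euclidean_space"
  assumes "c > 0" and "g > 0" and \<xi>: "\<And>i. \<xi> i \<ge> 0"
    and coercive: "\<And>j (e :: 'p \<Rightarrow> 'a).
      (\<Sum>i\<in>UNIV. \<xi> i * (e i \<bullet> ((\<Sum>q\<in>UNIV. a i q *\<^sub>R (e i - e q)) + a i j *\<^sub>R e i)))
      \<ge> c * (\<Sum>i\<in>UNIV. \<xi> i * (norm (e i))\<^sup>2)"
    and der: "\<And>i j. (e i j has_vector_derivative
      - (g *\<^sub>R ((\<Sum>q\<in>UNIV. a i q *\<^sub>R (e i j t - e q j t)) + a i j *\<^sub>R e i j t)) - v j) (at t within S)"
  defines "Q \<equiv> \<lambda>t. \<Sum>j\<in>UNIV. \<Sum>i\<in>UNIV. \<xi> i * (norm (e i j t))\<^sup>2"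
  shows "\<exists>D. (Q has_real_derivative D) (at t within S) \<and>
    D \<le> - (c * g * Q t) + (\<Sum>i\<in>UNIV. \<xi> i) / c / g * (\<Sum>j\<in>UNIV. (norm (v j))\<^sup>2)"
proof -
  define h where "h i j = (\<Sum>q\<in>UNIV. a i q *\<^sub>R (e i j t - e q j t)) + a i j *\<^sub>R e i j t" for i j
  define D where "D = (\<Sum>j\<in>UNIV. \<Sum>i\<in>UNIV. \<xi> i * (2 * (e i j t \<bullet> (- (g *\<^sub>R h i j) - v j))))"
  have "(Q has_real_derivative D) (at t within S)"
    unfolding Q_def D_def h_def
    by (intro DERIV_sum DERIV_cmult has_real_derivative_norm_power2 der)
  moreover have "D \<le> - (c * g * Q t) + (\<Sum>i\<in>UNIV. \<xi> i) / c / g * (\<Sum>j\<in>UNIV. (norm (v j))\<^sup>2)"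
  proof -
    have "(\<Sum>i\<in>UNIV. \<xi> i * (2 * (e i j t \<bullet> (- (g *\<^sub>R h i j) - v j))))
        \<le> - (c * g * (\<Sum>i\<in>UNIV. \<xi> i * (norm (e i j t))\<^sup>2))
          + (\<Sum>i\<in>UNIV. \<xi> i) / c / g * (norm (v j))\<^sup>2" for j
    proof -
      let ?N = "\<Sum>i\<in>UNIV. \<xi> i * (norm (e i j t))\<^sup>2"
      have "(\<Sum>i\<in>UNIV. \<xi> i * (2 * (e i j t \<bullet> (- (g *\<^sub>R h i j) - v j))))
          = - (2 * g * (\<Sum>i\<in>UNIV. \<xi> i * (e i j t \<bullet> h i j)))
            + (\<Sum>i\<in>UNIV. \<xi> i * (2 * (e i j t \<bullet> - v j)))"
        by (simp add: inner_diff_right sum_distrib_left sum_subtractf sum_negf algebra_simps)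
      also have "\<dots> \<le> - (2 * g * (c * ?N))
            + (\<Sum>i\<in>UNIV. \<xi> i * (c * g * (norm (e i j t))\<^sup>2 + (norm (- v j))\<^sup>2 / (c * g)))"
        using \<open>g > 0\<close> \<open>c > 0\<close> coercive[of "\<lambda>i. e i j t" j] unfolding h_def
        by (intro add_mono le_imp_neg_le mult_left_mono sum_mono inner_le_Young \<xi>) auto
      also have "\<dots> = - (c * g * ?N) + (\<Sum>i\<in>UNIV. \<xi> i) / c / g * (norm (v j))\<^sup>2"
        by (simp add: distrib_left sum.distrib sum_distrib_left sum_distrib_right sum_divide_distrib mult_ac)
      finally show ?thesis .
    qed
    then have "D \<le> (\<Sum>j\<in>UNIV. - (c * g * (\<Sum>i\<in>UNIV. \<xi> i * (norm (e i j t))\<^sup>2))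
          + (\<Sum>i\<in>UNIV. \<xi> i) / c / g * (norm (v j))\<^sup>2)"
      unfolding D_def by (rule sum_mono)
    also have "\<dots> = - (c * g * Q t) + (\<Sum>i\<in>UNIV. \<xi> i) / c / g * (\<Sum>j\<in>UNIV. (norm (v j))\<^sup>2)"
      by (simp only: Q_def sum.distrib sum_negf sum_distrib_left)
    finally show ?thesis .
  qed
  ultimately show ?thesis by blast
qed

lemma stacked_lipschitz:
  fixes f :: "'p::finite \<Rightarrow> (nat \<Rightarrow> real ^ 'm) \<Rightarrow> real list \<Rightarrow> real ^ 'm"
  assumes lip: "\<And>i \<xi> \<eta>. norm (f i \<xi> (w i) - f i \<eta> (w i))
      \<le> L 0 * norm (\<xi> 0 - \<eta> 0) + (\<Sum>l<m. L (Suc l) * norm (\<xi> (Suc l) - \<eta> (Suc l)))"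
    and L: "\<And>l. l \<le> m \<Longrightarrow> L l \<ge> 0"
  shows "norm ((\<chi> i. f i (\<lambda>l. x l $ i) (w i)) - (\<chi> i. f i (\<lambda>l. y l $ i) (w i)))
    \<le> real CARD('p) * (\<Sum>l\<le>m. L l) * (\<Sum>l\<le>m. norm (x l - y l))"
proof -
  have "norm (f i (\<lambda>l. x l $ i) (w i) - f i (\<lambda>l. y l $ i) (w i))
      \<le> (\<Sum>l\<le>m. L l) * (\<Sum>l\<le>m. norm (x l - y l))" for i
  proof -
    have "norm (f i (\<lambda>l. x l $ i) (w i) - f i (\<lambda>l. y l $ i) (w i))
        \<le> (\<Sum>l<Suc m. L l * norm ((x l - y l) $ i))"
      using lip[of i "\<lambda>l. x l $ i" "\<lambda>l. y l $ i"] by (simp only: sum.lessThan_Suc_shift vector_minus_component)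
    also have "\<dots> = (\<Sum>l\<le>m. L l * norm ((x l - y l) $ i))" by (simp only: lessThan_Suc_atMost)
    also have "\<dots> \<le> (\<Sum>l\<le>m. L l * (\<Sum>l\<le>m. norm (x l - y l)))"
    proof (intro sum_mono mult_left_mono L)
      fix l assume "l \<in> {..m}"
      then have "norm (x l - y l) \<le> (\<Sum>l\<le>m. norm (x l - y l))"
        by (intro member_le_sum) auto
      then show "norm ((x l - y l) $ i) \<le> (\<Sum>l\<le>m. norm (x l - y l))"
        by (rule order_trans[OF Finite_Cartesian_Product.norm_nth_le])
    qed auto
    finally show ?thesis by (simp only: sum_distrib_right)
  qed
  then have sum_le: "(\<Sum>i\<in>UNIV. norm (((\<chi> i. f i (\<lambda>l. x l $ i) (w i)) - (\<chi> i. f i (\<lambda>l. y l $ i) (w i))) $ i))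
      \<le> (\<Sum>i\<in>(UNIV :: 'p set). (\<Sum>l\<le>m. L l) * (\<Sum>l\<le>m. norm (x l - y l)))"
    by (intro sum_mono) simp
  have "norm v \<le> (\<Sum>i\<in>UNIV. norm (v $ i))" for v :: "real ^ 'm ^ 'p"
    unfolding norm_vec_def by (rule L2_set_le_sum) simp
  from order_trans[OF this sum_le] show ?thesis by (simp add: mult.assoc)
qed

theorem theorem4:
  fixes n :: nat
    and a :: "'p::finite \<Rightarrow> 'p \<Rightarrow> real"
    and J :: "'p \<Rightarrow> real ^ 'm ^ 'p \<Rightarrow> real"
    and f :: "'p \<Rightarrow> (nat \<Rightarrow> real ^ 'm) \<Rightarrow> real list \<Rightarrow> real ^ 'm"
    and w :: "'p \<Rightarrow> real list"
    and lx :: real and lxd :: "nat \<Rightarrow> real"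
    and \<omega> \<theta> :: real
    and k \<beta> :: "nat \<Rightarrow> real"
  assumes "n \<ge> 1"
    and "\<And>i j. a i j \<ge> 0" and "\<And>i. a i i = 0"
    and "strongly_connected (comm_digraph a)"
    and "lx \<ge> 0" and "\<And>l. l \<in> {1..<n} \<Longrightarrow> lxd l \<ge> 0"
    and "\<And>i \<xi> \<eta>. norm (f i \<xi> (w i) - f i \<eta> (w i))
            \<le> lx * norm (\<xi> 0 - \<eta> 0) + (\<Sum>l = 1..<n. lxd l * norm (\<xi> l - \<eta> l))"
    and "\<And>i. continuously_differentiable (J i)"
    and "\<And>i x. convex_on UNIV (\<lambda>v. J i (with_own x i v))"
    and "\<omega> > 0" and "strongly_monotone \<omega> (pseudo_gradient J)"
    and "\<theta> > 0" and "\<theta>-lipschitz_on UNIV (pseudo_gradient J)"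
    and "\<And>s::complex. s ^ (n - 1) + (\<Sum>l = 1..<n. of_real (k l) * s ^ (l - 1)) = 0 \<Longrightarrow> Re s < 0"
    and "\<And>s::complex. s ^ n + (\<Sum>l = 1..n. of_real (\<beta> l) * s ^ (n - l)) = 0 \<Longrightarrow> Re s < 0"
  shows "\<exists>xs. nash_equilibrium J xs \<and> (\<forall>x. nash_equilibrium J x \<longrightarrow> x = xs) \<and>
    (\<exists>\<alpha>\<^sub>1>0. \<exists>\<alpha>\<^sub>2>0. \<exists>\<alpha>\<^sub>3>0. \<exists>\<epsilon>>0. \<exists>\<mu>>0. \<exists>\<Lambda>>0. \<forall>x z y xh.
      closed_loop_solution n a J f w k \<beta> \<alpha>\<^sub>1 \<alpha>\<^sub>2 \<alpha>\<^sub>3 \<epsilon> \<mu> x z y xh \<longrightarrow>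
      (\<exists>C>0. \<forall>t\<ge>0. norm (x 0 t - xs) \<le> C * exp (- \<Lambda> * t)))"
proof -
  obtain m where n: "n = Suc m" using \<open>n \<ge> 1\<close> by (cases n) auto
  note lip = \<open>\<theta>-lipschitz_on UNIV (pseudo_gradient J)\<close>
  obtain xs where xs: "pseudo_gradient J xs = 0" and unique: "\<And>x. pseudo_gradient J x = 0 \<Longrightarrow> x = xs"
    using strongly_monotone_ex1_zero[OF assms(10,11,12,13)] by blast
  have nash: "nash_equilibrium J x \<longleftrightarrow> pseudo_gradient J x = 0" for x
    by (intro nash_equilibrium_iff assms)
  define F where "F X = pseudo_gradient J (xs + X)" for X
  have F: "strongly_monotone \<omega> F" "\<theta>-lipschitz_on UNIV F" "F 0 = 0"
  proof -
    show "strongly_monotone \<omega> F"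
      unfolding strongly_monotone_def F_def
    proof (intro allI)
      fix X Y
      show "\<omega> * (norm (X - Y))\<^sup>2
          \<le> (X - Y) \<bullet> (pseudo_gradient J (xs + X) - pseudo_gradient J (xs + Y))"
        using assms(11)[unfolded strongly_monotone_def, rule_format, where x = "xs + X" and y = "xs + Y"] by simp
    qed
    show "\<theta>-lipschitz_on UNIV F"
    proof (rule lipschitz_onI)
      show "dist (F X) (F Y) \<le> \<theta> * dist X Y" for X Y
        using lipschitz_onD[OF lip, of "xs + X" "xs + Y"] by (simp add: F_def)
    qed (use \<open>\<theta> > 0\<close> in simp)
    show "F 0 = 0" by (simp add: F_def xs)
  qed
  obtain \<xi> c where "c > 0" and \<xi>: "\<And>i. \<xi> i \<ge> 0" "\<And>i j. i \<noteq> j \<Longrightarrow> \<xi> i \<ge> 1"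
    and coercive: "\<And>j (e :: 'p \<Rightarrow> real ^ 'm).
      (\<Sum>i\<in>UNIV. \<xi> i * (e i \<bullet> ((\<Sum>q\<in>UNIV. a i q *\<^sub>R (e i - e q)) + a i j *\<^sub>R e i)))
      \<ge> c * (\<Sum>i\<in>UNIV. \<xi> i * (norm (e i))\<^sup>2)"
    using pinned_laplacian_coercive[where ?'a = "real ^ 'm", OF assms(2,4)] by blast
  define C\<^sub>0 where "C\<^sub>0 = \<theta>\<^sup>2 + (\<Sum>i\<in>UNIV. \<xi> i) / c"
  have "(\<Sum>i\<in>UNIV. \<xi> i) / c \<ge> 0" using \<xi>(1) \<open>c > 0\<close> by (simp add: sum_nonneg)
  then have C0: "C\<^sub>0 > 0" "\<theta>\<^sup>2 \<le> C\<^sub>0" "(\<Sum>i\<in>UNIV. \<xi> i) / c \<le> C\<^sub>0"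
    using \<open>\<theta> > 0\<close> by (auto simp: C\<^sub>0_def add_pos_nonneg)
  have hk: "Re s < 0" if "s ^ m + (\<Sum>l<m. of_real (k (Suc l)) * s ^ l) = 0" for s :: complex
  proof (rule assms(14))
    have "(\<Sum>l = 1..<n. of_real (k l) * s ^ (l - 1)) = (\<Sum>l<m. of_real (k (Suc l)) * s ^ l)"
      unfolding n One_nat_def sum.shift_bounds_Suc_ivl by (simp add: atLeast0LessThan)
    with that show "s ^ (n - 1) + (\<Sum>l = 1..<n. of_real (k l) * s ^ (l - 1)) = 0" by (simp add: n)
  qed
  have h\<beta>: "Re s < 0" if "s ^ Suc m + (\<Sum>l<Suc m. of_real (\<beta> (Suc m - l)) * s ^ l) = 0" for s :: complex
  proof (rule assms(15))
    have "(\<Sum>l = 1..n. of_real (\<beta> l) * s ^ (n - l)) = (\<Sum>l<Suc m. of_real (\<beta> (Suc m - l)) * s ^ l)"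
      unfolding n by (rule sum.reindex_bij_witness[of _ "\<lambda>l. Suc m - l" "\<lambda>l. Suc m - l"]) auto
    with that show "s ^ n + (\<Sum>l = 1..n. of_real (\<beta> l) * s ^ (n - l)) = 0" by (simp add: n)
  qed
  obtain \<kappa> \<Gamma> \<sigma> r where pos: "\<kappa> > 0" "\<Gamma> > 0" "\<sigma> > 0" "r > 0"
    and decay: "\<And>X Z Y G \<Phi> Q. scaled_loop m k \<beta> F c C\<^sub>0 \<kappa> \<Gamma> \<sigma> X Z Y G \<Phi> Q \<Longrightarrow>
      \<exists>C>0. \<forall>t\<ge>0. norm (X 0 t) \<le> C * exp (- (r * t))"
    using scaled_loop_decay[OF hk h\<beta> \<open>\<omega> > 0\<close> F \<open>c > 0\<close> C0(1)] by blast

  define L where "L l = (if l = 0 then lx else lxd l)" for l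
  have L: "L l \<ge> 0" if "l \<le> m" for l
    using assms(5,6) that by (auto simp: L_def n)
  define N where "N = real CARD('p) * (\<Sum>l\<le>m. L l)"
  have "N \<ge> 0" unfolding N_def by (intro mult_nonneg_nonneg sum_nonneg L) auto
  define \<epsilon> where "\<epsilon> = 1 + N / \<sigma>"
  have \<epsilon>: "\<epsilon> \<ge> 1" "\<epsilon> > 0" "N / \<epsilon> \<le> \<sigma>"
    using \<open>N \<ge> 0\<close> pos by (auto simp: \<epsilon>_def field_simps add_pos_nonneg)
  have "\<exists>C>0. \<forall>t\<ge>0. norm (x 0 t - xs) \<le> C * exp (- (r * \<epsilon>) * t)"
    if sol: "closed_loop_solution n a J f w k \<beta> (\<kappa> * \<epsilon> ^ n) (\<kappa>\<^sup>2 * \<epsilon> ^ n) (\<Gamma> * \<epsilon>) \<epsilon> (1 / \<Gamma>) x z y xh" for x z y xh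
  proof -
    define fs where "fs t = (\<chi> i. f i (\<lambda>l. x l t $ i) (w i))" for t
    define fe where "fe = (\<chi> i. f i (\<lambda>l. (if l = 0 then xs else 0) $ i) (w i))"
    define g where "g t = (\<chi> i. estimated_gradient J i (x 0 t) (xh t))" for t
    define ye where "ye = (1 / (\<kappa>\<^sup>2 * \<epsilon> ^ n)) *\<^sub>R fe"
    define X where "X l \<tau> = (1 / \<epsilon> ^ l) *\<^sub>R (x l (\<tau> / \<epsilon>) - (if l = 0 then xs else 0))" for l \<tau>
    define Z where "Z l \<tau> = (1 / \<epsilon> ^ l) *\<^sub>R (z l (\<tau> / \<epsilon>) - (if l = 0 then xs else 0))" for l \<tau>
    define Y where "Y \<tau> = y (\<tau> / \<epsilon>) - ye" for \<tau>
    define G where "G \<tau> = g (\<tau> / \<epsilon>)" for \<tau>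
    define \<Phi> where "\<Phi> \<tau> = (1 / \<epsilon> ^ n) *\<^sub>R (fs (\<tau> / \<epsilon>) - fe)" for \<tau>
    define Q where "Q \<tau> = (\<Sum>j\<in>UNIV. \<Sum>i\<in>UNIV. \<xi> i * (norm (xh (\<tau> / \<epsilon>) $ i $ j - x 0 (\<tau> / \<epsilon>) $ j))\<^sup>2)" for \<tau>
    have dx: "(x l has_vector_derivative x (Suc l) t) (at t within {0..})" if "l < m" "t \<ge> 0" for l t
      using sol that
      by (intro has_vector_derivative_vec) (auto simp: closed_loop_solution_def n)
    have shift: "(\<Sum>l = 1..<n. h l) = (\<Sum>l<m. h (Suc l))" for h :: "nat \<Rightarrow> real ^ 'm"
      unfolding n One_nat_def sum.shift_bounds_Suc_ivl atLeast0LessThan ..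
    have dxm: "(x m has_vector_derivative fs t - (\<Sum>l<m. (\<epsilon> ^ (m - l) * k (Suc l)) *\<^sub>R z (Suc l) t)
        - (\<kappa> * \<epsilon> ^ n) *\<^sub>R g t - (\<kappa>\<^sup>2 * \<epsilon> ^ n) *\<^sub>R y t) (at t within {0..})" if "t \<ge> 0" for t
    proof (rule has_vector_derivative_vec)
      fix i
      have "((\<lambda>s. x m s $ i) has_vector_derivative f i (\<lambda>l. x l t $ i) (w i)
          + control_input n J k (\<kappa> * \<epsilon> ^ n) (\<kappa>\<^sup>2 * \<epsilon> ^ n) \<epsilon> i (x 0 t) (\<lambda>l. z l t) (y t) (xh t)) (at t within {0..})"
        using sol that unfolding closed_loop_solution_def n by simp
      then show "((\<lambda>s. x m s $ i) has_vector_derivative (fs t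
          - (\<Sum>l<m. (\<epsilon> ^ (m - l) * k (Suc l)) *\<^sub>R z (Suc l) t)
          - (\<kappa> * \<epsilon> ^ n) *\<^sub>R g t - (\<kappa>\<^sup>2 * \<epsilon> ^ n) *\<^sub>R y t) $ i) (at t within {0..})"
        by (rule has_vector_derivative_eq_rhs)
          (simp only: control_input_def shift, simp add: fs_def g_def n)
    qed
    have dy: "(y has_vector_derivative (\<Sum>l<m. (k (Suc l) / \<epsilon> ^ l) *\<^sub>R z (Suc l) t)
        + (\<kappa> * \<epsilon>) *\<^sub>R g t) (at t within {0..})" if "t \<ge> 0" for t
    proof (rule has_vector_derivative_vec)
      fix i
      have "((\<lambda>s. y s $ i) has_vector_derivative
          (\<Sum>l = 1..<n. (\<epsilon> powi (1 - int l) * k l) *\<^sub>R z l t $ i)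
          + (\<kappa> * \<epsilon> ^ n / \<epsilon> ^ (n - 1)) *\<^sub>R estimated_gradient J i (x 0 t) (xh t)) (at t within {0..})"
        using sol that unfolding closed_loop_solution_def by simp
      then show "((\<lambda>s. y s $ i) has_vector_derivative
          ((\<Sum>l<m. (k (Suc l) / \<epsilon> ^ l) *\<^sub>R z (Suc l) t) + (\<kappa> * \<epsilon>) *\<^sub>R g t) $ i) (at t within {0..})"
      proof (rule has_vector_derivative_eq_rhs)
        have "\<epsilon> powi (1 - int (Suc l)) * k (Suc l) = k (Suc l) / \<epsilon> ^ l" for l
          by (simp add: power_int_minus divide_inverse)
        moreover have "\<kappa> * \<epsilon> ^ n / \<epsilon> ^ (n - 1) = \<kappa> * \<epsilon>" using \<epsilon>(2) by (simp add: n)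
        ultimately show "(\<Sum>l = 1..<n. (\<epsilon> powi (1 - int l) * k l) *\<^sub>R z l t $ i)
          + (\<kappa> * \<epsilon> ^ n / \<epsilon> ^ (n - 1)) *\<^sub>R estimated_gradient J i (x 0 t) (xh t)
          = ((\<Sum>l<m. (k (Suc l) / \<epsilon> ^ l) *\<^sub>R z (Suc l) t) + (\<kappa> * \<epsilon>) *\<^sub>R g t) $ i"
          by (simp only: shift) (simp add: g_def)
      qed
    qed
    have dz: "(z l has_vector_derivative (if l < m then z (Suc l) t else 0)
        + (\<epsilon> ^ Suc l * \<Gamma> ^ Suc l * \<beta> (Suc l)) *\<^sub>R (x 0 t - z 0 t)) (at t within {0..})"
      if "l \<le> m" "t \<ge> 0" for l t
    proof (rule has_vector_derivative_vec)
      fix i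
      have gain: "\<epsilon> ^ (l + 1) * \<beta> (l + 1) / (1 / \<Gamma>) ^ (l + 1) = \<epsilon> ^ Suc l * \<Gamma> ^ Suc l * \<beta> (Suc l)"
        by (simp add: power_divide)
      have "((\<lambda>s. z l s $ i) has_vector_derivative (if l < m then z (Suc l) t $ i else 0)
          + (\<epsilon> ^ (l + 1) * \<beta> (l + 1) / (1 / \<Gamma>) ^ (l + 1)) *\<^sub>R (x 0 t $ i - z 0 t $ i)) (at t within {0..})"
        using sol that unfolding closed_loop_solution_def n by (cases "l = m") auto
      then show "((\<lambda>s. z l s $ i) has_vector_derivative ((if l < m then z (Suc l) t else 0)
          + (\<epsilon> ^ Suc l * \<Gamma> ^ Suc l * \<beta> (Suc l)) *\<^sub>R (x 0 t - z 0 t)) $ i) (at t within {0..})"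
        unfolding gain by (rule has_vector_derivative_eq_rhs) simp
    qed
    have dxh: "((\<lambda>s. xh s $ i $ j) has_vector_derivative - (\<Gamma> * \<epsilon>) *\<^sub>R
        ((\<Sum>q\<in>UNIV. a i q *\<^sub>R (xh t $ i $ j - xh t $ q $ j)) + a i j *\<^sub>R (xh t $ i $ j - x 0 t $ j)))
        (at t within {0..})" if "t \<ge> 0" for i j t
      using sol that
      by (auto simp: closed_loop_solution_def)

    have "scaled_loop m k \<beta> F c C\<^sub>0 \<kappa> \<Gamma> \<sigma> X Z Y G \<Phi> Q"
      unfolding scaled_loop_def
    proof (intro allI impI conjI)
      fix \<tau> :: real
      assume "\<tau> \<ge> 0"
      define t where "t = \<tau> / \<epsilon>"
      have "t \<ge> 0" using \<open>\<tau> \<ge> 0\<close> \<epsilon> by (simp add: t_def)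
      have scale: "((\<lambda>\<tau>. b *\<^sub>R (h (\<tau> / \<epsilon>) - h0)) has_vector_derivative (b / \<epsilon>) *\<^sub>R D) (at \<tau> within {0..})"
        if "(h has_vector_derivative D) (at t within {0..})" for h h0 D and b :: real
      proof -
        have "((\<lambda>\<tau>. h (\<tau> / \<epsilon>) - h0) has_vector_derivative (1 / \<epsilon>) *\<^sub>R D - 0) (at \<tau> within {0..})"
          using that \<epsilon>(2) unfolding t_def
          by (intro has_vector_derivative_diff has_vector_derivative_time_scale has_vector_derivative_const)
        from bounded_linear.has_vector_derivative[OF bounded_linear_scaleR_right this, of b]
        show ?thesis by simp
      qed
      show "(X l has_vector_derivative X (Suc l) \<tau>) (at \<tau> within {0..})" if "l < m" for l
        using scale[OF dx[OF that \<open>t \<ge> 0\<close>], of "1 / \<epsilon> ^ l" "if l = 0 then xs else 0"]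
        unfolding X_def by (simp add: t_def mult.commute)
      show "(X m has_vector_derivative \<Phi> \<tau> - (\<Sum>l<m. k (Suc l) *\<^sub>R Z (Suc l) \<tau>) - \<kappa> *\<^sub>R G \<tau>
          - \<kappa>\<^sup>2 *\<^sub>R Y \<tau>) (at \<tau> within {0..})"
      proof -
        have "(X m has_vector_derivative (1 / \<epsilon> ^ m / \<epsilon>) *\<^sub>R
            (fs t - (\<Sum>l<m. (\<epsilon> ^ (m - l) * k (Suc l)) *\<^sub>R z (Suc l) t)
              - (\<kappa> * \<epsilon> ^ n) *\<^sub>R g t - (\<kappa>\<^sup>2 * \<epsilon> ^ n) *\<^sub>R y t)) (at \<tau> within {0..})"
          unfolding X_def by (rule scale[OF dxm[OF \<open>t \<ge> 0\<close>]])
        also have "1 / \<epsilon> ^ m / \<epsilon> = 1 / \<epsilon> ^ n" by (simp add: n mult.commute)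
        also have "(1 / \<epsilon> ^ n) *\<^sub>R (fs t - (\<Sum>l<m. (\<epsilon> ^ (m - l) * k (Suc l)) *\<^sub>R z (Suc l) t)
              - (\<kappa> * \<epsilon> ^ n) *\<^sub>R g t - (\<kappa>\<^sup>2 * \<epsilon> ^ n) *\<^sub>R y t)
            = (1 / \<epsilon> ^ n) *\<^sub>R fs t - (1 / \<epsilon> ^ n) *\<^sub>R (\<Sum>l<m. (\<epsilon> ^ (m - l) * k (Suc l)) *\<^sub>R z (Suc l) t)
              - \<kappa> *\<^sub>R g t - \<kappa>\<^sup>2 *\<^sub>R y t"
          using \<epsilon>(2) by (simp add: scaleR_diff_right)
        also have "(1 / \<epsilon> ^ n) *\<^sub>R (\<Sum>l<m. (\<epsilon> ^ (m - l) * k (Suc l)) *\<^sub>R z (Suc l) t)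
            = (\<Sum>l<m. k (Suc l) *\<^sub>R Z (Suc l) \<tau>)"
          unfolding scaleR_sum_right
        proof (rule sum.cong[OF refl])
          fix l assume "l \<in> {..<m}"
          then have "\<epsilon> ^ n = \<epsilon> ^ (m - l) * \<epsilon> ^ Suc l" by (simp add: n flip: power_add)
          then have "1 / \<epsilon> ^ n * (\<epsilon> ^ (m - l) * k (Suc l)) = k (Suc l) * (1 / \<epsilon> ^ Suc l)"
            using \<epsilon>(2) by simp
          then show "(1 / \<epsilon> ^ n) *\<^sub>R (\<epsilon> ^ (m - l) * k (Suc l)) *\<^sub>R z (Suc l) t = k (Suc l) *\<^sub>R Z (Suc l) \<tau>"
            by (simp only: scaleR_scaleR) (simp add: Z_def t_def)
        qed
        also have "\<kappa>\<^sup>2 *\<^sub>R y t = \<kappa>\<^sup>2 *\<^sub>R Y \<tau> + (1 / \<epsilon> ^ n) *\<^sub>R fe"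
          using pos(1) by (simp add: Y_def ye_def t_def scaleR_diff_right)
        finally show ?thesis
          by (simp add: \<Phi>_def G_def t_def scaleR_diff_right algebra_simps)
      qed
      show "(Y has_vector_derivative (\<Sum>l<m. k (Suc l) *\<^sub>R Z (Suc l) \<tau>) + \<kappa> *\<^sub>R G \<tau>) (at \<tau> within {0..})"
      proof -
        have "(Y has_vector_derivative (1 / \<epsilon>) *\<^sub>R ((\<Sum>l<m. (k (Suc l) / \<epsilon> ^ l) *\<^sub>R z (Suc l) t)
            + (\<kappa> * \<epsilon>) *\<^sub>R g t)) (at \<tau> within {0..})"
          using scale[OF dy[OF \<open>t \<ge> 0\<close>], of 1 ye] by (simp add: Y_def[abs_def])
        also have "(1 / \<epsilon>) *\<^sub>R ((\<Sum>l<m. (k (Suc l) / \<epsilon> ^ l) *\<^sub>R z (Suc l) t) + (\<kappa> * \<epsilon>) *\<^sub>R g t)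
            = (\<Sum>l<m. k (Suc l) *\<^sub>R Z (Suc l) \<tau>) + \<kappa> *\<^sub>R G \<tau>"
          using \<epsilon>(2) by (simp add: scaleR_add_right scaleR_sum_right Z_def G_def t_def mult.commute)
        finally show ?thesis .
      qed
      show "(Z l has_vector_derivative (if l < m then Z (Suc l) \<tau> else 0)
          + (\<Gamma> ^ Suc l * \<beta> (Suc l)) *\<^sub>R (X 0 \<tau> - Z 0 \<tau>)) (at \<tau> within {0..})" if "l \<le> m" for l
      proof -
        have "(Z l has_vector_derivative (1 / \<epsilon> ^ l / \<epsilon>) *\<^sub>R ((if l < m then z (Suc l) t else 0)
            + (\<epsilon> ^ Suc l * \<Gamma> ^ Suc l * \<beta> (Suc l)) *\<^sub>R (x 0 t - z 0 t))) (at \<tau> within {0..})"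
          unfolding Z_def by (rule scale[OF dz[OF that \<open>t \<ge> 0\<close>]])
        also have "1 / \<epsilon> ^ l / \<epsilon> = 1 / \<epsilon> ^ Suc l" by (simp add: mult.commute)
        also have "(1 / \<epsilon> ^ Suc l) *\<^sub>R ((if l < m then z (Suc l) t else 0)
            + (\<epsilon> ^ Suc l * \<Gamma> ^ Suc l * \<beta> (Suc l)) *\<^sub>R (x 0 t - z 0 t))
            = (1 / \<epsilon> ^ Suc l) *\<^sub>R (if l < m then z (Suc l) t else 0)
              + (\<Gamma> ^ Suc l * \<beta> (Suc l)) *\<^sub>R (x 0 t - z 0 t)"
          using \<epsilon>(2) by (simp add: scaleR_add_right)
        also have "\<dots> = (if l < m then Z (Suc l) \<tau> else 0) + (\<Gamma> ^ Suc l * \<beta> (Suc l)) *\<^sub>R (X 0 \<tau> - Z 0 \<tau>)"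
          by (simp add: X_def Z_def t_def)
        finally show ?thesis .
      qed
      show "norm (\<Phi> \<tau>) \<le> \<sigma> * (\<Sum>l\<le>m. norm (X l \<tau>))"
      proof -
        have "norm (fs t - fe) \<le> N * (\<Sum>l\<le>m. norm (x l t - (if l = 0 then xs else 0)))"
          unfolding fs_def fe_def N_def
        proof (rule stacked_lipschitz)
          fix i and \<zeta> \<eta> :: "nat \<Rightarrow> real ^ 'm"
          have "(\<Sum>l = 1..<n. lxd l * norm (\<zeta> l - \<eta> l))
              = (\<Sum>l<m. L (Suc l) * norm (\<zeta> (Suc l) - \<eta> (Suc l)))"
            unfolding n One_nat_def sum.shift_bounds_Suc_ivl atLeast0LessThan by (simp add: L_def)
          then show "norm (f i \<zeta> (w i) - f i \<eta> (w i)) \<le> L 0 * norm (\<zeta> 0 - \<eta> 0)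
              + (\<Sum>l<m. L (Suc l) * norm (\<zeta> (Suc l) - \<eta> (Suc l)))"
            using assms(7)[of i \<zeta> \<eta>] by (simp add: L_def)
        qed (rule L)
        also have "\<dots> \<le> N * (\<Sum>l\<le>m. \<epsilon> ^ m * norm (X l \<tau>))"
        proof (intro mult_left_mono sum_mono \<open>N \<ge> 0\<close>)
          fix l assume "l \<in> {..m}"
          have "norm (x l t - (if l = 0 then xs else 0)) = \<epsilon> ^ l * norm (X l \<tau>)"
            using \<epsilon>(2) by (simp add: X_def t_def)
          also have "\<dots> \<le> \<epsilon> ^ m * norm (X l \<tau>)"
            using \<epsilon>(1) \<open>l \<in> {..m}\<close> by (intro mult_right_mono power_increasing) auto
          finally show "norm (x l t - (if l = 0 then xs else 0)) \<le> \<epsilon> ^ m * norm (X l \<tau>)" .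
        qed
        finally have "1 / \<epsilon> ^ n * norm (fs t - fe) \<le> 1 / \<epsilon> ^ n * \<dots>"
          using \<epsilon>(2) by (intro mult_left_mono) auto
        also have "\<dots> = N / \<epsilon> * (\<Sum>l\<le>m. norm (X l \<tau>))"
          using \<epsilon>(2) by (simp add: n sum_distrib_left[symmetric])
        also have "\<dots> \<le> \<sigma> * (\<Sum>l\<le>m. norm (X l \<tau>))"
          using \<epsilon>(3) by (intro mult_right_mono sum_nonneg) auto
        finally show ?thesis using \<epsilon>(2) by (simp add: \<Phi>_def t_def)
      qed
      show "0 \<le> Q \<tau>"
        unfolding Q_def by (intro sum_nonneg mult_nonneg_nonneg \<xi>) auto
      with C0(2) have "\<theta>\<^sup>2 * Q \<tau> \<le> C\<^sub>0 * Q \<tau>" by (rule mult_right_mono)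
      moreover have "(norm (G \<tau> - F (X 0 \<tau>)))\<^sup>2 \<le> \<theta>\<^sup>2 * Q \<tau>"
        using estimated_gradient_error[OF lip \<xi>, where x = "x 0 t" and xh = "xh t"]
        by (simp add: G_def g_def F_def X_def Q_def t_def)
      ultimately show "(norm (G \<tau> - F (X 0 \<tau>)))\<^sup>2 \<le> C\<^sub>0 * Q \<tau>" by linarith
      show "\<exists>D. (Q has_real_derivative D) (at \<tau> within {0..}) \<and>
          D \<le> - (c * \<Gamma> * Q \<tau>) + C\<^sub>0 / \<Gamma> * (norm V)\<^sup>2"
        if "(X 0 has_vector_derivative V) (at \<tau> within {0..})" for V
      proof -
        define e where "e i j \<tau> = xh (\<tau> / \<epsilon>) $ i $ j - x 0 (\<tau> / \<epsilon>) $ j" for i j \<tau>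
        have "(e i j has_vector_derivative
            - (\<Gamma> *\<^sub>R ((\<Sum>q\<in>UNIV. a i q *\<^sub>R (e i j \<tau> - e q j \<tau>)) + a i j *\<^sub>R e i j \<tau>)) - V $ j)
            (at \<tau> within {0..})" for i j
        proof -
          have "((\<lambda>\<tau>. (X 0 \<tau> + xs) $ j) has_vector_derivative (V + 0) $ j) (at \<tau> within {0..})"
            by (intro bounded_linear.has_vector_derivative[OF bounded_linear_vec_nth]
                has_vector_derivative_add that has_vector_derivative_const)
          moreover have "((\<lambda>\<tau>. xh (\<tau> / \<epsilon>) $ i $ j) has_vector_derivative (1 / \<epsilon>) *\<^sub>R (- (\<Gamma> * \<epsilon>) *\<^sub>R
              ((\<Sum>q\<in>UNIV. a i q *\<^sub>R (xh t $ i $ j - xh t $ q $ j)) + a i j *\<^sub>R (xh t $ i $ j - x 0 t $ j))))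
              (at \<tau> within {0..})"
            using dxh[OF \<open>t \<ge> 0\<close>, of i j] \<epsilon>(2) unfolding t_def by (rule has_vector_derivative_time_scale)
          ultimately have "((\<lambda>\<tau>. xh (\<tau> / \<epsilon>) $ i $ j - (X 0 \<tau> + xs) $ j) has_vector_derivative
              (1 / \<epsilon>) *\<^sub>R (- (\<Gamma> * \<epsilon>) *\<^sub>R ((\<Sum>q\<in>UNIV. a i q *\<^sub>R (xh t $ i $ j - xh t $ q $ j))
                + a i j *\<^sub>R (xh t $ i $ j - x 0 t $ j))) - (V + 0) $ j) (at \<tau> within {0..})"
            by (intro has_vector_derivative_diff)
          then show ?thesis using \<epsilon>(2) by (simp add: e_def[abs_def] X_def t_def)
        qed
        from consensus_energy_deriv[OF \<open>c > 0\<close> pos(2) \<xi>(1) coercive this]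
        obtain D where D: "(Q has_real_derivative D) (at \<tau> within {0..})"
          and le: "D \<le> - (c * \<Gamma> * Q \<tau>) + (\<Sum>i\<in>UNIV. \<xi> i) / c / \<Gamma> * (norm V)\<^sup>2"
          unfolding Q_def[abs_def] e_def norm_vec_power2[of V] by blast
        have "(\<Sum>i\<in>UNIV. \<xi> i) / c / \<Gamma> * (norm V)\<^sup>2 \<le> C\<^sub>0 / \<Gamma> * (norm V)\<^sup>2"
          using C0(3) pos(2) by (intro mult_right_mono divide_right_mono) auto
        with D le show ?thesis by force
      qed
    qed
    from decay[OF this] obtain C where "C > 0"
      and C: "\<And>\<tau>. \<tau> \<ge> 0 \<Longrightarrow> norm (X 0 \<tau>) \<le> C * exp (- (r * \<tau>))" by blast
    have "norm (x 0 t - xs) \<le> C * exp (- (r * \<epsilon>) * t)" if "t \<ge> 0" for t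
      using C[of "\<epsilon> * t"] that \<epsilon> by (simp add: X_def mult.assoc)
    with \<open>C > 0\<close> show ?thesis by blast
  qed
  note stable = this
  have gains: "\<kappa> * \<epsilon> ^ n > 0" "\<kappa>\<^sup>2 * \<epsilon> ^ n > 0" "\<Gamma> * \<epsilon> > 0" "1 / \<Gamma> > 0" "r * \<epsilon> > 0"
    using pos \<epsilon> by auto
  show ?thesis
  proof (intro exI[of _ xs] conjI allI impI)
    show "nash_equilibrium J xs" using nash xs by blast
    show "x = xs" if "nash_equilibrium J x" for x using nash unique that by blast
    show "\<exists>\<alpha>\<^sub>1>0. \<exists>\<alpha>\<^sub>2>0. \<exists>\<alpha>\<^sub>3>0. \<exists>\<epsilon>>0. \<exists>\<mu>>0. \<exists>\<Lambda>>0. \<forall>x z y xh.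
      closed_loop_solution n a J f w k \<beta> \<alpha>\<^sub>1 \<alpha>\<^sub>2 \<alpha>\<^sub>3 \<epsilon> \<mu> x z y xh \<longrightarrow>
      (\<exists>C>0. \<forall>t\<ge>0. norm (x 0 t - xs) \<le> C * exp (- \<Lambda> * t))"
      by (rule exI[of _ "\<kappa> * \<epsilon> ^ n"], rule conjI[OF gains(1)],
          rule exI[of _ "\<kappa>\<^sup>2 * \<epsilon> ^ n"], rule conjI[OF gains(2)],
          rule exI[of _ "\<Gamma> * \<epsilon>"], rule conjI[OF gains(3)], rule exI[of _ \<epsilon>], rule conjI[OF \<epsilon>(2)],
          rule exI[of _ "1 / \<Gamma>"], rule conjI[OF gains(4)], rule exI[of _ "r * \<epsilon>"], rule conjI[OF gains(5)])
        (intro allI impI, rule stable)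
  qed
qed

end
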